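(* Let $(M,d)$ be a metric space. If $M$ contains a thick family of geodesics, then for any sequence $(\delta_i')_{i=0}^\infty$ of positive real numbers, $M$ contains a thick inverse system with $\delta_i^E\le\delta_i'$ and $\delta_i^d\le\delta_i'$ for every $i\ge0$.
   Context: Thick families. A $p$-$q$ geodesic is an isometric embedding of a compact interval sending the left endpoint to $p$ and the right endpoint to $q$. A nonempty family $\Gamma$ of $p$-$q$ geodesics with common domain $[a,b]$ is concatenation closed if whenever $\gamma_1,\gamma_2\in\Gamma$, $c\in[a,b]$, $\gamma_1(c)=\gamma_2(c)$, the curve equal to $\gamma_1$ on $[a,c]$ and $\gamma_2$ on $[c,b]$ is in $\Gamma$. It is a thick family of geodesics if moreover there is $\alpha'>0$ such that for every $\gamma\in\Gamma$ and $a=t_0<\dots<t_k=b$ there exist $a=q_0<s_1<q_1<\dots<s_j<q_j=b$ and $\tilde\gamma\in\Gamma$ with $\{t_i\}\subseteq\{q_i\}$, $\gamma(q_i)=\tilde\gamma(q_i)$ for all $i$, and $\sum_{i=1}^jd(\gamma(s_i),\tilde\gamma(s_i))\ge\alpha'$. Graphs. A finite metric graph is a metric space $X$ with a finite vertex set $V(X)\subseteq X$ and a finite set $E(X)$ of subsets (edges) covering $X$, each edge isometric to a compact interval whose endpoints (and no interior points) correspond to vertices, two distinct edges being disjoint or meeting in one or two vertices. It is directed if each edge has a chosen order (source, sink) of its two vertices. $|A|$ denotes length measure of $A$. Thick inverse system. A sequence $X_0\subseteq X_1\subseteq\cdots$ of finite directed metric graphs, all carrying restrictions of one metric $d$, with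 maps $\pi_i^{i+1}:X_{i+1}\to X_i$, such that for all $i\ge0$: (A1) $X_0$ has two vertices $0,1$ and one edge, of length $1$, directed from $0$ to $1$. (A2) There is a directed subdivision $X_i'$ of $X_i$ such that for each $e'\in E(X_i')$, $(\pi_i^{i+1})^{-1}(e')=e'\cup e'_{\rm op}$, where $e'$ and $e'_{\rm op}$ are edges of $X_{i+1}$ and either $e'_{\rm op}=e'$ (the preimage is then called an interval) or $e'_{\rm op}$ has the same source and sink as $e'$ and its interior is disjoint from the rest of $X_{i+1}$ (the preimage is then called a circle). A subedge $e'\in E(X_i')$ of $e\in E(X_i)$ sharing a vertex with $e$ is called terminal, and the preimage of a terminal subedge is an interval. (A3) Every directed edge path of $X_i$ is isometric (for $d$) to a compact interval. (A4) $\pi_i^{i+1}$ is the identity on each $e'\in E(X_i')$ and maps $e'_{\rm op}$ isometrically onto $e'$. For $p\in e'$, $p^{\rm op}$ is the unique point of $e'_{\rm op}$ with $\pi_i^{i+1}(p^{\rm op})=p$. (A5) There is $\alpha>0$ independent of $i$ with $\max_{p\in e'}d(p,p^{\rm op})\ge\alpha|e'|$ for every $e'\in E(X_i')$ whose preimage is a circle. (A6) There is $\beta>0$ independent of $i$ such that for every directed edge path $P$ from $0$ to $1$ in $X_i'$, the edges $e'\subseteq P$ whose preimage is a circle have total length at least $\beta$. The system carries probability measures $\mu_i$: $\mu_0$ is length measure; $\mu_{i+1}$ is a constant multiple of length measure on each edge, with $\mu_{i+1}(e')=\mu_i(e')$ if $e'_{\rm op}=e'$ and $\mu_{i+1}(e')=\mu_{i+1}(e'_{\rm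 op})=\frac12\mu_i(e')$ otherwise. $M$ contains the system if all $X_i\subseteq M$ with $d$ the metric of $M$. Parameters. $\Delta_i^E=\min_{e\in E(X_i)}|e|$, $\delta_i^E=\max_{e'\in E(X_i')}|e'|/\Delta_i^E$. $\Delta_i^d$ is the minimum of $d(e',X_i\setminus e)$ over $e\in E(X_i)$ and nonterminal subedges $e'\in E(X_i')$ of $e$ (distance to $\emptyset$ being $+\infty$), and $\delta_i^d=\max|e'|/\Delta_i^d$ over nonterminal $e'\in E(X_i')$.
   Formalization: Since (A1) needs an edge of length 1, which a space of diameter below 1 cannot contain, the system is obtained for the rescaled metric d/r for every 0 < r ≤ d(p,q); r = 1 (the metric d itself) is covered when d(p,q) ≥ 1. *)

theory Defs
  imports "HOL-Analysis.Analysis" "HOL-Probability.Probability"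
begin

section \<open>Thick families of geodesics\<close>

definition isometric_on_interval :: "('a \<Rightarrow> 'a \<Rightarrow> real) \<Rightarrow> real \<Rightarrow> real \<Rightarrow> (real \<Rightarrow> 'a) \<Rightarrow> bool" where
  "isometric_on_interval d a b \<gamma> \<longleftrightarrow> (\<forall>s\<in>{a..b}. \<forall>t\<in>{a..b}. d (\<gamma> s) (\<gamma> t) = \<bar>s - t\<bar>)"

text \<open>Curves with domain \<open>[a,b]\<close> are extensional functions, so that equality of curves is
  equality on \<open>[a,b]\<close>.\<close>

definition geodesic ::
    "'a set \<Rightarrow> ('a \<Rightarrow> 'a \<Rightarrow> real) \<Rightarrow> 'a \<Rightarrow> 'a \<Rightarrow> real \<Rightarrow> real \<Rightarrow> (real \<Rightarrow> 'a) \<Rightarrow> bool" where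
  "geodesic M d p q a b \<gamma> \<longleftrightarrow>
     a \<le> b \<and> \<gamma> \<in> {a..b} \<rightarrow>\<^sub>E M \<and> isometric_on_interval d a b \<gamma> \<and> \<gamma> a = p \<and> \<gamma> b = q"

definition concatenation_closed :: "real \<Rightarrow> real \<Rightarrow> (real \<Rightarrow> 'a) set \<Rightarrow> bool" where
  "concatenation_closed a b \<Gamma> \<longleftrightarrow>
     (\<forall>\<gamma>\<^sub>1\<in>\<Gamma>. \<forall>\<gamma>\<^sub>2\<in>\<Gamma>. \<forall>c\<in>{a..b}. \<gamma>\<^sub>1 c = \<gamma>\<^sub>2 c \<longrightarrow>
        restrict (\<lambda>t. if t \<le> c then \<gamma>\<^sub>1 t else \<gamma>\<^sub>2 t) {a..b} \<in> \<Gamma>)"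

text \<open>For \<open>a = b\<close> the only partition has \<open>k = 0\<close>, which forces \<open>j = 0\<close> and an empty sum; so a thick
  family always has \<open>a < b\<close>.\<close>

definition thick_family ::
    "'a set \<Rightarrow> ('a \<Rightarrow> 'a \<Rightarrow> real) \<Rightarrow> 'a \<Rightarrow> 'a \<Rightarrow> real \<Rightarrow> real \<Rightarrow> (real \<Rightarrow> 'a) set \<Rightarrow> bool" where
  "thick_family M d p q a b \<Gamma> \<longleftrightarrow>
     \<Gamma> \<noteq> {} \<and> (\<forall>\<gamma>\<in>\<Gamma>. geodesic M d p q a b \<gamma>) \<and> concatenation_closed a b \<Gamma> \<and>
     (\<exists>\<alpha>'>0. \<forall>\<gamma>\<in>\<Gamma>. \<forall>(k::nat) (t::nat \<Rightarrow> real).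
        t 0 = a \<and> t k = b \<and> (\<forall>i<k. t i < t (Suc i)) \<longrightarrow>
        (\<exists>(j::nat) (u::nat \<Rightarrow> real) (s::nat \<Rightarrow> real). \<exists>\<gamma>'\<in>\<Gamma>.
           u 0 = a \<and> u j = b \<and> (\<forall>i<j. u i < s (Suc i) \<and> s (Suc i) < u (Suc i)) \<and>
           t ` {0..k} \<subseteq> u ` {0..j} \<and> (\<forall>i\<le>j. \<gamma> (u i) = \<gamma>' (u i)) \<and>
           (\<Sum>i=1..j. d (\<gamma> (s i)) (\<gamma>' (s i))) \<ge> \<alpha>'))"

section \<open>Finite directed metric graphs\<close>

record 'a graph =
  pts :: "'a set"
  verts :: "'a set"
  edges :: "'a set set"
  src :: "'a set \<Rightarrow> 'a"
  snk :: "'a set \<Rightarrow> 'a"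

definition finite_metric_graph :: "('a \<Rightarrow> 'a \<Rightarrow> real) \<Rightarrow> 'a graph \<Rightarrow> bool" where
  "finite_metric_graph d G \<longleftrightarrow>
     Metric_space (pts G) d \<and>
     finite (verts G) \<and> verts G \<subseteq> pts G \<and> finite (edges G) \<and> \<Union>(edges G) = pts G \<and>
     (\<forall>e\<in>edges G. \<exists>a b \<phi>. a < b \<and> isometric_on_interval d a b \<phi> \<and> \<phi> ` {a..b} = e \<and>
        e \<inter> verts G = {\<phi> a, \<phi> b}) \<and>
     (\<forall>e\<in>edges G. \<forall>f\<in>edges G. e \<noteq> f \<longrightarrow> e \<inter> f \<subseteq> verts G \<and> card (e \<inter> f) \<le> 2)"

definition directed_metric_graph :: "('a \<Rightarrow> 'a \<Rightarrow> real) \<Rightarrow> 'a graph \<Rightarrow> bool" where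
  "directed_metric_graph d G \<longleftrightarrow>
     finite_metric_graph d G \<and>
     (\<forall>e\<in>edges G. src G e \<noteq> snk G e \<and> e \<inter> verts G = {src G e, snk G e})"

text \<open>Length measure \<open>|A|\<close>. On an edge \<open>e\<close>, distance to the source is an isometry onto \<open>[0, |e|]\<close>,
  that is, the inverse of the arc length parametrization; Lebesgue measure is transported along
  it. Vertices are null sets, so counting them in several edges is harmless.\<close>

definition len :: "('a \<Rightarrow> 'a \<Rightarrow> real) \<Rightarrow> 'a graph \<Rightarrow> 'a set \<Rightarrow> real" where
  "len d G A = (\<Sum>e\<in>edges G. measure lborel (d (src G e) ` (A \<inter> e)))"

text \<open>The edges of a directed subdivision inherit the direction of the edge that contains them.\<close>

definition directed_subdivision :: "('a \<Rightarrow> 'a \<Rightarrow> real) \<Rightarrow> 'a graph \<Rightarrow> 'a graph \<Rightarrow> bool" where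
  "directed_subdivision d G G' \<longleftrightarrow>
     directed_metric_graph d G' \<and> pts G' = pts G \<and> verts G \<subseteq> verts G' \<and>
     (\<forall>e'\<in>edges G'. \<exists>e\<in>edges G. e' \<subseteq> e \<and>
        d (src G e) (src G' e') < d (src G e) (snk G' e'))"

definition terminal_subedge :: "'a graph \<Rightarrow> 'a graph \<Rightarrow> 'a set \<Rightarrow> 'a set \<Rightarrow> bool" where
  "terminal_subedge G G' e e' \<longleftrightarrow>
     e \<in> edges G \<and> e' \<in> edges G' \<and> e' \<subseteq> e \<and> {src G' e', snk G' e'} \<inter> {src G e, snk G e} \<noteq> {}"

definition nonterminal_subedge :: "'a graph \<Rightarrow> 'a graph \<Rightarrow> 'a set \<Rightarrow> 'a set \<Rightarrow> bool" where
  "nonterminal_subedge G G' e e' \<longleftrightarrow>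
     e \<in> edges G \<and> e' \<in> edges G' \<and> e' \<subseteq> e \<and> \<not> terminal_subedge G G' e e'"

definition directed_edge_path :: "'a graph \<Rightarrow> 'a set list \<Rightarrow> bool" where
  "directed_edge_path G es \<longleftrightarrow>
     es \<noteq> [] \<and> set es \<subseteq> edges G \<and>
     (\<forall>k. Suc k < length es \<longrightarrow> snk G (es ! k) = src G (es ! Suc k))"

definition directed_edge_path_from_to :: "'a graph \<Rightarrow> 'a \<Rightarrow> 'a \<Rightarrow> 'a set list \<Rightarrow> bool" where
  "directed_edge_path_from_to G x y es \<longleftrightarrow>
     directed_edge_path G es \<and> src G (hd es) = x \<and> snk G (last es) = y"

definition isometric_to_compact_interval :: "('a \<Rightarrow> 'a \<Rightarrow> real) \<Rightarrow> 'a set \<Rightarrow> bool" where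
  "isometric_to_compact_interval d A \<longleftrightarrow>
     (\<exists>a b \<phi>. a \<le> b \<and> isometric_on_interval d a b \<phi> \<and> \<phi> ` {a..b} = A)"

section \<open>Thick inverse systems\<close>

text \<open>\<open>X' i\<close> is the subdivision of \<open>X i\<close>, \<open>opp i e'\<close> is \<open>e'\<^sub>o\<^sub>p\<close>, and \<open>v0\<close>, \<open>v1\<close> are the vertices
  called 0 and 1. The preimage of \<open>e'\<close> is a circle iff \<open>opp i e' \<noteq> e'\<close>.\<close>

definition opp_point :: "('a \<Rightarrow> 'a) \<Rightarrow> 'a set \<Rightarrow> 'a \<Rightarrow> 'a" where
  "opp_point proj e\<^sub>o\<^sub>p p = (THE x. x \<in> e\<^sub>o\<^sub>p \<and> proj x = p)"

locale thick_inverse_system =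
  fixes d :: "'a \<Rightarrow> 'a \<Rightarrow> real"
    and v0 v1 :: 'a
    and X X' :: "nat \<Rightarrow> 'a graph"
    and proj :: "nat \<Rightarrow> 'a \<Rightarrow> 'a"
    and opp :: "nat \<Rightarrow> 'a set \<Rightarrow> 'a set"
    and \<mu> :: "nat \<Rightarrow> 'a measure"
  assumes graph: "\<And>i. directed_metric_graph d (X i)"
    and subset: "\<And>i. pts (X i) \<subseteq> pts (X (Suc i))"
    and proj: "\<And>i. proj i \<in> pts (X (Suc i)) \<rightarrow> pts (X i)"
    and A1: "v0 \<noteq> v1" "verts (X 0) = {v0, v1}" "edges (X 0) = {pts (X 0)}"
      "src (X 0) (pts (X 0)) = v0" "snk (X 0) (pts (X 0)) = v1" "len d (X 0) (pts (X 0)) = 1"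
    and A2_subdivision: "\<And>i. directed_subdivision d (X i) (X' i)"
    and A2_preimage: "\<And>i e'. e' \<in> edges (X' i) \<Longrightarrow>
      {x \<in> pts (X (Suc i)). proj i x \<in> e'} = e' \<union> opp i e'"
    and A2_edges: "\<And>i e'. e' \<in> edges (X' i) \<Longrightarrow>
      e' \<in> edges (X (Suc i)) \<and> opp i e' \<in> edges (X (Suc i)) \<and>
      src (X (Suc i)) e' = src (X' i) e' \<and> snk (X (Suc i)) e' = snk (X' i) e'"
    and A2_circle: "\<And>i e'. e' \<in> edges (X' i) \<Longrightarrow> opp i e' \<noteq> e' \<Longrightarrow>
      src (X (Suc i)) (opp i e') = src (X (Suc i)) e' \<and>
      snk (X (Suc i)) (opp i e') = snk (X (Suc i)) e' \<and>
      (\<forall>f\<in>edges (X (Suc i)). f \<noteq> opp i e' \<longrightarrow>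
         (opp i e' - {src (X (Suc i)) (opp i e'), snk (X (Suc i)) (opp i e')}) \<inter> f = {})"
    and A2_terminal: "\<And>i e e'. terminal_subedge (X i) (X' i) e e' \<Longrightarrow> opp i e' = e'"
    and A3: "\<And>i es. directed_edge_path (X i) es \<Longrightarrow> isometric_to_compact_interval d (\<Union>(set es))"
    and A4_identity: "\<And>i e' x. e' \<in> edges (X' i) \<Longrightarrow> x \<in> e' \<Longrightarrow> proj i x = x"
    and A4_isometry: "\<And>i e'. e' \<in> edges (X' i) \<Longrightarrow>
      proj i ` opp i e' = e' \<and>
      (\<forall>x\<in>opp i e'. \<forall>y\<in>opp i e'. d (proj i x) (proj i y) = d x y)"
    and A5: "\<exists>\<alpha>>0. \<forall>i. \<forall>e'\<in>edges (X' i). opp i e' \<noteq> e' \<longrightarrow>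
      (\<exists>p\<in>e'. d p (opp_point (proj i) (opp i e') p) \<ge> \<alpha> * len d (X i) e')"
    and A6: "\<exists>\<beta>>0. \<forall>i es. directed_edge_path_from_to (X' i) v0 v1 es \<longrightarrow>
      (\<Sum>e' | e' \<in> edges (X' i) \<and> e' \<subseteq> \<Union>(set es) \<and> opp i e' \<noteq> e'. len d (X i) e') \<ge> \<beta>"
    and mu_prob: "\<And>i. prob_space (\<mu> i)"
    and mu_space: "\<And>i. space (\<mu> i) = pts (X i)"
    and mu_sets: "\<And>i. sets (\<mu> i) =
      sigma_sets (pts (X i)) {U. openin (Metric_space.mtopology (pts (X i)) d) U}"
    and mu_0: "\<And>A. A \<in> sets (\<mu> 0) \<Longrightarrow> measure (\<mu> 0) A = len d (X 0) A"
    and mu_Suc_length: "\<And>i e. e \<in> edges (X (Suc i)) \<Longrightarrow>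
      \<exists>c. \<forall>A\<in>sets (\<mu> (Suc i)). A \<subseteq> e \<longrightarrow> measure (\<mu> (Suc i)) A = c * len d (X (Suc i)) A"
    and mu_Suc_interval: "\<And>i e'. e' \<in> edges (X' i) \<Longrightarrow> opp i e' = e' \<Longrightarrow>
      measure (\<mu> (Suc i)) e' = measure (\<mu> i) e'"
    and mu_Suc_circle: "\<And>i e'. e' \<in> edges (X' i) \<Longrightarrow> opp i e' \<noteq> e' \<Longrightarrow>
      measure (\<mu> (Suc i)) e' = measure (\<mu> i) e' / 2 \<and>
      measure (\<mu> (Suc i)) (opp i e') = measure (\<mu> i) e' / 2"

section \<open>Parameters\<close>

definition Delta_E :: "('a \<Rightarrow> 'a \<Rightarrow> real) \<Rightarrow> 'a graph \<Rightarrow> real" where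
  "Delta_E d G = Min (len d G ` edges G)"

definition delta_E :: "('a \<Rightarrow> 'a \<Rightarrow> real) \<Rightarrow> 'a graph \<Rightarrow> 'a graph \<Rightarrow> real" where
  "delta_E d G G' = Max (len d G ` edges G') / Delta_E d G"

text \<open>The values lie in \<open>[0,\<infinity>]\<close> because the distance to the empty set is \<open>\<infinity>\<close>; this occurs for
  the single-edge graph \<open>X 0\<close>, where \<open>Delta_d\<close> is \<open>\<infinity>\<close> and \<open>delta_d\<close> is \<open>0\<close>.\<close>

definition set_distance :: "('a \<Rightarrow> 'a \<Rightarrow> real) \<Rightarrow> 'a set \<Rightarrow> 'a set \<Rightarrow> ennreal" where
  "set_distance d A B = (INF x\<in>A. INF y\<in>B. ennreal (d x y))"

definition Delta_d :: "('a \<Rightarrow> 'a \<Rightarrow> real) \<Rightarrow> 'a graph \<Rightarrow> 'a graph \<Rightarrow> ennreal" where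
  "Delta_d d G G' =
     (INF (e, e')\<in>{(e, e'). nonterminal_subedge G G' e e'}. set_distance d e' (pts G - e))"

definition delta_d :: "('a \<Rightarrow> 'a \<Rightarrow> real) \<Rightarrow> 'a graph \<Rightarrow> 'a graph \<Rightarrow> ennreal" where
  "delta_d d G G' =
     (SUP e'\<in>{e'. \<exists>e. nonterminal_subedge G G' e e'}. ennreal (len d G e')) / Delta_d d G G'"

text \<open>\<open>M\<close>, with the metric \<open>d\<close>, contains a thick inverse system with \<open>\<delta>\<^sub>i\<^sup>E \<le> \<delta>' i\<close> and
  \<open>\<delta>\<^sub>i\<^sup>d \<le> \<delta>' i\<close> for all \<open>i\<close>.\<close>

definition contains_thick_inverse_system ::
    "'a set \<Rightarrow> ('a \<Rightarrow> 'a \<Rightarrow> real) \<Rightarrow> (nat \<Rightarrow> real) \<Rightarrow> bool" where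
  "contains_thick_inverse_system M d \<delta>' \<longleftrightarrow>
     (\<exists>v0 v1 X X' proj opp \<mu>.
        thick_inverse_system d v0 v1 X X' proj opp \<mu> \<and>
        (\<forall>i. pts (X i) \<subseteq> M) \<and>
        (\<forall>i. delta_E d (X i) (X' i) \<le> \<delta>' i \<and> delta_d d (X i) (X' i) \<le> ennreal (\<delta>' i)))"

end

theory Submission
  imports Defs
begin

text \<open>Cut and concatenate to pass to a subfamily of curves of length \<open>r\<close> that is still thick, and rescale
  to \<open>[0,1]\<close>. All points are then ordered by their height \<open>d v0\<close>, and a graph is determined by its
  edges, which are pieces of curves of the family; directed paths are geodesics because curves of the
  family that meet can be concatenated. To build the next graph, a finite set of heights is chosen on
  each edge; thickness says that every curve admits such a set for which the gaps carrying a detour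
  (\<open>good_gap\<close>) have total length at least \<open>\<alpha>\<close>. On each edge one takes a set whose total is at least half
  of the supremum. This choice is local, yet (A6) holds for every path because a set for the whole path
  restricts to competitors on its edges. Leaving out a small terminal piece of each edge, the rest of the
  edge has positive distance from the other edges, so detours of much smaller length avoid each other
  and the old graph.\<close>

section \<open>Gaps of finite sets of reals\<close>

text \<open>The obstacle is that the total length of the good gaps is not monotone: an added point
  may split a gap that carries a detour. Sets that suit different directed paths can therefore not
  be merged into one, although such paths share edges. Hence each edge is optimised alone, among the
  sets that contain a fixed grid \<open>G e\<close>. Thickness allows any finite set to be
  prescribed, so for a given path it can be applied to a set that contains all grids and all end
  heights of edges; each gap then lies in one edge, and the gaps in that edge form a competitor
  there. The terminal pieces cost at most half of \<alpha> and near-optimality costs a factor 2,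
  which gives the bound \<open>\<alpha> / 4\<close> in (A6). As detours are always taken from the
  original family, no constant deteriorates with the stage. A detour over a gap of length at most
  \<open>m\<close> stays within \<open>2 * m\<close> of its edge at equal heights, so a separation
  larger than \<open>4 * m\<close> keeps two detours apart.\<close>

definition gaps :: "real set \<Rightarrow> (real \<times> real) set" where
  "gaps T = {(s, t). s \<in> T \<and> t \<in> T \<and> s < t \<and> T \<inter> {s<..<t} = {}}"

lemma gapsD:
  assumes "(s, t) \<in> gaps T"
  shows "s \<in> T" "t \<in> T" "s < t" "\<And>u. u \<in> T \<Longrightarrow> u \<le> s \<or> t \<le> u"
  using assms by (auto simp: gaps_def disjoint_iff not_less)

lemma gapsI:
  assumes "s \<in> T" "t \<in> T" "s < t" "\<And>u. u \<in> T \<Longrightarrow> s < u \<Longrightarrow> u < t \<Longrightarrow> False"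
  shows "(s, t) \<in> gaps T"
  using assms by (auto simp: gaps_def)

lemma finite_gaps: "finite T \<Longrightarrow> finite (gaps T)"
  by (rule finite_subset[of _ "T \<times> T"]) (auto simp: gaps_def)

lemma gaps_eqI:
  assumes "(s, t) \<in> gaps T" "(s', t') \<in> gaps T" "s < t'" "s' < t"
  shows "s = s' \<and> t = t'"
  using gapsD[OF assms(1)] gapsD[OF assms(2)] assms(3,4)
  by (meson antisym not_less)

lemma gap_around:
  assumes "finite T" "x \<in> T" "y \<in> T" "x < u" "u < y" "u \<notin> T"
  obtains s t where "(s, t) \<in> gaps T" "s < u" "u < t" "x \<le> s" "t \<le> y"
proof -
  let ?s = "Max {v \<in> T. v < u}" and ?t = "Min {v \<in> T. u < v}"
  have s: "?s \<in> {v \<in> T. v < u}" by (rule Max_in) (use assms in auto)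
  have t: "?t \<in> {v \<in> T. u < v}" by (rule Min_in) (use assms in auto)
  have "x \<le> ?s" "?t \<le> y" using assms by (auto intro: Max_ge Min_le)
  moreover have "(?s, ?t) \<in> gaps T"
  proof (rule gapsI)
    fix v assume v: "v \<in> T" "?s < v" "v < ?t"
    show False
    proof (cases "v < u")
      case True
      then have "v \<le> ?s" using assms v by (intro Max_ge) auto
      then show False using v by simp
    next
      case False
      then have "u < v" using v assms by (metis linorder_neqE)
      then have "?t \<le> v" using assms v by (intro Min_le) auto
      then show False using v by simp
    qed
  qed (use s t in auto)
  ultimately show thesis using that s t by blast
qed

text \<open>Telescoping: a new maximum \<open>b\<close> adds exactly the gap
  \<open>(Max T, b)\<close>.\<close>

lemma sum_gaps:
  assumes "finite T" "T \<noteq> {}"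
  shows "(\<Sum>(s, t)\<in>gaps T. t - s) = Max T - Min T"
  using assms
proof (induction T rule: finite_linorder_max_induct)
  case (insert b T)
  show ?case
  proof (cases "T = {}")
    case True
    have "gaps {b} = {}" by (auto simp: gaps_def)
    then show ?thesis using True by simp
  next
    case False
    have m: "Max T \<in> T" "Max T < b" "\<And>u. u \<in> T \<Longrightarrow> u \<le> Max T"
      using insert False by auto
    have "gaps (insert b T) = insert (Max T, b) (gaps T)"
    proof (intro set_eqI iffI)
      fix x assume "x \<in> gaps (insert b T)"
      then obtain s t where x: "x = (s, t)" "(s, t) \<in> gaps (insert b T)" by (cases x) auto
      note st = gapsD[OF x(2)]
      have "s \<in> T" using st insert(2) by fastforce
      show "x \<in> insert (Max T, b) (gaps T)"
      proof (cases "t = b")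
        case True
        then show ?thesis using st(1-3) st(4)[of "Max T"] m(1,2) insert(1) \<open>s \<in> T\<close> x
            by (metis Max_ge insertCI insertI1 leD order_antisym)
      next
        case False
        then have "(s, t) \<in> gaps T" using st \<open>s \<in> T\<close> by (intro gapsI) (auto dest: leD)
        then show ?thesis using x by simp
      qed
    next
      fix x assume "x \<in> insert (Max T, b) (gaps T)"
      then show "x \<in> gaps (insert b T)"
      proof
        assume x: "x = (Max T, b)"
        show ?thesis unfolding x using m by (intro gapsI) (auto dest: leD)
      next
        assume "x \<in> gaps T"
        then obtain s t where x: "x = (s, t)" "(s, t) \<in> gaps T" by (cases x) auto
        note st = gapsD[OF x(2)]
        show ?thesis unfolding x(1) using st insert(2) by (intro gapsI) (auto dest: leD)
      qed
    qed
    moreover have "(Max T, b) \<notin> gaps T" using insert(2) by (auto simp: gaps_def)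
    moreover have "Max (insert b T) = b" "Min (insert b T) = Min T"
    proof -
      show "Max (insert b T) = b" by (rule Max_eqI) (use insert in \<open>auto simp: less_imp_le\<close>)
      have "Min T \<le> b" using insert(1,2) False by (metis Min_in less_imp_le)
      then show "Min (insert b T) = Min T" using insert False by (subst Min_insert) auto
    qed
    ultimately show ?thesis using insert False finite_gaps[OF insert(1)] by simp
  qed
qed auto

text \<open>Lebesgue measure of the disjoint union replaces an ordering of the intervals.\<close>

lemma sum_disjoint_intervals_le:
  fixes l r :: "'i \<Rightarrow> real"
  assumes "finite I" "x \<le> y" and le: "\<And>i. i \<in> I \<Longrightarrow> x \<le> l i \<and> l i \<le> r i \<and> r i \<le> y"
    and disj: "\<And>i j. i \<in> I \<Longrightarrow> j \<in> I \<Longrightarrow> i \<noteq> j \<Longrightarrow> {l i<..<r i} \<inter> {l j<..<r j} = {}"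
  shows "(\<Sum>i\<in>I. r i - l i) \<le> y - x"
proof -
  have "(\<Sum>i\<in>I. r i - l i) = (\<Sum>i\<in>I. measure lborel {l i<..<r i})"
    using le by (intro sum.cong) auto
  also have "\<dots> = measure lborel (\<Union>i\<in>I. {l i<..<r i})"
    using assms by (intro measure_finite_Union[symmetric]) (auto simp: disjoint_family_on_def)
  also have "\<dots> \<le> measure lborel {x..y}"
    by (rule measure_mono_fmeasurable) (use assms in \<open>force+, simp add: fmeasurable_def\<close>)
  also have "\<dots> = y - x" using assms by simp
  finally show ?thesis .
qed

section \<open>Thickness of families of curves in terms of gaps\<close>

text \<open>The detour \<open>\<eta>\<close> meets \<open>\<gamma>\<close> only at the two ends of
  the gap, so that both arcs form a circle, and its distance from \<open>\<gamma>\<close> is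
  comparable with the length of the gap. This is (A5) with the constant \<open>c\<close>.\<close>

definition good_gap ::
    "('a \<Rightarrow> 'a \<Rightarrow> real) \<Rightarrow> (real \<Rightarrow> 'a) set \<Rightarrow> real \<Rightarrow> (real \<Rightarrow> 'a) \<Rightarrow> real \<Rightarrow> real \<Rightarrow> bool" where
  "good_gap d F c \<gamma> s t \<longleftrightarrow>
     (\<exists>\<eta>\<in>F. \<eta> s = \<gamma> s \<and> \<eta> t = \<gamma> t \<and> (\<forall>u\<in>{s<..<t}. \<eta> u \<noteq> \<gamma> u) \<and>
        (\<exists>u\<in>{s<..<t}. c * (t - s) \<le> d (\<gamma> u) (\<eta> u)))"

definition good_gaps ::
    "('a \<Rightarrow> 'a \<Rightarrow> real) \<Rightarrow> (real \<Rightarrow> 'a) set \<Rightarrow> real \<Rightarrow> (real \<Rightarrow> 'a) \<Rightarrow> real set \<Rightarrow> (real \<times> real) set" where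
  "good_gaps d F c \<gamma> T = {(s, t) \<in> gaps T. good_gap d F c \<gamma> s t}"

definition good_length ::
    "('a \<Rightarrow> 'a \<Rightarrow> real) \<Rightarrow> (real \<Rightarrow> 'a) set \<Rightarrow> real \<Rightarrow> (real \<Rightarrow> 'a) \<Rightarrow> real set \<Rightarrow> real" where
  "good_length d F c \<gamma> T = (\<Sum>(s, t)\<in>good_gaps d F c \<gamma> T. t - s)"

text \<open>One constant \<open>c\<close> bounds both the relative size of the detours, as in (A5),
  and their total length, as in (A6). Through \<open>T\<close> one can prescribe points that no gap
  may contain in its interior.\<close>

definition uniformly_thick ::
    "('a \<Rightarrow> 'a \<Rightarrow> real) \<Rightarrow> real \<Rightarrow> real \<Rightarrow> (real \<Rightarrow> 'a) set \<Rightarrow> real \<Rightarrow> bool" where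
  "uniformly_thick d a b F c \<longleftrightarrow>
     (\<forall>\<gamma>\<in>F. \<forall>T. finite T \<and> T \<subseteq> {a..b} \<longrightarrow>
        (\<exists>T'. finite T' \<and> T \<subseteq> T' \<and> T' \<subseteq> {a..b} \<and> c \<le> good_length d F c \<gamma> T'))"

text \<open>The values of the curves outside the interval \<open>[a,b]\<close> are irrelevant.\<close>

definition curve_family ::
    "'a set \<Rightarrow> ('a \<Rightarrow> 'a \<Rightarrow> real) \<Rightarrow> real \<Rightarrow> real \<Rightarrow> (real \<Rightarrow> 'a) set \<Rightarrow> bool" where
  "curve_family M d a b F \<longleftrightarrow>
     F \<noteq> {} \<and> (\<forall>\<gamma>\<in>F. \<gamma> ` {a..b} \<subseteq> M \<and> isometric_on_interval d a b \<gamma>) \<and>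
     (\<forall>\<gamma>\<^sub>1\<in>F. \<forall>\<gamma>\<^sub>2\<in>F. \<forall>c\<in>{a..b}. \<gamma>\<^sub>1 c = \<gamma>\<^sub>2 c \<longrightarrow>
        (\<exists>\<gamma>\<in>F. (\<forall>t\<in>{a..c}. \<gamma> t = \<gamma>\<^sub>1 t) \<and> (\<forall>t\<in>{c..b}. \<gamma> t = \<gamma>\<^sub>2 t)))"

text \<open>Within \<open>S\<close>, curves can differ only at parameters in \<open>U\<close>;
  localisation consists in shrinking \<open>U\<close>.\<close>

definition agree_off :: "real set \<Rightarrow> real set \<Rightarrow> (real \<Rightarrow> 'a) set \<Rightarrow> bool" where
  "agree_off S U F \<longleftrightarrow> (\<forall>\<gamma>\<in>F. \<forall>\<eta>\<in>F. \<forall>t\<in>S - U. \<gamma> t = \<eta> t)"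

lemma curve_family_concat:
  assumes "curve_family M d a b F" "\<gamma>\<^sub>1 \<in> F" "\<gamma>\<^sub>2 \<in> F" "c \<in> {a..b}" "\<gamma>\<^sub>1 c = \<gamma>\<^sub>2 c"
  obtains \<gamma> where "\<gamma> \<in> F" "\<And>t. t \<in> {a..c} \<Longrightarrow> \<gamma> t = \<gamma>\<^sub>1 t" "\<And>t. t \<in> {c..b} \<Longrightarrow> \<gamma> t = \<gamma>\<^sub>2 t"
proof -
  have "\<forall>c\<in>{a..b}. \<gamma>\<^sub>1 c = \<gamma>\<^sub>2 c \<longrightarrow>
      (\<exists>\<gamma>\<in>F. (\<forall>t\<in>{a..c}. \<gamma> t = \<gamma>\<^sub>1 t) \<and> (\<forall>t\<in>{c..b}. \<gamma> t = \<gamma>\<^sub>2 t))"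
    using assms(1-3) by (simp add: curve_family_def)
  from bspec[OF this assms(4)] assms(5) that show thesis by blast
qed

lemma good_gap_mono:
  assumes "good_gap d F c \<gamma> s t" "c' \<le> c" "s \<le> t"
  shows "good_gap d F c' \<gamma> s t"
proof -
  have "c' * (t - s) \<le> c * (t - s)" using assms by (simp add: mult_right_mono)
  then show ?thesis using assms(1) unfolding good_gap_def by (meson order_trans)
qed

lemma good_gapsD:
  assumes "(s, t) \<in> good_gaps d F c \<gamma> T"
  shows "(s, t) \<in> gaps T" "good_gap d F c \<gamma> s t" "s < t"
  using assms gapsD unfolding good_gaps_def by auto

lemma finite_good_gaps: "finite T \<Longrightarrow> finite (good_gaps d F c \<gamma> T)"
  using finite_gaps by (auto simp: good_gaps_def intro: finite_subset[of _ "gaps T"])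

section \<open>Distance and agreement of two curves\<close>

lemma isometric_curve_mem:
  "isometric_on_interval d a b \<gamma> \<Longrightarrow> s \<in> {a..b} \<Longrightarrow> t \<in> {a..b} \<Longrightarrow> d (\<gamma> s) (\<gamma> t) = \<bar>s - t\<bar>"
  by (simp add: isometric_on_interval_def)

lemma curve_dist_continuous:
  assumes "Metric_space M d" "isometric_on_interval d a b \<gamma>" "isometric_on_interval d a' b' \<eta>"
    "\<gamma> ` {a..b} \<subseteq> M" "\<eta> ` {a'..b'} \<subseteq> M"
  shows "continuous_on ({a..b} \<times> {a'..b'}) (\<lambda>(s, t). d (\<gamma> s) (\<eta> t))"
proof -
  interpret Metric_space M d by fact
  have *: "\<bar>d (\<gamma> s) (\<eta> t) - d (\<gamma> s') (\<eta> t')\<bar> \<le> 2 * dist (s, t) (s', t')"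
    if "s \<in> {a..b}" "s' \<in> {a..b}" "t \<in> {a'..b'}" "t' \<in> {a'..b'}" for s s' t t'
  proof -
    have m: "\<gamma> s \<in> M" "\<gamma> s' \<in> M" "\<eta> t \<in> M" "\<eta> t' \<in> M" using that assms by auto
    have "d (\<gamma> s) (\<gamma> s') = \<bar>s - s'\<bar>" "d (\<eta> t) (\<eta> t') = \<bar>t - t'\<bar>"
      using that assms unfolding isometric_on_interval_def by auto
    moreover have "\<bar>s - s'\<bar> \<le> dist (s, t) (s', t')" "\<bar>t - t'\<bar> \<le> dist (s, t) (s', t')"
      using dist_fst_le[of "(s, t)" "(s', t')"] dist_snd_le[of "(s, t)" "(s', t')"]
      by (auto simp: dist_real_def)
    moreover have "d (\<gamma> s) (\<eta> t) \<le> d (\<gamma> s) (\<gamma> s') + d (\<gamma> s') (\<eta> t') + d (\<eta> t') (\<eta> t)"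
      using triangle[of "\<gamma> s" "\<gamma> s'" "\<eta> t"] triangle[of "\<gamma> s'" "\<eta> t'" "\<eta> t"] m by linarith
    moreover have "d (\<gamma> s') (\<eta> t') \<le> d (\<gamma> s') (\<gamma> s) + d (\<gamma> s) (\<eta> t) + d (\<eta> t) (\<eta> t')"
      using triangle[of "\<gamma> s'" "\<gamma> s" "\<eta> t'"] triangle[of "\<gamma> s" "\<eta> t" "\<eta> t'"] m by linarith
    ultimately show ?thesis
      using commute[of "\<gamma> s" "\<gamma> s'"] commute[of "\<eta> t" "\<eta> t'"] by linarith
  qed
  show ?thesis
    unfolding continuous_on_iff
  proof (intro ballI allI impI)
    fix x and e :: real assume x: "x \<in> {a..b} \<times> {a'..b'}" "0 < e"
    show "\<exists>\<delta>>0. \<forall>x'\<in>{a..b} \<times> {a'..b'}. dist x' x < \<delta> \<longrightarrow>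
        dist (case x' of (s, t) \<Rightarrow> d (\<gamma> s) (\<eta> t)) (case x of (s, t) \<Rightarrow> d (\<gamma> s) (\<eta> t)) < e"
    proof (intro exI[of _ "e / 2"] conjI ballI impI)
      fix x' assume x': "x' \<in> {a..b} \<times> {a'..b'}" "dist x' x < e / 2"
      obtain s t s' t' where "x = (s, t)" "x' = (s', t')" by (cases x, cases x')
      then show "dist (case x' of (s, t) \<Rightarrow> d (\<gamma> s) (\<eta> t)) (case x of (s, t) \<Rightarrow> d (\<gamma> s) (\<eta> t)) < e"
        using *[of s' s t' t] x x' by (auto simp: dist_real_def)
    qed (use x in auto)
  qed
qed

text \<open>Restriction of the two-parameter distance function to the diagonal.\<close>

lemma curve_dist_diag_continuous:
  assumes "Metric_space M d" "isometric_on_interval d a b \<gamma>" "isometric_on_interval d a b \<eta>"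
    "\<gamma> ` {a..b} \<subseteq> M" "\<eta> ` {a..b} \<subseteq> M"
  shows "continuous_on {a..b} (\<lambda>t. d (\<gamma> t) (\<eta> t))"
proof -
  have "continuous_on {a..b} ((\<lambda>(s, t). d (\<gamma> s) (\<eta> t)) \<circ> (\<lambda>t. (t, t)))"
    by (rule continuous_on_compose)
      (auto intro!: continuous_intros continuous_on_subset[OF curve_dist_continuous[OF assms]])
  then show ?thesis by (simp add: comp_def)
qed

lemma curves_agree_closed:
  assumes "Metric_space M d" "isometric_on_interval d a b \<gamma>" "isometric_on_interval d a b \<eta>"
    "\<gamma> ` {a..b} \<subseteq> M" "\<eta> ` {a..b} \<subseteq> M"
  shows "closed {t \<in> {a..b}. \<gamma> t = \<eta> t}"
proof -
  interpret Metric_space M d by fact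
  have "{t \<in> {a..b}. \<gamma> t = \<eta> t} = {t \<in> {a..b}. d (\<gamma> t) (\<eta> t) = 0}"
    using assms by (auto simp: image_subset_iff)
  then show ?thesis
    using continuous_closed_preimage_constant[OF curve_dist_diag_continuous[OF assms], of 0] by simp
qed

text \<open>The agreement set is closed, hence has a last point before \<open>s\<close> and a first
  point after \<open>s\<close>; these are \<open>l\<close> and \<open>r\<close>.\<close>

lemma separation_interval:
  fixes \<gamma> \<eta> :: "real \<Rightarrow> 'a"
  assumes cl: "closed {t \<in> {x..y}. \<gamma> t = \<eta> t}"
    and "\<gamma> x = \<eta> x" "\<gamma> y = \<eta> y" "x < s" "s < y" "\<gamma> s \<noteq> \<eta> s"
  obtains l r where "x \<le> l" "l < s" "s < r" "r \<le> y" "\<gamma> l = \<eta> l" "\<gamma> r = \<eta> r"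
    "\<And>u. l < u \<Longrightarrow> u < r \<Longrightarrow> \<gamma> u \<noteq> \<eta> u"
proof -
  let ?Z = "{t \<in> {x..y}. \<gamma> t = \<eta> t}"
  have c: "compact (?Z \<inter> {x..s})" "compact (?Z \<inter> {s..y})"
    by (rule closed_Int_compact[OF cl compact_Icc])+
  have "x \<in> ?Z \<inter> {x..s}" "y \<in> ?Z \<inter> {s..y}" using assms by auto
  then obtain l r where l: "l \<in> ?Z \<inter> {x..s}" "\<forall>u\<in>?Z \<inter> {x..s}. u \<le> l"
    and r: "r \<in> ?Z \<inter> {s..y}" "\<forall>u\<in>?Z \<inter> {s..y}. r \<le> u"
    using compact_attains_sup[OF c(1)] compact_attains_inf[OF c(2)] by blast
  have "l \<noteq> s" "r \<noteq> s" using l r assms by auto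
  moreover have "\<gamma> u \<noteq> \<eta> u" if "l < u" "u < r" for u
  proof
    assume eq: "\<gamma> u = \<eta> u"
    show False
    proof (cases "u \<le> s")
      case True
      then have "u \<in> ?Z \<inter> {x..s}" using eq that l r by auto
      then show False using l(2) that by (meson not_le)
    next
      case False
      then have "u \<in> ?Z \<inter> {s..y}" using eq that l r by auto
      then show False using r(2) that by (meson not_le)
    qed
  qed
  ultimately show thesis using l r by (intro that[of l r]) auto
qed


lemma sum_pairs_le:
  fixes A :: "(real \<times> real) set"
  assumes "finite I" "inj_on f I" "f ` I \<subseteq> A" "finite A" "\<And>s t. (s, t) \<in> A \<Longrightarrow> s \<le> t"
    and "\<And>i. i \<in> I \<Longrightarrow> g i \<le> snd (f i) - fst (f i)"
  shows "sum g I \<le> (\<Sum>(s, t)\<in>A. t - s)"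
proof -
  have "sum g I \<le> (\<Sum>i\<in>I. snd (f i) - fst (f i))" using assms by (intro sum_mono) auto
  also have "\<dots> = (\<Sum>(s, t)\<in>f ` I. t - s)"
    using assms(2) by (simp add: sum.reindex case_prod_unfold)
  also have "\<dots> \<le> (\<Sum>(s, t)\<in>A. t - s)"
    using assms by (intro sum_mono2) auto
  finally show ?thesis .
qed

text \<open>Thickness is applied to the partition given by \<open>T\<close>. Pieces on which the two
  curves separate by less than \<open>c\<close> times the length of the piece account for at most
  \<open>c * (b - a)\<close> and are discarded. Every other piece is shrunk to the maximal interval
  around \<open>s i\<close> on which the curves differ, which yields a good gap at least as long as
  the separation \<open>D i\<close>.\<close>

lemma thick_family_imp_uniformly_thick:
  assumes M: "Metric_space M d" and th: "thick_family M d p q a b \<Gamma>" and ab: "a < b"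
  obtains c where "c > 0" "uniformly_thick d a b \<Gamma> c"
proof -
  interpret Metric_space M d by fact
  obtain \<alpha> where \<alpha>: "\<alpha> > 0" and thick: "\<forall>\<gamma>\<in>\<Gamma>. \<forall>(k::nat) (t::nat \<Rightarrow> real).
        t 0 = a \<and> t k = b \<and> (\<forall>i<k. t i < t (Suc i)) \<longrightarrow>
        (\<exists>(j::nat) (u::nat \<Rightarrow> real) (s::nat \<Rightarrow> real). \<exists>\<gamma>'\<in>\<Gamma>.
           u 0 = a \<and> u j = b \<and> (\<forall>i<j. u i < s (Suc i) \<and> s (Suc i) < u (Suc i)) \<and>
           t ` {0..k} \<subseteq> u ` {0..j} \<and> (\<forall>i\<le>j. \<gamma> (u i) = \<gamma>' (u i)) \<and>
           (\<Sum>i=1..j. d (\<gamma> (s i)) (\<gamma>' (s i))) \<ge> \<alpha>)"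
    using th[unfolded thick_family_def, THEN conjunct2, THEN conjunct2, THEN conjunct2]
    by (elim exE conjE)
  have geo: "isometric_on_interval d a b \<gamma>" "\<gamma> ` {a..b} \<subseteq> M" if "\<gamma> \<in> \<Gamma>" for \<gamma>
    using th that unfolding thick_family_def geodesic_def by auto
  \<comment> \<open>The second bound makes the discarded pieces contribute at most half of \<alpha>;
    by the first, the remaining half suffices for the total length of the good gaps.\<close>
  define c where "c = min (\<alpha> / 2) (\<alpha> / (2 * (b - a)))"
  have c: "c > 0" "c \<le> \<alpha> / 2" "c \<le> \<alpha> / (2 * (b - a))"
    unfolding c_def using \<alpha> ab by (simp_all only: min.cobounded1 min.cobounded2) simp
  have "uniformly_thick d a b \<Gamma> c"
    unfolding uniformly_thick_def
  proof (intro ballI allI impI)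
    fix \<gamma> T assume g: "\<gamma> \<in> \<Gamma>" and T: "finite T \<and> T \<subseteq> {a..b}"
    define T1 where "T1 = T \<union> {a, b}"
    define l where "l = sorted_list_of_set T1"
    have T1: "finite T1" "T1 \<subseteq> {a..b}" "a \<in> T1" "b \<in> T1" using T ab by (auto simp: T1_def)
    have l: "set l = T1" "sorted_wrt (<) l" using T1 by (auto simp: l_def)
    have len: "length l > 0" using T1 l by (cases l) auto
    define k where "k = length l - 1"
    have mono: "i \<le> j \<Longrightarrow> j < length l \<Longrightarrow> l ! i \<le> l ! j" for i j
      using l(2) by (metis less_eq_real_def nat_less_le sorted_wrt_nth_less)
    have k: "k < length l" "length l = Suc k" using len by (auto simp: k_def)
    have inl: "\<exists>i<length l. l ! i = x" if "x \<in> T1" for x using that l by (metis in_set_conv_nth)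
    have l0: "l ! 0 = a"
    proof -
      have "l ! 0 \<in> T1" using l len nth_mem by blast
      then show ?thesis using T1 inl[of a] mono[of 0] by force
    qed
    have lk: "l ! k = b"
    proof -
      have "l ! k \<in> T1" using l k nth_mem by blast
      moreover obtain i where "i < length l" "l ! i = b" using inl[of b] T1 by blast
      ultimately show ?thesis using T1 mono[of i k] k by force
    qed
    have "\<forall>i<k. l ! i < l ! Suc i" using l(2) k by (simp add: sorted_wrt_nth_less)
    from thick[rule_format, OF g, of "(!) l" k, OF conjI[OF l0 conjI[OF lk this]]]
    obtain j :: nat and u s \<gamma>' where g': "\<gamma>' \<in> \<Gamma>" and u0: "u 0 = a" and uj: "u j = b"
      and us: "\<And>i. i < j \<Longrightarrow> u i < s (Suc i) \<and> s (Suc i) < u (Suc i)"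
      and Tu: "(!) l ` {0..k} \<subseteq> u ` {0..j}" and eq: "\<And>i. i \<le> j \<Longrightarrow> \<gamma> (u i) = \<gamma>' (u i)"
      and sum: "(\<Sum>i=1..j. d (\<gamma> (s i)) (\<gamma>' (s i))) \<ge> \<alpha>"
      by (elim exE bexE conjE) (rule that, auto)
    have umono: "u i \<le> u i'" if "i \<le> i'" "i' \<le> j" for i i'
      using that
    proof (induction i' rule: dec_induct)
      case (step n)
      then show ?case using us[of n] by force
    qed simp
    have uab: "u i \<in> {a..b}" if "i \<le> j" for i using umono[of 0 i] umono[of i j] u0 uj that by auto
    have TT: "T \<subseteq> u ` {0..j}"
    proof
      fix x assume "x \<in> T"
      then obtain i where "i < length l" "l ! i = x" using inl[of x] by (auto simp: T1_def)
      then show "x \<in> u ` {0..j}" using Tu k by force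
    qed
    define D where "D i = d (\<gamma> (s i)) (\<gamma>' (s i))" for i
    define I where "I = {i \<in> {1..j}. c * (u i - u (i - 1)) \<le> D i \<and> D i > 0}"
    have us': "u (i - 1) < s i" "s i < u i" "i - 1 \<le> j" "i \<le> j" if "i \<in> {1..j}" for i
      using us[of "i - 1"] that by auto
    have "\<exists>l r. u (i - 1) \<le> l \<and> l < s i \<and> s i < r \<and> r \<le> u i \<and> \<gamma> l = \<gamma>' l \<and> \<gamma> r = \<gamma>' r \<and>
        (\<forall>v. l < v \<longrightarrow> v < r \<longrightarrow> \<gamma> v \<noteq> \<gamma>' v)" if "i \<in> I" for i
    proof -
      have i: "i \<in> {1..j}" "D i > 0" using that by (auto simp: I_def)
      have sub: "{u (i - 1)..u i} \<subseteq> {a..b}" using uab[of i] uab[of "i - 1"] us'[OF i(1)] by auto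
      have iso: "isometric_on_interval d (u (i - 1)) (u i) \<gamma>" "isometric_on_interval d (u (i - 1)) (u i) \<gamma>'"
        using sub geo g g' unfolding isometric_on_interval_def by blast+
      have cl: "closed {t \<in> {u (i - 1)..u i}. \<gamma> t = \<gamma>' t}"
        by (rule curves_agree_closed[OF M iso]) (use sub geo g g' in blast)+
      have "s i \<in> {a..b}" using us'[OF i(1)] sub by auto
      then have "\<gamma> (s i) \<in> M" using geo(2) g by blast
      then have "\<gamma> (s i) \<noteq> \<gamma>' (s i)" using i(2) by (auto simp: D_def)
      then show ?thesis
        using separation_interval[OF cl eq eq us'(1,2)[OF i(1)]] us'(3,4)[OF i(1)] by metis
    qed
    then obtain L R where LR: "\<And>i. i \<in> I \<Longrightarrow> u (i - 1) \<le> L i \<and> L i < s i \<and> s i < R i \<and> R i \<le> u i \<and>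
        \<gamma> (L i) = \<gamma>' (L i) \<and> \<gamma> (R i) = \<gamma>' (R i) \<and> (\<forall>v. L i < v \<longrightarrow> v < R i \<longrightarrow> \<gamma> v \<noteq> \<gamma>' v)"
      by metis
    \<comment> \<open>The shrunk intervals are gaps of this set: no point that stems from another
      piece lies strictly between \<open>u (i - 1)\<close> and \<open>u i\<close>.\<close>
    define T' where "T' = u ` {0..j} \<union> L ` I \<union> R ` I"
    have finI: "finite I" by (simp add: I_def)
    have Ij: "i \<in> {1..j}" if "i \<in> I" for i using that by (simp add: I_def)
    have T'ab: "T' \<subseteq> {a..b}"
    proof -
      have "L i \<in> {a..b} \<and> R i \<in> {a..b}" if "i \<in> I" for i
        using LR[OF that] uab[OF us'(3)[OF Ij[OF that]]] uab[OF us'(4)[OF Ij[OF that]]] by auto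
      then show ?thesis using uab by (auto simp: T'_def)
    qed
    have out: "x \<le> u (i - 1) \<or> u i \<le> x" if "i \<in> {1..j}" "x = u n" "n \<le> j" for i x n
      using that umono[of n "i - 1"] umono[of i n] us'[OF that(1)] by (cases "n < i") auto
    have out': "u n \<le> u (i - 1) \<or> u i \<le> u (n - 1)" if "i \<in> {1..j}" "n \<in> {1..j}" "n \<noteq> i" for i n
      using that umono[of n "i - 1"] umono[of i "n - 1"] by (cases "n < i") auto
    have gap: "(L i, R i) \<in> gaps T'" if i: "i \<in> I" for i
    proof (rule gapsI)
      show "L i \<in> T'" "R i \<in> T'" "L i < R i" using i LR[OF i] by (auto simp: T'_def)
      fix x assume x: "x \<in> T'" "L i < x" "x < R i"
      have "x \<le> u (i - 1) \<or> u i \<le> x \<or> x = L i \<or> x = R i"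
        using x(1) unfolding T'_def
      proof (elim UnE imageE)
        fix n assume "x = u n" "n \<in> {0..j}"
        then show ?thesis using out[OF Ij[OF i]] by auto
      next
        fix n assume n: "x = L n" "n \<in> I"
        then show ?thesis using out'[OF Ij[OF i] Ij[OF n(2)]] LR[OF n(2)] by (cases "n = i") force+
      next
        fix n assume n: "x = R n" "n \<in> I"
        then show ?thesis using out'[OF Ij[OF i] Ij[OF n(2)]] LR[OF n(2)] by (cases "n = i") force+
      qed
      then show False using x LR[OF i] by auto
    qed
    have LRab: "L i \<in> {a..b}" "R i \<in> {a..b}" "s i \<in> {a..b}" if "i \<in> I" for i
    proof -
      show LR': "L i \<in> {a..b}" "R i \<in> {a..b}" using gapsD(1,2)[OF gap[OF that]] T'ab by auto
      show "s i \<in> {a..b}" using LR' LR[OF that] by auto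
    qed
    have good: "(L i, R i) \<in> good_gaps d \<Gamma> c \<gamma> T'" if i: "i \<in> I" for i
    proof -
      have "c * (R i - L i) \<le> c * (u i - u (i - 1))"
        using LR[OF i] c by (intro mult_left_mono) auto
      also have "\<dots> \<le> D i" using i by (simp add: I_def)
      finally have "good_gap d \<Gamma> c \<gamma> (L i) (R i)"
        unfolding good_gap_def D_def using g' LR[OF i]
        by (intro bexI[of _ \<gamma>'] conjI bexI[of _ "s i"]) (auto simp: eq_commute)
      then show ?thesis using gap[OF i] by (simp add: good_gaps_def)
    qed
    text \<open>Two geodesics that meet at \<open>L\<close> and at \<open>R\<close> are at time \<open>s\<close> at distance at most
      \<open>2 min (s - L) (R - s)\<close>.\<close>
    have DLR: "D i \<le> R i - L i" if i: "i \<in> I" for i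
    proof -
      have m: "\<gamma> (s i) \<in> M" "\<gamma>' (s i) \<in> M" "\<gamma> (L i) \<in> M" "\<gamma> (R i) \<in> M"
        using LRab[OF i] geo(2) g g' by blast+
      have "d (\<gamma> (s i)) (\<gamma> (L i)) = s i - L i" "d (\<gamma>' (L i)) (\<gamma>' (s i)) = s i - L i"
        "d (\<gamma> (s i)) (\<gamma> (R i)) = R i - s i" "d (\<gamma>' (R i)) (\<gamma>' (s i)) = R i - s i"
        using LR[OF i] isometric_curve_mem[OF geo(1)[OF g] LRab(3)[OF i] LRab(1)[OF i]]
          isometric_curve_mem[OF geo(1)[OF g] LRab(3)[OF i] LRab(2)[OF i]]
          isometric_curve_mem[OF geo(1)[OF g'] LRab(1)[OF i] LRab(3)[OF i]]
          isometric_curve_mem[OF geo(1)[OF g'] LRab(2)[OF i] LRab(3)[OF i]] by simp_all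
      then show ?thesis
        using triangle[of "\<gamma> (s i)" "\<gamma> (L i)" "\<gamma>' (s i)"] triangle[of "\<gamma> (s i)" "\<gamma> (R i)" "\<gamma>' (s i)"]
          m LR[OF i] by (simp add: D_def)
    qed
    have usum: "(\<Sum>i=1..n. u i - u (i - 1)) = u n - u 0" for n by (induction n) auto
    have "\<alpha> \<le> (\<Sum>i=1..j. D i)" using sum by (simp add: D_def)
    also have "\<dots> \<le> (\<Sum>i=1..j. (if i \<in> I then D i else 0) + c * (u i - u (i - 1)))"
    proof (rule sum_mono)
      fix i assume i: "i \<in> {1..j}"
      have "0 \<le> c * (u i - u (i - 1))" using us'[OF i] c by simp
      then show "D i \<le> (if i \<in> I then D i else 0) + c * (u i - u (i - 1))"
        using i by (auto simp: I_def)
    qed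
    also have "\<dots> = (\<Sum>i\<in>I. D i) + c * (b - a)"
    proof -
      have "{1..j} \<inter> I = I" using Ij by auto
      then show ?thesis
        using usum[of j] u0 uj by (simp add: sum.distrib sum.If_cases flip: sum_distrib_left)
    qed
    also have "c * (b - a) \<le> \<alpha> / 2" using c(3) ab by (simp add: field_simps)
    finally have "\<alpha> / 2 \<le> (\<Sum>i\<in>I. D i)" by simp
    moreover have "inj_on (\<lambda>i. (L i, R i)) I"
    proof (rule inj_onI)
      fix i n assume i: "i \<in> I" "n \<in> I" "(L i, R i) = (L n, R n)"
      then show "i = n"
        using out'[OF Ij Ij, of i n] LR[of i] LR[of n] by (cases "i = n") force+
    qed
    moreover have finT: "finite T'" using finI by (simp add: T'_def)
    ultimately have "\<alpha> / 2 \<le> (\<Sum>i\<in>I. D i)" "inj_on (\<lambda>i. (L i, R i)) I" "finite (good_gaps d \<Gamma> c \<gamma> T')"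
      by (simp_all add: finite_good_gaps)
    moreover have "(\<Sum>i\<in>I. D i) \<le> good_length d \<Gamma> c \<gamma> T'" if "inj_on (\<lambda>i. (L i, R i)) I"
      unfolding good_length_def
    proof (rule sum_pairs_le[OF finI that])
      show "(\<lambda>i. (L i, R i)) ` I \<subseteq> good_gaps d \<Gamma> c \<gamma> T'" using good by blast
    qed (use DLR finite_good_gaps[OF finT] in \<open>auto dest: good_gapsD(3)\<close>)
    ultimately have "\<alpha> / 2 \<le> good_length d \<Gamma> c \<gamma> T'" by linarith
    then have "c \<le> good_length d \<Gamma> c \<gamma> T'" using c by linarith
    moreover have TT': "T \<subseteq> T'" unfolding T'_def by (intro le_supI1 TT)
    ultimately show "\<exists>T'. finite T' \<and> T \<subseteq> T' \<and> T' \<subseteq> {a..b} \<and> c \<le> good_length d \<Gamma> c \<gamma> T'"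
      using finT TT' T'ab by blast
  qed
  then show thesis using c that by blast
qed

text \<open>A pigeonhole argument. \<open>F1\<close> prescribes the curves after \<open>m\<close>,
  \<open>F2\<close> before \<open>m\<close>. If no such subfamily were thick with half the constant,
  a failure of each kind could be tested by one set \<open>T'\<close> containing \<open>m\<close>:
  each gap of \<open>T'\<close> lies on one side of \<open>m\<close>, and concatenation turns a
  detour on that side into a member of the corresponding subfamily. But one side must carry at least
  half of the total.\<close>

lemma thick_bisect:
  assumes F: "curve_family M d a b F" "uniformly_thick d a b F c"
    and c: "c > 0" and ag: "agree_off {a..b} {x<..<y} F" and m: "m \<in> {a..b}" "x \<le> m" "m \<le> y"
  obtains F' x' y' where "curve_family M d a b F'" "uniformly_thick d a b F' (c / 2)"
    "agree_off {a..b} {x'<..<y'} F'" "x' = x \<and> y' = m \<or> x' = m \<and> y' = y"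
proof -
  define F1 where "F1 \<gamma>\<^sub>0 = {\<gamma>\<in>F. \<forall>t\<in>{m..b}. \<gamma> t = \<gamma>\<^sub>0 t}" for \<gamma>\<^sub>0
  define F2 where "F2 \<gamma>\<^sub>0 = {\<gamma>\<in>F. \<forall>t\<in>{a..m}. \<gamma> t = \<gamma>\<^sub>0 t}" for \<gamma>\<^sub>0
  obtain \<gamma>\<^sub>0 where g0: "\<gamma>\<^sub>0 \<in> F" using F by (auto simp: curve_family_def)
  have "(\<exists>\<gamma>\<in>F. uniformly_thick d a b (F1 \<gamma>) (c / 2)) \<or> (\<exists>\<gamma>\<in>F. uniformly_thick d a b (F2 \<gamma>) (c / 2))"
  proof (rule ccontr)
    assume neg: "\<not> ?thesis"
    then obtain \<gamma>\<^sub>1 T1 where g1: "\<gamma>\<^sub>1 \<in> F1 \<gamma>\<^sub>0" and T1: "finite T1" "T1 \<subseteq> {a..b}"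
      "\<And>T'. finite T' \<Longrightarrow> T1 \<subseteq> T' \<Longrightarrow> T' \<subseteq> {a..b} \<Longrightarrow> good_length d (F1 \<gamma>\<^sub>0) (c / 2) \<gamma>\<^sub>1 T' < c / 2"
      using g0 unfolding uniformly_thick_def by (metis not_less)
    then have g1': "\<gamma>\<^sub>1 \<in> F" by (simp add: F1_def)
    \<comment> \<open>The second subfamily follows \<open>\<gamma>\<^sub>1\<close>, not
      \<open>\<gamma>\<^sub>0\<close>, before \<open>m\<close>. So \<open>\<gamma>\<^sub>2\<close>
      coincides there with \<open>\<gamma>\<^sub>1\<close>, and detours of
      \<open>\<gamma>\<^sub>2\<close> to the left of \<open>m\<close> are detours of
      \<open>\<gamma>\<^sub>1\<close>.\<close>
    then obtain \<gamma>\<^sub>2 T2 where g2: "\<gamma>\<^sub>2 \<in> F2 \<gamma>\<^sub>1" and T2: "finite T2" "T2 \<subseteq> {a..b}"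
      "\<And>T'. finite T' \<Longrightarrow> T2 \<subseteq> T' \<Longrightarrow> T' \<subseteq> {a..b} \<Longrightarrow> good_length d (F2 \<gamma>\<^sub>1) (c / 2) \<gamma>\<^sub>2 T' < c / 2"
      using neg unfolding uniformly_thick_def by (metis not_less)
    then have g2': "\<gamma>\<^sub>2 \<in> F" by (simp add: F2_def)
    obtain T' where T': "finite T'" "T1 \<union> T2 \<union> {m} \<subseteq> T'" "T' \<subseteq> {a..b}" "c \<le> good_length d F c \<gamma>\<^sub>2 T'"
      using F(2) g2' T1(1,2) T2(1,2) m unfolding uniformly_thick_def
      by (metis Un_least empty_subsetI finite.emptyI finite_Un finite_insert insert_subset)
    let ?G = "good_gaps d F c \<gamma>\<^sub>2 T'" and ?G1 = "good_gaps d (F1 \<gamma>\<^sub>0) (c / 2) \<gamma>\<^sub>1 T'"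
      and ?G2 = "good_gaps d (F2 \<gamma>\<^sub>1) (c / 2) \<gamma>\<^sub>2 T'"
    have half: "good_gap d F (c / 2) \<gamma>\<^sub>2 s t" if "(s, t) \<in> ?G" for s t
      by (rule good_gap_mono[OF good_gapsD(2)[OF that]]) (use c good_gapsD(3)[OF that] in auto)
    have eq12: "\<gamma>\<^sub>2 t = \<gamma>\<^sub>1 t" if "t \<in> {a..m}" for t using g2 that by (auto simp: F2_def)
    have "?G \<subseteq> ?G1 \<union> ?G2"
    proof
      fix st assume "st \<in> ?G"
      then obtain s t where st: "st = (s, t)" "(s, t) \<in> ?G" by (cases st) auto
      have gp: "(s, t) \<in> gaps T'" "s < t" "s \<in> {a..b}" "t \<in> {a..b}"
        using good_gapsD[OF st(2)] gapsD[of s t T'] T' by auto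
      obtain \<eta> v where eta: "\<eta> \<in> F" "\<eta> s = \<gamma>\<^sub>2 s" "\<eta> t = \<gamma>\<^sub>2 t" "\<forall>u\<in>{s<..<t}. \<eta> u \<noteq> \<gamma>\<^sub>2 u"
        "v \<in> {s<..<t}" "c / 2 * (t - s) \<le> d (\<gamma>\<^sub>2 v) (\<eta> v)"
        using half[OF st(2)] unfolding good_gap_def by blast
      have "t \<le> m \<or> m \<le> s" using gapsD(4)[OF gp(1), of m] T' by auto
      then show "st \<in> ?G1 \<union> ?G2"
      proof
        assume tm: "t \<le> m"
        have "\<eta> t = \<gamma>\<^sub>1 t" using eta(3) eq12 tm gp by auto
        then obtain \<eta>' where e': "\<eta>' \<in> F" "\<And>u. u \<in> {a..t} \<Longrightarrow> \<eta>' u = \<eta> u" "\<And>u. u \<in> {t..b} \<Longrightarrow> \<eta>' u = \<gamma>\<^sub>1 u"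
          using curve_family_concat[OF F(1) eta(1) g1' gp(4)] by metis
        have "\<eta>' \<in> F1 \<gamma>\<^sub>0" using e' g1 tm by (auto simp: F1_def)
        then have "good_gap d (F1 \<gamma>\<^sub>0) (c / 2) \<gamma>\<^sub>1 s t"
          unfolding good_gap_def using eta e' eq12 gp tm
          by (intro bexI[of _ \<eta>'] conjI bexI[of _ v]) auto
        then show ?thesis using gp st by (simp add: good_gaps_def)
      next
        assume ms: "m \<le> s"
        obtain \<eta>' where e': "\<eta>' \<in> F" "\<And>u. u \<in> {a..s} \<Longrightarrow> \<eta>' u = \<gamma>\<^sub>2 u" "\<And>u. u \<in> {s..b} \<Longrightarrow> \<eta>' u = \<eta> u"
          using curve_family_concat[OF F(1) g2' eta(1) gp(3)] eta(2) by metis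
        have "\<eta>' \<in> F2 \<gamma>\<^sub>1" using e' eq12 ms by (auto simp: F2_def)
        then have "good_gap d (F2 \<gamma>\<^sub>1) (c / 2) \<gamma>\<^sub>2 s t"
          unfolding good_gap_def using eta e' gp ms
          by (intro bexI[of _ \<eta>'] conjI bexI[of _ v]) auto
        then show ?thesis using gp st by (simp add: good_gaps_def)
      qed
    qed
    moreover have "finite (?G1 \<union> ?G2)" using T'(1) by (simp add: finite_good_gaps)
    ultimately have "good_length d F c \<gamma>\<^sub>2 T' \<le> (\<Sum>(s, t)\<in>?G1 \<union> ?G2. t - s)"
      unfolding good_length_def by (intro sum_mono2) (auto dest!: good_gapsD(3))
    also have "\<dots> \<le> good_length d (F1 \<gamma>\<^sub>0) (c / 2) \<gamma>\<^sub>1 T' + good_length d (F2 \<gamma>\<^sub>1) (c / 2) \<gamma>\<^sub>2 T'"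
    proof -
      have "0 \<le> (\<Sum>(s, t)\<in>?G1 \<inter> ?G2. t - s)"
        using good_gapsD(3) by (intro sum_nonneg) (force simp: less_imp_le)
      then show ?thesis
        using sum_Un[of ?G1 ?G2 "\<lambda>(s, t). t - s"] T'(1)
        by (simp add: good_length_def finite_good_gaps)
    qed
    also have "\<dots> < c / 2 + c / 2" using T1(3)[of T'] T2(3)[of T'] T' by (intro add_strict_mono) auto
    finally show False using T'(4) by simp
  qed
  moreover have fam1: "curve_family M d a b (F1 \<gamma>)" "agree_off {a..b} {x<..<m} (F1 \<gamma>)" if g: "\<gamma> \<in> F" for \<gamma>
  proof -
    have "\<exists>\<gamma>'\<in>F1 \<gamma>. (\<forall>t\<in>{a..e}. \<gamma>' t = \<gamma>\<^sub>1 t) \<and> (\<forall>t\<in>{e..b}. \<gamma>' t = \<gamma>\<^sub>2 t)"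
      if g12: "\<gamma>\<^sub>1 \<in> F1 \<gamma>" "\<gamma>\<^sub>2 \<in> F1 \<gamma>" "e \<in> {a..b}" "\<gamma>\<^sub>1 e = \<gamma>\<^sub>2 e" for \<gamma>\<^sub>1 \<gamma>\<^sub>2 e
    proof -
      have g12': "\<gamma>\<^sub>1 \<in> F" "\<gamma>\<^sub>2 \<in> F" using g12 by (auto simp: F1_def)
      obtain \<gamma>' where "\<gamma>' \<in> F" and e: "\<And>t. t \<in> {a..e} \<Longrightarrow> \<gamma>' t = \<gamma>\<^sub>1 t" "\<And>t. t \<in> {e..b} \<Longrightarrow> \<gamma>' t = \<gamma>\<^sub>2 t"
        using curve_family_concat[OF F(1) g12' g12(3,4)] by blast
      moreover have "\<gamma>' t = \<gamma> t" if "t \<in> {m..b}" for t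
        using g12(1,2) e[of t] m that by (cases "t \<le> e") (auto simp: F1_def)
      ultimately show ?thesis by (intro bexI[of _ \<gamma>']) (auto simp: F1_def)
    qed
    then show "curve_family M d a b (F1 \<gamma>)"
      using F(1) g unfolding curve_family_def F1_def by auto
    show "agree_off {a..b} {x<..<m} (F1 \<gamma>)"
      unfolding agree_off_def
    proof (intro ballI)
      fix \<gamma>\<^sub>1 \<gamma>\<^sub>2 t assume "\<gamma>\<^sub>1 \<in> F1 \<gamma>" "\<gamma>\<^sub>2 \<in> F1 \<gamma>" "t \<in> {a..b} - {x<..<m}"
      then show "\<gamma>\<^sub>1 t = \<gamma>\<^sub>2 t"
        using ag m by (cases "m \<le> t") (auto simp: F1_def agree_off_def)
    qed
  qed
  moreover have fam2: "curve_family M d a b (F2 \<gamma>)" "agree_off {a..b} {m<..<y} (F2 \<gamma>)" if g: "\<gamma> \<in> F" for \<gamma>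
  proof -
    have "\<exists>\<gamma>'\<in>F2 \<gamma>. (\<forall>t\<in>{a..e}. \<gamma>' t = \<gamma>\<^sub>1 t) \<and> (\<forall>t\<in>{e..b}. \<gamma>' t = \<gamma>\<^sub>2 t)"
      if g12: "\<gamma>\<^sub>1 \<in> F2 \<gamma>" "\<gamma>\<^sub>2 \<in> F2 \<gamma>" "e \<in> {a..b}" "\<gamma>\<^sub>1 e = \<gamma>\<^sub>2 e" for \<gamma>\<^sub>1 \<gamma>\<^sub>2 e
    proof -
      have g12': "\<gamma>\<^sub>1 \<in> F" "\<gamma>\<^sub>2 \<in> F" using g12 by (auto simp: F2_def)
      obtain \<gamma>' where "\<gamma>' \<in> F" and e: "\<And>t. t \<in> {a..e} \<Longrightarrow> \<gamma>' t = \<gamma>\<^sub>1 t" "\<And>t. t \<in> {e..b} \<Longrightarrow> \<gamma>' t = \<gamma>\<^sub>2 t"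
        using curve_family_concat[OF F(1) g12' g12(3,4)] by blast
      moreover have "\<gamma>' t = \<gamma> t" if "t \<in> {a..m}" for t
        using g12(1,2) e[of t] m that by (cases "t \<le> e") (auto simp: F2_def)
      ultimately show ?thesis by (intro bexI[of _ \<gamma>']) (auto simp: F2_def)
    qed
    then show "curve_family M d a b (F2 \<gamma>)"
      using F(1) g unfolding curve_family_def F2_def by auto
    show "agree_off {a..b} {m<..<y} (F2 \<gamma>)"
      unfolding agree_off_def
    proof (intro ballI)
      fix \<gamma>\<^sub>1 \<gamma>\<^sub>2 t assume "\<gamma>\<^sub>1 \<in> F2 \<gamma>" "\<gamma>\<^sub>2 \<in> F2 \<gamma>" "t \<in> {a..b} - {m<..<y}"
      then show "\<gamma>\<^sub>1 t = \<gamma>\<^sub>2 t"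
        using ag m by (cases "t \<le> m") (auto simp: F2_def agree_off_def)
    qed
  qed
  ultimately show thesis
  proof (elim disjE bexE)
    fix \<gamma> assume "\<gamma> \<in> F" "uniformly_thick d a b (F1 \<gamma>) (c / 2)"
    then show thesis using that[of "F1 \<gamma>" x m] fam1 by simp
  next
    fix \<gamma> assume "\<gamma> \<in> F" "uniformly_thick d a b (F2 \<gamma>) (c / 2)"
    then show thesis using that[of "F2 \<gamma>" m y] fam2 by simp
  qed
qed

text \<open>Each bisection halves both the interval and the constant; finitely many suffice, so the
  constant stays positive.\<close>

lemma thick_localize:
  assumes "curve_family M d a b F" "uniformly_thick d a b F c" "c > 0" "agree_off {a..b} {a<..<b} F"
    "a \<le> b" "r > 0"
  obtains F' c' x y where "curve_family M d a b F'" "uniformly_thick d a b F' c'" "c' > 0"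
    "agree_off {a..b} {x<..<y} F'" "a \<le> x" "x \<le> y" "y \<le> b" "y - x \<le> r"
proof -
  have "\<exists>F' c' x y. curve_family M d a b F' \<and> uniformly_thick d a b F' c' \<and> c' > 0 \<and>
    agree_off {a..b} {x<..<y} F' \<and> a \<le> x \<and> x \<le> y \<and> y \<le> b \<and> y - x = (b - a) / 2 ^ n" for n
  proof (induction n)
    case 0
    show ?case using assms by (intro exI[of _ F] exI[of _ c] exI[of _ a] exI[of _ b]) auto
  next
    case (Suc n)
    then obtain F' c' x y where F': "curve_family M d a b F'" "uniformly_thick d a b F' c'" "c' > 0"
      "agree_off {a..b} {x<..<y} F'" and xy: "a \<le> x" "x \<le> y" "y \<le> b" "y - x = (b - a) / 2 ^ n"
      by blast
    let ?m = "(x + y) / 2"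
    have "?m \<in> {a..b}" "x \<le> ?m" "?m \<le> y" using xy by auto
    from thick_bisect[OF F' this] obtain F2 x' y' where "curve_family M d a b F2" "uniformly_thick d a b F2 (c' / 2)"
      "agree_off {a..b} {x'<..<y'} F2" and x': "x' = x \<and> y' = ?m \<or> x' = ?m \<and> y' = y"
      by metis
    moreover have "a \<le> x'" "x' \<le> y'" "y' \<le> b" using xy x' by auto
    moreover have "y' - x' = (b - a) / 2 ^ Suc n"
    proof -
      have "y' - x' = (y - x) / 2" using x' by (auto simp: field_simps)
      then show ?thesis using xy(4) by simp
    qed
    ultimately show ?case using F'(3) by (meson half_gt_zero)
  qed
  moreover obtain n where "(b - a) / 2 ^ n \<le> r"
  proof -
    obtain n where "(b - a) / r < 2 ^ n" using real_arch_pow[of 2 "(b - a) / r"] by auto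
    then show ?thesis using that[of n] assms(6) by (simp add: field_simps)
  qed
  ultimately show thesis using that by metis
qed


text \<open>All detours take place inside the window from \<open>e\<close> to \<open>e + r\<close>,
  because the curves coincide elsewhere; cutting the curves to the window loses no good gap.\<close>

lemma thick_rescale:
  assumes F: "curve_family M d a b F" and th: "uniformly_thick d a b F c" and c: "c > 0"
    and ag: "agree_off {a..b} {x<..<y} F" and r: "r > 0"
    and e: "a \<le> e" "e + r \<le> b" "e \<le> x" "y \<le> e + r" "x \<le> y"
  obtains F' \<alpha> where "curve_family M (\<lambda>u v. d u v / r) 0 1 F'" "\<alpha> > 0"
    "uniformly_thick (\<lambda>u v. d u v / r) 0 1 F' \<alpha>" "\<forall>\<gamma>\<in>F'. \<forall>\<eta>\<in>F'. \<gamma> 0 = \<eta> 0 \<and> \<gamma> 1 = \<eta> 1"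
proof -
  define \<phi> where "\<phi> t = e + r * t" for t
  define \<psi> where "\<psi> t = (t - e) / r" for t
  have inv[simp]: "\<psi> (\<phi> t) = t" "\<phi> (\<psi> t) = t" for t using r by (auto simp: \<phi>_def \<psi>_def)
  have mono[simp]: "\<phi> s < \<phi> t \<longleftrightarrow> s < t" "\<phi> s \<le> \<phi> t \<longleftrightarrow> s \<le> t" for s t using r by (auto simp: \<phi>_def)
  have mono'[simp]: "\<psi> s < \<psi> t \<longleftrightarrow> s < t" "\<psi> s \<le> \<psi> t \<longleftrightarrow> s \<le> t" for s t
    using r by (auto simp: \<psi>_def divide_simps)
  have ends01[simp]: "\<phi> 0 = e" "\<phi> 1 = e + r" by (auto simp: \<phi>_def)
  have \<phi>ab: "\<phi> t \<in> {a..b}" if "t \<in> {0..1}" for t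
  proof -
    have "\<phi> 0 \<le> \<phi> t" "\<phi> t \<le> \<phi> 1" using that by (auto simp del: ends01)
    then show ?thesis using e by auto
  qed
  define D where "D u v = d u v / r" for u v
  define F' where "F' = (\<lambda>\<gamma>. \<gamma> \<circ> \<phi>) ` F"
  \<comment> \<open>Rescaling preserves the relative size of a detour and divides the length of a
    gap by \<open>r\<close>.\<close>
  define \<alpha> where "\<alpha> = min c (c / r)"
  have \<alpha>: "\<alpha> > 0" "\<alpha> \<le> c" "\<alpha> \<le> c / r" using c r by (auto simp: \<alpha>_def)
  have fam: "curve_family M D 0 1 F'"
    unfolding curve_family_def
  proof (intro conjI ballI impI)
    show "F' \<noteq> {}" using F by (auto simp: F'_def curve_family_def)
    fix \<gamma>' assume "\<gamma>' \<in> F'"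
    then obtain \<gamma> where g: "\<gamma> \<in> F" "\<gamma>' = \<gamma> \<circ> \<phi>" by (auto simp: F'_def)
    have gM: "\<gamma> ` {a..b} \<subseteq> M" and iso: "isometric_on_interval d a b \<gamma>"
      using F g by (auto simp: curve_family_def)
    show "\<gamma>' ` {0..1} \<subseteq> M" using gM \<phi>ab g by auto
    show "isometric_on_interval D 0 1 \<gamma>'"
      unfolding isometric_on_interval_def
    proof (intro ballI)
      fix s t :: real assume "s \<in> {0..1}" "t \<in> {0..1}"
      then have "D (\<gamma>' s) (\<gamma>' t) = \<bar>\<phi> s - \<phi> t\<bar> / r"
        using isometric_curve_mem[OF iso \<phi>ab \<phi>ab] by (simp add: D_def g)
      also have "\<phi> s - \<phi> t = r * (s - t)" by (simp add: \<phi>_def algebra_simps)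
      finally show "D (\<gamma>' s) (\<gamma>' t) = \<bar>s - t\<bar>" using r by (simp add: abs_mult)
    qed
  next
    fix \<gamma>\<^sub>1' \<gamma>\<^sub>2' and u :: real
    assume "\<gamma>\<^sub>1' \<in> F'" "\<gamma>\<^sub>2' \<in> F'" and u: "u \<in> {0..1}" and eq: "\<gamma>\<^sub>1' u = \<gamma>\<^sub>2' u"
    then obtain \<gamma>\<^sub>1 \<gamma>\<^sub>2 where g: "\<gamma>\<^sub>1 \<in> F" "\<gamma>\<^sub>2 \<in> F" "\<gamma>\<^sub>1' = \<gamma>\<^sub>1 \<circ> \<phi>" "\<gamma>\<^sub>2' = \<gamma>\<^sub>2 \<circ> \<phi>"
      by (auto simp: F'_def)
    have "\<gamma>\<^sub>1 (\<phi> u) = \<gamma>\<^sub>2 (\<phi> u)" using eq g by simp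
    then obtain \<gamma> where g': "\<gamma> \<in> F" "\<And>t. t \<in> {a..\<phi> u} \<Longrightarrow> \<gamma> t = \<gamma>\<^sub>1 t" "\<And>t. t \<in> {\<phi> u..b} \<Longrightarrow> \<gamma> t = \<gamma>\<^sub>2 t"
      using curve_family_concat[OF F g(1,2) \<phi>ab[OF u]] by metis
    have "\<phi> t \<in> {a..\<phi> u}" if "t \<in> {0..u}" for t using \<phi>ab[of t] that u by auto
    moreover have "\<phi> t \<in> {\<phi> u..b}" if "t \<in> {u..1}" for t using \<phi>ab[of t] that u by auto
    ultimately show "\<exists>\<gamma>\<in>F'. (\<forall>t\<in>{0..u}. \<gamma> t = \<gamma>\<^sub>1' t) \<and> (\<forall>t\<in>{u..1}. \<gamma> t = \<gamma>\<^sub>2' t)"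
      using g g' by (intro bexI[of _ "\<gamma> \<circ> \<phi>"]) (auto simp: F'_def)
  qed
  have ends: "\<forall>\<gamma>\<in>F'. \<forall>\<eta>\<in>F'. \<gamma> 0 = \<eta> 0 \<and> \<gamma> 1 = \<eta> 1"
    using ag e r by (auto simp: F'_def agree_off_def)
  have "uniformly_thick D 0 1 F' \<alpha>"
    unfolding uniformly_thick_def
  proof (intro ballI allI impI)
    fix \<gamma>' and T :: "real set" assume "\<gamma>' \<in> F'" and T: "finite T \<and> T \<subseteq> {0..1}"
    then obtain \<gamma> where g: "\<gamma> \<in> F" "\<gamma>' = \<gamma> \<circ> \<phi>" by (auto simp: F'_def)
    have "\<phi> ` T \<union> {e, e + r} \<subseteq> {a..b}" using T \<phi>ab e r by auto
    then obtain T1 where T1: "finite T1" "\<phi> ` T \<union> {e, e + r} \<subseteq> T1" "T1 \<subseteq> {a..b}"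
      "c \<le> good_length d F c \<gamma> T1"
      using th g(1) T unfolding uniformly_thick_def
      by (metis finite.emptyI finite.insertI finite_UnI finite_imageI)
    define T' where "T' = \<psi> ` (T1 \<inter> {e..e + r})"
    have T'in: "v \<in> T' \<longleftrightarrow> \<phi> v \<in> T1 \<and> v \<in> {0..1}" for v
    proof -
      have "\<phi> v \<in> {e..e + r} \<longleftrightarrow> v \<in> {0..1}" using mono(2)[of 0 v] mono(2)[of v 1] by simp
      then show ?thesis unfolding T'_def by (metis (no_types, lifting) Int_iff imageE image_eqI inv)
    qed
    have T': "finite T'" "T \<subseteq> T'" "T' \<subseteq> {0..1}"
    proof -
      show "finite T'" using T1 by (simp add: T'_def)
      show "T \<subseteq> T'" "T' \<subseteq> {0..1}" unfolding subset_iff T'in using T1(2) T by blast+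
    qed
    let ?G = "good_gaps d F c \<gamma> T1" and ?G' = "good_gaps D F' \<alpha> \<gamma>' T'"
    have good: "(\<psi> s, \<psi> t) \<in> ?G'" if st: "(s, t) \<in> ?G" for s t
    proof -
      note gp = gapsD[OF good_gapsD(1)[OF st]]
      obtain \<eta> v where eta: "\<eta> \<in> F" "\<eta> s = \<gamma> s" "\<eta> t = \<gamma> t" "\<forall>u\<in>{s<..<t}. \<eta> u \<noteq> \<gamma> u"
        "v \<in> {s<..<t}" "c * (t - s) \<le> d (\<gamma> v) (\<eta> v)"
        using good_gapsD(2)[OF st] unfolding good_gap_def by blast
      \<comment> \<open>On a gap the two curves differ throughout, and curves of \<open>F\<close>
        differ only in \<open>{x<..<y}\<close>.\<close>
      have "{s<..<t} \<subseteq> {x<..<y}"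
      proof
        fix u assume u: "u \<in> {s<..<t}"
        then have "u \<in> {a..b}" using gp(1,2) T1(3) by force
        then show "u \<in> {x<..<y}" using ag eta(1,4) g(1) u unfolding agree_off_def by blast
      qed
      then have "x \<le> s" "t \<le> y" using gp(3) by (auto simp: greaterThanLessThan_subseteq_greaterThanLessThan)
      then have "\<phi> 0 \<le> \<phi> (\<psi> s)" "\<phi> (\<psi> t) \<le> \<phi> 1" using e by auto
      then have st01: "0 \<le> \<psi> s" "\<psi> t \<le> 1" by (simp_all only: mono)
      have "\<psi> s < \<psi> t" using gp(3) by simp
      have g1: "(\<psi> s, \<psi> t) \<in> gaps T'"
      proof (rule gapsI)
        show "\<psi> s \<in> T'" "\<psi> t \<in> T'" unfolding T'in using gp(1,2) st01 \<open>\<psi> s < \<psi> t\<close> by (simp_all del: mono')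
        fix w assume w: "w \<in> T'" "\<psi> s < w" "w < \<psi> t"
        then have "\<phi> (\<psi> s) < \<phi> w" "\<phi> w < \<phi> (\<psi> t)" by (simp_all only: mono)
        then show False using gp(4)[of "\<phi> w"] w(1) by (auto simp: T'in)
      qed fact
      have "\<alpha> * (\<psi> t - \<psi> s) = \<alpha> * (t - s) / r" by (simp add: \<psi>_def diff_divide_distrib[symmetric])
      also have "\<dots> \<le> c * (t - s) / r"
        using \<alpha> gp(3) r by (intro divide_right_mono mult_right_mono) auto
      also have "\<dots> \<le> D (\<gamma> v) (\<eta> v)" using eta(6) r by (auto simp: D_def intro: divide_right_mono)
      finally have dist: "\<alpha> * (\<psi> t - \<psi> s) \<le> D (\<gamma>' (\<psi> v)) ((\<eta> \<circ> \<phi>) (\<psi> v))" by (simp add: g)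
      have "(\<eta> \<circ> \<phi>) u \<noteq> \<gamma>' u" if "u \<in> {\<psi> s<..<\<psi> t}" for u
      proof -
        have "\<phi> (\<psi> s) < \<phi> u" "\<phi> u < \<phi> (\<psi> t)" using that by (simp_all only: mono) auto
        then show ?thesis using eta(4) g by simp
      qed
      then have "good_gap D F' \<alpha> \<gamma>' (\<psi> s) (\<psi> t)"
        unfolding good_gap_def using eta dist g
        by (intro bexI[of _ "\<eta> \<circ> \<phi>"] conjI bexI[of _ "\<psi> v"]) (auto simp: F'_def)
      then show ?thesis using g1 by (simp add: good_gaps_def)
    qed
    have "good_length d F c \<gamma> T1 / r = (\<Sum>st\<in>?G. (snd st - fst st) / r)"
      by (simp add: good_length_def case_prod_unfold sum_divide_distrib)
    also have "\<dots> \<le> good_length D F' \<alpha> \<gamma>' T'"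
      unfolding good_length_def
    proof (rule sum_pairs_le[where f = "\<lambda>st. (\<psi> (fst st), \<psi> (snd st))"])
      show "inj_on (\<lambda>st. (\<psi> (fst st), \<psi> (snd st))) ?G"
        by (rule inj_onI) (metis inv(2) prod.inject prod.collapse)
    qed (use T1(1) T'(1) good in \<open>auto simp: finite_good_gaps \<psi>_def diff_divide_distrib dest: good_gapsD(3)\<close>)
    finally have "c / r \<le> good_length D F' \<alpha> \<gamma>' T'"
      using T1(4) r by (meson divide_right_mono less_imp_le order_trans)
    then show "\<exists>T'. finite T' \<and> T \<subseteq> T' \<and> T' \<subseteq> {0..1} \<and> \<alpha> \<le> good_length D F' \<alpha> \<gamma>' T'"
      using T' \<alpha> by (intro exI[of _ T']) auto
  qed
  then show thesis using that fam ends \<alpha>(1) unfolding D_def by blast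
qed

lemma thick_family_normalize:
  assumes M: "Metric_space M d" and th: "thick_family M d p q a b \<Gamma>" and r: "0 < r" "r \<le> d p q"
  obtains F \<alpha> where "curve_family M (\<lambda>u v. d u v / r) 0 1 F" "\<alpha> > 0"
    "uniformly_thick (\<lambda>u v. d u v / r) 0 1 F \<alpha>" "\<forall>\<gamma>\<in>F. \<forall>\<eta>\<in>F. \<gamma> 0 = \<eta> 0 \<and> \<gamma> 1 = \<eta> 1"
proof -
  have geo: "geodesic M d p q a b \<gamma>" if "\<gamma> \<in> \<Gamma>" for \<gamma> using th that by (simp add: thick_family_def)
  obtain \<gamma>\<^sub>0 where g0: "\<gamma>\<^sub>0 \<in> \<Gamma>" using th by (auto simp: thick_family_def)
  have "d (\<gamma>\<^sub>0 a) (\<gamma>\<^sub>0 b) = b - a" "a \<le> b" "\<gamma>\<^sub>0 a = p" "\<gamma>\<^sub>0 b = q"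
    using geo[OF g0] by (auto simp: geodesic_def isometric_on_interval_def)
  then have rb: "r \<le> b - a" "a < b" using r by auto
  have fam: "curve_family M d a b \<Gamma>"
    unfolding curve_family_def
  proof (intro conjI ballI impI)
    fix \<gamma>\<^sub>1 \<gamma>\<^sub>2 c assume *: "\<gamma>\<^sub>1 \<in> \<Gamma>" "\<gamma>\<^sub>2 \<in> \<Gamma>" "c \<in> {a..b}" "\<gamma>\<^sub>1 c = \<gamma>\<^sub>2 c"
    then have "restrict (\<lambda>t. if t \<le> c then \<gamma>\<^sub>1 t else \<gamma>\<^sub>2 t) {a..b} \<in> \<Gamma>"
      using th by (simp add: thick_family_def concatenation_closed_def)
    then show "\<exists>\<gamma>\<in>\<Gamma>. (\<forall>t\<in>{a..c}. \<gamma> t = \<gamma>\<^sub>1 t) \<and> (\<forall>t\<in>{c..b}. \<gamma> t = \<gamma>\<^sub>2 t)"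
      using * by (rule_tac bexI) auto
  qed (use g0 geo in \<open>auto simp: geodesic_def\<close>)
  have ag: "agree_off {a..b} {a<..<b} \<Gamma>"
    unfolding agree_off_def
  proof (intro ballI)
    fix \<gamma> \<eta> t assume "\<gamma> \<in> \<Gamma>" "\<eta> \<in> \<Gamma>" "t \<in> {a..b} - {a<..<b}"
    moreover from this have "t = a \<or> t = b" by auto
    ultimately show "\<gamma> t = \<eta> t" using geo by (auto simp: geodesic_def)
  qed
  obtain c where c: "c > 0" "uniformly_thick d a b \<Gamma> c"
    using thick_family_imp_uniformly_thick[OF M th rb(2)] .
  have "a \<le> b" using rb by simp
  from thick_localize[OF fam c(2,1) ag this r(1)]
  obtain F c' x y where F: "curve_family M d a b F" "uniformly_thick d a b F c'" "c' > 0"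
    "agree_off {a..b} {x<..<y} F" and xy: "a \<le> x" "x \<le> y" "y \<le> b" "y - x \<le> r" .
  \<comment> \<open>The window of length \<open>r\<close> starts at \<open>x\<close>, or earlier
    where it would run past \<open>b\<close>.\<close>
  have "a \<le> min x (b - r)" "min x (b - r) + r \<le> b" "min x (b - r) \<le> x" "y \<le> min x (b - r) + r"
    using xy rb by (auto simp: min_def)
  from thick_rescale[OF F r(1) this xy(2)] that show thesis by blast
qed

section \<open>Graphs made of pieces of curves of a thick family\<close>

locale thick_curves = Metric_space M d
  for M :: "'a set" and d :: "'a \<Rightarrow> 'a \<Rightarrow> real" +
  fixes F :: "(real \<Rightarrow> 'a) set" and v0 v1 :: 'a and \<alpha> :: real
  assumes family: "curve_family M d 0 1 F"
    and thick: "uniformly_thick d 0 1 F \<alpha>"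
    and \<alpha>_pos: "\<alpha> > 0"
    and start: "\<And>\<gamma>. \<gamma> \<in> F \<Longrightarrow> \<gamma> 0 = v0"
    and finish: "\<And>\<gamma>. \<gamma> \<in> F \<Longrightarrow> \<gamma> 1 = v1"
begin

text \<open>On each curve of the family this is the parameter. Hence curves meet only at equal
  parameters and can be concatenated at every common point.\<close>

definition height :: "'a \<Rightarrow> real" where
  "height z = d v0 z"

definition segment :: "'a set \<Rightarrow> bool" where
  "segment e \<longleftrightarrow> (\<exists>\<gamma>\<in>F. \<exists>x y. 0 \<le> x \<and> x < y \<and> y \<le> 1 \<and> e = \<gamma> ` {x..y})"

text \<open>The edges of a \<open>graph\<close> are sets of points. Their parametrisation is
  recovered from the set by means of the height, with no reference to a particular curve, since an
  edge may lie on many curves.\<close>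

definition lo :: "'a set \<Rightarrow> real" where
  "lo e = Inf (height ` e)"

definition hi :: "'a set \<Rightarrow> real" where
  "hi e = Sup (height ` e)"

definition pt :: "'a set \<Rightarrow> real \<Rightarrow> 'a" where
  "pt e t = (THE z. z \<in> e \<and> height z = t)"

abbreviation source :: "'a set \<Rightarrow> 'a" where
  "source e \<equiv> pt e (lo e)"

abbreviation sink :: "'a set \<Rightarrow> 'a" where
  "sink e \<equiv> pt e (hi e)"

definition part :: "'a set \<Rightarrow> real \<Rightarrow> real \<Rightarrow> 'a set" where
  "part e s t = pt e ` {s..t}"

lemma curve_mem: "\<gamma> \<in> F \<Longrightarrow> t \<in> {0..1} \<Longrightarrow> \<gamma> t \<in> M"
  using family by (auto simp: curve_family_def image_subset_iff)

lemma curve_isometric: "\<gamma> \<in> F \<Longrightarrow> isometric_on_interval d 0 1 \<gamma>"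
  using family by (auto simp: curve_family_def)

lemma curve_dist: "\<gamma> \<in> F \<Longrightarrow> s \<in> {0..1} \<Longrightarrow> t \<in> {0..1} \<Longrightarrow> d (\<gamma> s) (\<gamma> t) = \<bar>s - t\<bar>"
  by (rule isometric_curve_mem[OF curve_isometric])

lemma height_curve: "\<gamma> \<in> F \<Longrightarrow> t \<in> {0..1} \<Longrightarrow> height (\<gamma> t) = t"
  using curve_dist[of \<gamma> 0 t] start[of \<gamma>] by (simp add: height_def)

lemma segmentI:
  assumes g: "\<gamma> \<in> F" and xy: "0 \<le> x" "x < y" "y \<le> 1"
  shows "segment (\<gamma> ` {x..y})" "lo (\<gamma> ` {x..y}) = x" "hi (\<gamma> ` {x..y}) = y"
    "\<And>t. t \<in> {x..y} \<Longrightarrow> pt (\<gamma> ` {x..y}) t = \<gamma> t"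
proof -
  have h: "height (\<gamma> t) = t" if "t \<in> {x..y}" for t using height_curve[OF g] that xy by auto
  then have "height ` \<gamma> ` {x..y} = {x..y}" by (force simp: image_image)
  then show "lo (\<gamma> ` {x..y}) = x" "hi (\<gamma> ` {x..y}) = y" using xy by (simp_all add: lo_def hi_def)
  show "segment (\<gamma> ` {x..y})" using g xy by (auto simp: segment_def)
  show "pt (\<gamma> ` {x..y}) t = \<gamma> t" if "t \<in> {x..y}" for t
    unfolding pt_def by (rule the_equality) (use that h in auto)
qed

lemma segmentE:
  assumes "segment e"
  obtains \<gamma> where "\<gamma> \<in> F" "e = \<gamma> ` {lo e..hi e}" "\<And>t. t \<in> {lo e..hi e} \<Longrightarrow> pt e t = \<gamma> t"
  using assms segmentI unfolding segment_def by metis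

lemma segment_bounds:
  assumes "segment e"
  shows "0 \<le> lo e" "lo e < hi e" "hi e \<le> 1"
  using assms segmentI(2,3) unfolding segment_def by auto

lemma segment_range:
  assumes "segment e" "t \<in> {lo e..hi e}"
  shows "t \<in> {0..1}"
  using assms segment_bounds[of e] by auto

lemma pt_in: "segment e \<Longrightarrow> t \<in> {lo e..hi e} \<Longrightarrow> pt e t \<in> e"
  by (metis segmentE image_eqI)

lemma height_pt: "segment e \<Longrightarrow> t \<in> {lo e..hi e} \<Longrightarrow> height (pt e t) = t"
  by (metis segmentE height_curve segment_range)

lemma segment_mem:
  assumes "segment e" "z \<in> e"
  shows "height z \<in> {lo e..hi e}" "pt e (height z) = z"
proof -
  obtain \<gamma> where g: "\<gamma> \<in> F" "e = \<gamma> ` {lo e..hi e}" "\<And>t. t \<in> {lo e..hi e} \<Longrightarrow> pt e t = \<gamma> t"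
    by (rule segmentE[OF assms(1)]) (rule that)
  obtain t where t: "t \<in> {lo e..hi e}" "z = \<gamma> t" using g(2) assms(2) by blast
  then have "height z = t" using height_curve[OF g(1)] segment_range[OF assms(1)] by simp
  then show "height z \<in> {lo e..hi e}" "pt e (height z) = z" using t g(3) by auto
qed

lemma segment_eq_pt: "segment e \<Longrightarrow> e = pt e ` {lo e..hi e}"
  using segment_mem pt_in by (force simp: image_iff)

lemma segment_isometric: "segment e \<Longrightarrow> isometric_on_interval d (lo e) (hi e) (pt e)"
  unfolding isometric_on_interval_def
  by (metis segmentE curve_dist segment_range)

lemma pt_dist: "segment e \<Longrightarrow> s \<in> {lo e..hi e} \<Longrightarrow> t \<in> {lo e..hi e} \<Longrightarrow> d (pt e s) (pt e t) = \<bar>s - t\<bar>"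
  by (rule isometric_curve_mem[OF segment_isometric])

lemma segment_subset: "segment e \<Longrightarrow> e \<subseteq> M"
  by (metis segmentE curve_mem segment_range image_subset_iff)

lemma pt_mem: "segment e \<Longrightarrow> t \<in> {lo e..hi e} \<Longrightarrow> pt e t \<in> M"
  using pt_in segment_subset by blast

lemma height_dist:
  assumes "segment e" "segment f" "y \<in> e" "z \<in> f"
  shows "\<bar>height y - height z\<bar> \<le> d y z"
proof -
  obtain \<gamma> where g: "\<gamma> \<in> F" using family by (auto simp: curve_family_def)
  have "v0 \<in> M" using curve_mem[OF g, of 0] start[OF g] by simp
  moreover have "y \<in> M" "z \<in> M" using assms segment_subset by auto
  ultimately show ?thesis
    using triangle[of v0 y z] triangle[of v0 z y] commute[of y z] by (simp add: height_def abs_le_iff)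
qed

lemma partI:
  assumes e: "segment e" and st: "lo e \<le> s" "s < t" "t \<le> hi e"
  shows "segment (part e s t)" "lo (part e s t) = s" "hi (part e s t) = t"
    "\<And>u. u \<in> {s..t} \<Longrightarrow> pt (part e s t) u = pt e u" "part e s t \<subseteq> e"
proof -
  obtain \<gamma> where g: "\<gamma> \<in> F" "\<And>t. t \<in> {lo e..hi e} \<Longrightarrow> pt e t = \<gamma> t"
    by (rule segmentE[OF e]) (rule that)
  have "part e s t = \<gamma> ` {s..t}" unfolding part_def using g st by (intro image_cong) auto
  then show "segment (part e s t)" "lo (part e s t) = s" "hi (part e s t) = t"
    "\<And>u. u \<in> {s..t} \<Longrightarrow> pt (part e s t) u = pt e u"
    using segmentI[OF g(1), of s t] segment_bounds[OF e] st g(2) by auto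
  show "part e s t \<subseteq> e" unfolding part_def using pt_in[OF e] st by auto
qed

lemma pt_subset:
  assumes "segment e" "segment f" "f \<subseteq> e" "u \<in> {lo f..hi f}"
  shows "pt f u = pt e u" "u \<in> {lo e..hi e}"
  using segment_mem[OF assms(1), of "pt f u"] pt_in[OF assms(2,4)] assms(3) height_pt[OF assms(2,4)]
  by auto

section \<open>Edges that meet only at ends, and directed paths of such edges\<close>

definition meets_at_ends :: "'a set \<Rightarrow> 'a set \<Rightarrow> bool" where
  "meets_at_ends e f \<longleftrightarrow> (\<forall>z\<in>e \<inter> f. height z \<in> {lo e, hi e} \<and> height z \<in> {lo f, hi f})"

definition edge_system :: "'a set set \<Rightarrow> bool" where
  "edge_system E \<longleftrightarrow> finite E \<and> E \<noteq> {} \<and> (\<forall>e\<in>E. segment e) \<and>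
     (\<forall>e\<in>E. \<forall>f\<in>E. e \<noteq> f \<longrightarrow> meets_at_ends e f)"

definition graph_of :: "'a set set \<Rightarrow> 'a graph" where
  "graph_of E = \<lparr>pts = \<Union>E, verts = source ` E \<union> sink ` E, edges = E, src = source, snk = sink\<rparr>"

lemma graph_of_simps [simp]:
  "pts (graph_of E) = \<Union>E" "verts (graph_of E) = source ` E \<union> sink ` E"
  "edges (graph_of E) = E" "src (graph_of E) = source" "snk (graph_of E) = sink"
  by (simp_all add: graph_of_def)

lemma edge_systemD:
  assumes "edge_system E"
  shows "finite E" "E \<noteq> {}" "\<And>e. e \<in> E \<Longrightarrow> segment e"
    "\<And>e f z. e \<in> E \<Longrightarrow> f \<in> E \<Longrightarrow> e \<noteq> f \<Longrightarrow> z \<in> e \<Longrightarrow> z \<in> f \<Longrightarrow> height z = lo e \<or> height z = hi e"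
  using assms unfolding edge_system_def meets_at_ends_def by auto

lemma edge_systemI:
  assumes "finite E" "E \<noteq> {}" "\<And>e. e \<in> E \<Longrightarrow> segment e"
    "\<And>e f z. e \<in> E \<Longrightarrow> f \<in> E \<Longrightarrow> e \<noteq> f \<Longrightarrow> z \<in> e \<Longrightarrow> z \<in> f \<Longrightarrow> height z = lo e \<or> height z = hi e"
  shows "edge_system E"
  using assms unfolding edge_system_def meets_at_ends_def by blast

lemma segment_end:
  assumes "segment e" "z \<in> e" "height z = lo e \<or> height z = hi e"
  shows "z = source e \<or> z = sink e"
  using segment_mem(2)[OF assms(1,2)] assms(3) by auto

lemma ends_in: "segment e \<Longrightarrow> source e \<in> e" "segment e \<Longrightarrow> sink e \<in> e"
  using segment_bounds[of e] by (auto intro: pt_in)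

lemma edge_verts:
  assumes E: "edge_system E" and e: "e \<in> E"
  shows "e \<inter> (source ` E \<union> sink ` E) = {source e, sink e}"
proof
  note ES = edge_systemD[OF E]
  have "z = source e \<or> z = sink e" if z: "z \<in> e" and f: "f \<in> E" "z = source f \<or> z = sink f" for z f
  proof (cases "f = e")
    case False
    have "z \<in> f" using f ends_in ES(3) by auto
    then show ?thesis using ES(4)[OF e f(1) _ z] False segment_end[OF ES(3)[OF e] z] by blast
  qed (use f in auto)
  then show "e \<inter> (source ` E \<union> sink ` E) \<subseteq> {source e, sink e}" by blast
  show "{source e, sink e} \<subseteq> e \<inter> (source ` E \<union> sink ` E)" using e ends_in[OF ES(3)[OF e]] by auto
qed

lemma source_neq_sink: "segment e \<Longrightarrow> source e \<noteq> sink e"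
  using height_pt[of e "lo e"] height_pt[of e "hi e"] segment_bounds[of e] by force

lemma graph_of_directed:
  assumes E: "edge_system E"
  shows "directed_metric_graph d (graph_of E)"
proof -
  note ES = edge_systemD[OF E]
  have "Metric_space (\<Union>E) d"
    using subspace[of "\<Union>E"] segment_subset ES(3) by blast
  moreover have "\<exists>a b \<phi>. a < b \<and> isometric_on_interval d a b \<phi> \<and> \<phi> ` {a..b} = e \<and>
      e \<inter> (source ` E \<union> sink ` E) = {\<phi> a, \<phi> b}" if "e \<in> E" for e
    using segment_isometric[OF ES(3)[OF that]] edge_verts[OF E that] segment_bounds[OF ES(3)[OF that]]
      segment_eq_pt[OF ES(3)[OF that]]
    by (intro exI[of _ "lo e"] exI[of _ "hi e"] exI[of _ "pt e"]) simp
  moreover have "e \<inter> f \<subseteq> source ` E \<union> sink ` E" "card (e \<inter> f) \<le> 2" if ef: "e \<in> E" "f \<in> E" "e \<noteq> f" for e f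
  proof -
    have sub: "e \<inter> f \<subseteq> {source e, sink e}"
      using ES(4)[OF ef] segment_end[OF ES(3)[OF ef(1)]] by blast
    then show "e \<inter> f \<subseteq> source ` E \<union> sink ` E" using ef(1) by blast
    have "card (e \<inter> f) \<le> card {source e, sink e}" by (rule card_mono) (use sub in auto)
    also have "\<dots> \<le> 2" by (simp add: card_insert_if)
    finally show "card (e \<inter> f) \<le> 2" .
  qed
  moreover have "source ` E \<union> sink ` E \<subseteq> \<Union>E" using ES(3) ends_in by blast
  ultimately show ?thesis
    unfolding directed_metric_graph_def finite_metric_graph_def
    using ES(1,3) edge_verts[OF E] source_neq_sink by simp
qed

text \<open>Consecutive edges of a directed path are pieces of curves of the family that can be
  concatenated at their common vertex.\<close>

lemma path_curve:
  assumes E: "edge_system E" and es: "directed_edge_path (graph_of E) es"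
  shows "\<exists>\<gamma>\<in>F. \<Union>(set es) = \<gamma> ` {lo (hd es)..hi (last es)} \<and> lo (hd es) < hi (last es) \<and>
    \<gamma> (hi (last es)) = sink (last es)"
proof -
  have "es \<noteq> []" using es by (simp add: directed_edge_path_def)
  then show ?thesis using es
  proof (induction es rule: rev_nonempty_induct)
    case (single e)
    then have e: "segment e" using edge_systemD(3)[OF E] by (auto simp: directed_edge_path_def)
    obtain \<gamma> where "\<gamma> \<in> F" "e = \<gamma> ` {lo e..hi e}" "\<And>t. t \<in> {lo e..hi e} \<Longrightarrow> pt e t = \<gamma> t"
      by (rule segmentE[OF e]) (rule that)
    then show ?case using segment_bounds[OF e] by (intro bexI[of _ \<gamma>]) auto
  next
    case (snoc e es)
    have path: "directed_edge_path (graph_of E) es" and last: "sink (last es) = source e"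
      and e: "segment e" and l: "segment (last es)" and h: "segment (hd es)"
    proof -
      have s: "\<And>k. Suc k < length (es @ [e]) \<Longrightarrow> sink ((es @ [e]) ! k) = source ((es @ [e]) ! Suc k)"
        using snoc.prems by (simp add: directed_edge_path_def)
      have sub: "set es \<subseteq> E" "e \<in> E" using snoc.prems by (auto simp: directed_edge_path_def)
      show "segment e" "segment (last es)" "segment (hd es)"
        using sub edge_systemD(3)[OF E] snoc.hyps last_in_set[of es] list.set_sel(1)[of es] by blast+
      show "directed_edge_path (graph_of E) es"
        unfolding directed_edge_path_def
      proof (intro conjI allI impI)
        fix k assume "Suc k < length es"
        then show "snk (graph_of E) (es ! k) = src (graph_of E) (es ! Suc k)"
          using s[of k] by (simp add: nth_append)
      qed (use snoc.hyps sub in auto)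
      show "sink (last es) = source e"
        using s[of "length es - 1"] snoc.hyps by (simp add: nth_append last_conv_nth)
    qed
    obtain \<gamma> where g: "\<gamma> \<in> F" "\<Union>(set es) = \<gamma> ` {lo (hd es)..hi (last es)}" "lo (hd es) < hi (last es)"
      "\<gamma> (hi (last es)) = sink (last es)"
      using snoc.IH[OF path] by blast
    obtain \<eta> where eta: "\<eta> \<in> F" "e = \<eta> ` {lo e..hi e}" "\<And>t. t \<in> {lo e..hi e} \<Longrightarrow> pt e t = \<eta> t"
      by (rule segmentE[OF e]) (rule that)
    note b = segment_bounds[OF e] segment_bounds[OF l] segment_bounds[OF h]
    \<comment> \<open>Both numbers are the height of the common vertex, so the two curves meet at
      the same parameter.\<close>
    have eq: "hi (last es) = lo e"
      using height_pt[OF l, of "hi (last es)"] height_pt[OF e, of "lo e"] last b by simp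
    have "lo e \<in> {0..1}" "\<gamma> (lo e) = \<eta> (lo e)" using b last eq g(4) eta(3) by auto
    then obtain \<zeta> where z: "\<zeta> \<in> F" "\<And>t. t \<in> {0..lo e} \<Longrightarrow> \<zeta> t = \<gamma> t" "\<And>t. t \<in> {lo e..1} \<Longrightarrow> \<zeta> t = \<eta> t"
      using curve_family_concat[OF family g(1) eta(1)] by metis
    have "\<Union>(set (es @ [e])) = \<gamma> ` {lo (hd es)..lo e} \<union> \<eta> ` {lo e..hi e}"
      using g(2) eta(2) eq by auto
    also have "\<gamma> ` {lo (hd es)..lo e} = \<zeta> ` {lo (hd es)..lo e}" using z b by (intro image_cong) auto
    also have "\<eta> ` {lo e..hi e} = \<zeta> ` {lo e..hi e}" using z b by (intro image_cong) auto
    also have "\<zeta> ` {lo (hd es)..lo e} \<union> \<zeta> ` {lo e..hi e} = \<zeta> ` {lo (hd es)..hi e}"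
      using g(3) eq b by (auto simp flip: image_Un simp: ivl_disj_un)
    finally have "\<Union>(set (es @ [e])) = \<zeta> ` {lo (hd es)..hi e}" .
    then show ?case using z g(3) eq b eta(3)[of "hi e"] snoc.hyps
      by (intro bexI[of _ \<zeta>]) auto
  qed
qed

lemma path_isometric:
  assumes E: "edge_system E" and es: "directed_edge_path (graph_of E) es"
  shows "isometric_to_compact_interval d (\<Union>(set es))"
proof -
  obtain \<gamma> where g: "\<gamma> \<in> F" "\<Union>(set es) = \<gamma> ` {lo (hd es)..hi (last es)}" "lo (hd es) < hi (last es)"
    using path_curve[OF assms] by blast
  have "hd es \<in> E" "last es \<in> E" using es by (auto simp: directed_edge_path_def)
  then have "0 \<le> lo (hd es)" "hi (last es) \<le> 1"
    using segment_bounds edge_systemD(3)[OF E] by auto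
  then have "isometric_on_interval d (lo (hd es)) (hi (last es)) \<gamma>"
    using curve_dist[OF g(1)] by (simp add: isometric_on_interval_def)
  then show ?thesis using g unfolding isometric_to_compact_interval_def by (metis less_imp_le)
qed

lemma full_path_curve:
  assumes E: "edge_system E" and es: "directed_edge_path_from_to (graph_of E) v0 v1 es"
  obtains \<gamma> where "\<gamma> \<in> F" "\<Union>(set es) = \<gamma> ` {0..1}"
proof -
  have path: "directed_edge_path (graph_of E) es" and se: "source (hd es) = v0" "sink (last es) = v1"
    using es by (auto simp: directed_edge_path_from_to_def)
  obtain \<gamma> where g: "\<gamma> \<in> F" "\<Union>(set es) = \<gamma> ` {lo (hd es)..hi (last es)}"
    using path_curve[OF E path] by blast
  have "hd es \<in> E" "last es \<in> E" using path by (auto simp: directed_edge_path_def)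
  then have s: "segment (hd es)" "segment (last es)" using edge_systemD(3)[OF E] by auto
  have "lo (hd es) = height v0" "hi (last es) = height v1"
    using height_pt[OF s(1), of "lo (hd es)"] height_pt[OF s(2), of "hi (last es)"] se
      segment_bounds[OF s(1)] segment_bounds[OF s(2)] by auto
  moreover have "height v0 = 0" "height v1 = 1"
    using height_curve[OF g(1), of 0] height_curve[OF g(1), of 1] start[OF g(1)] finish[OF g(1)] by auto
  ultimately show thesis using that g by simp
qed

text \<open>Connectedness: the open parameter interval of \<open>e\<close> is covered by two closed
  sets, the parameters at which \<open>\<gamma>\<close> lies on \<open>e\<close> and those at which
  it lies on another edge. They are disjoint there because edges meet only at ends, and the first
  contains \<open>t\<^sub>0\<close>. Taking the closure adds the ends.\<close>

lemma curve_contains_edge: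
  assumes E: "edge_system E" and g: "\<gamma> \<in> F" "\<gamma> ` {0..1} \<subseteq> \<Union>E" and e: "e \<in> E"
    and t\<^sub>0: "lo e < t\<^sub>0" "t\<^sub>0 < hi e" "\<gamma> t\<^sub>0 \<in> e" and t: "t \<in> {lo e..hi e}"
  shows "\<gamma> t = pt e t"
proof -
  note ES = edge_systemD[OF E]
  note b = segment_bounds[OF ES(3)[OF e]]
  define Z where "Z f = {t \<in> {lo f..hi f}. \<gamma> t = pt f t}" for f
  have Z: "t \<in> Z f \<longleftrightarrow> \<gamma> t \<in> f" if "f \<in> E" "t \<in> {0..1}" for f t
  proof
    show "\<gamma> t \<in> f" if "t \<in> Z f"
      using that pt_in[OF ES(3)[OF \<open>f \<in> E\<close>], of t] by (simp add: Z_def)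
    show "t \<in> Z f" if "\<gamma> t \<in> f"
      using segment_mem[OF ES(3)[OF \<open>f \<in> E\<close>] that] height_curve[OF g(1) \<open>t \<in> {0..1}\<close>]
      by (simp add: Z_def)
  qed
  have cl: "closed (Z f)" if "f \<in> E" for f
    unfolding Z_def
  proof (rule curves_agree_closed)
    have "{lo f..hi f} \<subseteq> {0..1}" using segment_range[OF ES(3)[OF that]] by blast
    then show "isometric_on_interval d (lo f) (hi f) \<gamma>" "\<gamma> ` {lo f..hi f} \<subseteq> M"
      using curve_dist[OF g(1)] curve_mem[OF g(1)] by (auto simp: isometric_on_interval_def subset_iff)
    show "isometric_on_interval d (lo f) (hi f) (pt f)" "pt f ` {lo f..hi f} \<subseteq> M"
      using segment_isometric pt_mem ES(3)[OF that] by auto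
  qed (rule Metric_space_axioms)
  let ?I = "{lo e<..<hi e}" and ?B = "\<Union>(Z ` (E - {e}))"
  have clB: "closed ?B" using cl ES(1) by (intro closed_UN) auto
  have I01: "u \<in> {0..1}" if "u \<in> ?I" for u using that b by auto
  have "?I \<subseteq> Z e \<union> ?B"
  proof
    fix u assume u: "u \<in> ?I"
    then obtain f where "f \<in> E" "\<gamma> u \<in> f" using g(2) I01[OF u] by blast
    then show "u \<in> Z e \<union> ?B" using Z I01[OF u] by (cases "f = e") auto
  qed
  moreover have "Z e \<inter> ?B \<inter> ?I = {}"
  proof -
    have False if "u \<in> Z e" "f \<in> E" "f \<noteq> e" "u \<in> Z f" "u \<in> ?I" for u f
      using ES(4)[OF e that(2) that(3)[symmetric], of "\<gamma> u"] Z[OF e I01] Z[OF that(2) I01] that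
        height_curve[OF g(1) I01] by auto
    then show ?thesis by blast
  qed
  moreover have "connected ?I" by simp
  ultimately have "Z e \<inter> ?I = {} \<or> ?B \<inter> ?I = {}"
    using connected_closed cl[OF e] clB by (metis (no_types, lifting))
  moreover have "t\<^sub>0 \<in> Z e \<inter> ?I" using Z[OF e I01] t\<^sub>0 by auto
  ultimately have "?I \<subseteq> Z e" using \<open>?I \<subseteq> Z e \<union> ?B\<close> by blast
  then have "closure ?I \<subseteq> Z e" using cl[OF e] by (rule closure_minimal)
  then show ?thesis using t b by (auto simp: Z_def)
qed

section \<open>Length measure in terms of the height\<close>

lemma measure_lborel_translate:
  assumes "S \<in> sets borel"
  shows "measure lborel ((\<lambda>t. t - c) ` S) = measure lborel (S :: real set)"
proof -
  have "(\<lambda>t. t - c) ` S = (+) c -` S \<inter> space lborel" by (auto simp: image_iff) (metis add_diff_cancel_left')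
  moreover have "measure (distr lborel borel ((+) c)) S = measure lborel ((+) c -` S \<inter> space lborel)"
    by (rule measure_distr) (use assms in auto)
  ultimately show ?thesis using lborel_distr_plus[of c] by simp
qed

text \<open>On \<open>e\<close> the distance from the source is the height up to a translation; any
  other edge meets \<open>A\<close> in at most two points, which contribute nothing.\<close>

lemma len_graph_of:
  assumes E: "edge_system E" and e: "e \<in> E" and A: "A \<subseteq> e" "height ` A \<in> sets borel"
  shows "len d (graph_of E) A = measure lborel (height ` A)"
proof -
  note ES = edge_systemD[OF E]
  have null: "measure lborel (d (source f) ` (A \<inter> f)) = 0" if "f \<in> E - {e}" for f
  proof -
    have "A \<inter> f \<subseteq> {source e, sink e}"
      using ES(4)[OF e, of f] that A(1) segment_end[OF ES(3)[OF e]] by blast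
    then have "finite (d (source f) ` (A \<inter> f))" by (meson finite.emptyI finite.insertI finite_imageI finite_subset)
    then show ?thesis by (simp add: measure_eq_0_null_sets finite_imp_null_set_lborel)
  qed
  have "d (source e) z = height z - lo e" if "z \<in> A" for z
    using pt_dist[OF ES(3)[OF e], of "lo e" "height z"] segment_mem[OF ES(3)[OF e], of z] that A(1)
      segment_bounds[OF ES(3)[OF e]] by auto
  then have "d (source e) ` A = (\<lambda>t. t - lo e) ` height ` A" by (force simp: image_image)
  then have "measure lborel (d (source e) ` A) = measure lborel (height ` A)"
    using measure_lborel_translate[OF A(2)] by simp
  moreover have "A \<inter> e = A" using A by auto
  ultimately show ?thesis
    using null ES(1) e by (simp add: len_def sum.remove[of E e])
qed

lemma height_image:
  assumes "segment e"
  shows "height ` e = {lo e..hi e}"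
proof
  show "height ` e \<subseteq> {lo e..hi e}" using segment_mem(1)[OF assms] by blast
  show "{lo e..hi e} \<subseteq> height ` e"
  proof
    fix t assume t: "t \<in> {lo e..hi e}"
    show "t \<in> height ` e" using height_pt[OF assms t] pt_in[OF assms t]
      by (intro image_eqI[where x = "pt e t"]) simp_all
  qed
qed

lemma len_sub_edge:
  assumes E: "edge_system E" and e: "e \<in> E" and f: "segment f" "f \<subseteq> e"
  shows "len d (graph_of E) f = hi f - lo f"
  using len_graph_of[OF E e f(2)] height_image[OF f(1)] segment_bounds[OF f(1)] by simp

end

section \<open>Subdividing a graph and attaching bubbles\<close>

text \<open>The mesh bound is asserted for all supersets of the grid in the interval, because the
  sets chosen later are only known to contain it.\<close>

lemma fine_grid:
  fixes x y m :: real
  assumes "x < y" "m > 0"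
  obtains G where "finite G" "G \<subseteq> {x..y}" "x \<in> G" "y \<in> G"
    "\<And>T s t. G \<subseteq> T \<Longrightarrow> T \<subseteq> {x..y} \<Longrightarrow> (s, t) \<in> gaps T \<Longrightarrow> t - s \<le> m"
proof -
  obtain n :: nat where n: "(y - x) / m < n" using reals_Archimedean2 by blast
  moreover have "0 < (y - x) / m" using assms by simp
  ultimately have n0: "0 < real n" by linarith
  define h where "h = (y - x) / n"
  have h: "0 < h" "h \<le> m" "n * h = y - x" using n n0 assms by (auto simp: h_def field_simps)
  let ?G = "(\<lambda>k. x + real k * h) ` {0..n}"
  show thesis
  proof
    show "x \<in> ?G" by (rule image_eqI[of _ _ 0]) auto
    show "y \<in> ?G" by (rule image_eqI[of _ _ n]) (use h in auto)
    have "real k * h \<le> real n * h" if "k \<le> n" for k using that h by (intro mult_right_mono) auto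
    then have "x + real k * h \<in> {x..y}" if "k \<le> n" for k using h that by fastforce
    then show "?G \<subseteq> {x..y}" by auto
    fix T s t assume T: "?G \<subseteq> T" "T \<subseteq> {x..y}" and st: "(s, t) \<in> gaps T"
    show "t - s \<le> m"
    proof (rule ccontr)
      assume gt: "\<not> t - s \<le> m"
      note g = gapsD[OF st]
      have sx: "x \<le> s" "t \<le> y" using g T by auto
      \<comment> \<open>\<open>x + k * h\<close> is the first grid point strictly above
        \<open>s\<close>; it falls inside any gap that starts at \<open>s\<close> and is longer than
        \<open>h\<close>.\<close>
      define k where "k = nat (\<lfloor>(s - x) / h\<rfloor> + 1)"
      have "0 \<le> (s - x) / h" using sx h by simp
      then have "real k = \<lfloor>(s - x) / h\<rfloor> + 1" by (simp add: k_def)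
      then have "(s - x) / h < real k" "real k \<le> (s - x) / h + 1" by linarith+
      then have k: "s - x < k * h" "k * h \<le> s - x + h" using h by (auto simp: field_simps)
      then have "x + k * h < t" using gt h by linarith
      then have "k * h < n * h" using sx h by linarith
      then have "real k < real n" using h(1) mult_less_cancel_right_pos by blast
      then have "k \<le> n" by simp
      then have "x + real k * h \<in> ?G" by (intro image_eqI[of _ _ k]) auto
      then have "x + k * h \<in> T" using T(1) by blast
      then show False using g(4)[of "x + k * h"] k \<open>x + k * h < t\<close> by linarith
    qed
  qed simp
qed

text \<open>The supremum need not be attained, so only half of it is requested. If no element is
  positive, all elements are 0.\<close>

lemma half_optimal:
  fixes S :: "real set"
  assumes "S \<noteq> {}" "bdd_above S" "\<And>x. x \<in> S \<Longrightarrow> 0 \<le> x"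
  obtains x where "x \<in> S" "\<And>y. y \<in> S \<Longrightarrow> y \<le> 2 * x"
proof (cases "\<exists>x\<in>S. 0 < x")
  case True
  then have "Sup S / 2 < Sup S" using cSup_upper[OF _ assms(2)] by force
  then obtain x where "x \<in> S" "Sup S / 2 < x" using less_cSup_iff[OF assms(1,2)] by blast
  moreover have "y \<le> Sup S" if "y \<in> S" for y using cSup_upper[OF that assms(2)] .
  ultimately show thesis using that[of x] by fastforce
next
  case False
  then show thesis using assms that by (metis all_not_in_conv linorder_not_less mult_eq_0_iff order_antisym_conv)
qed

lemma good_length_nonneg: "0 \<le> good_length d F c \<gamma> T"
  unfolding good_length_def by (intro sum_nonneg) (auto dest: good_gapsD(3))

text \<open>Distinct gaps of one set have disjoint interiors.\<close>

lemma sum_gaps_within_le: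
  fixes x y :: real
  assumes "finite H" "x \<le> y" "H \<subseteq> {(s, t) \<in> gaps T. x \<le> s \<and> t \<le> y}"
  shows "(\<Sum>(s, t)\<in>H. t - s) \<le> y - x"
proof -
  have "(\<Sum>st\<in>H. snd st - fst st) \<le> y - x"
  proof (rule sum_disjoint_intervals_le)
    fix g assume "g \<in> H"
    then show "x \<le> fst g \<and> fst g \<le> snd g \<and> snd g \<le> y"
      using assms(3) by (cases g) (fastforce dest: gapsD(3))
  next
    fix g g' assume gg: "g \<in> H" "g' \<in> H" "g \<noteq> g'"
    have "(fst g, snd g) \<in> gaps T" "(fst g', snd g') \<in> gaps T" using gg assms(3) by auto
    then have "\<not> (fst g < snd g' \<and> fst g' < snd g)"
      using gaps_eqI[of "fst g" "snd g" T "fst g'" "snd g'"] gg(3) by (auto simp: prod_eq_iff)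
    then show "{fst g<..<snd g} \<inter> {fst g'<..<snd g'} = {}" by fastforce
  qed (use assms in auto)
  then show ?thesis by (simp add: case_prod_unfold)
qed

lemma good_length_le:
  assumes "finite T" "T \<subseteq> {x..y}" "x \<le> y"
  shows "good_length d F c \<gamma> T \<le> y - x"
  unfolding good_length_def
proof (rule sum_gaps_within_le[OF finite_good_gaps[OF assms(1)] assms(3), of _ _ _ _ T])
  show "good_gaps d F c \<gamma> T \<subseteq> {(s, t) \<in> gaps T. x \<le> s \<and> t \<le> y}"
    using assms(2) by (auto simp: good_gaps_def dest: gapsD(1,2))
qed

lemma inverse_ennreal_antimono:
  assumes "0 < r" "ennreal r \<le> x"
  shows "inverse x \<le> inverse (ennreal r)"
proof (cases x)
  case (real y)
  then have "r \<le> y" using assms by (simp add: ennreal_le_iff2)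
  then show ?thesis using real assms(1) by (simp add: inverse_ennreal ennreal_leI)
qed simp

context thick_curves begin

text \<open>\<open>f\<close> has the same end points as \<open>e\<close> and together with \<open>e\<close> forms a circle as in (A2), (A5).\<close>

definition bubble :: "'a set \<Rightarrow> 'a set \<Rightarrow> bool" where
  "bubble e f \<longleftrightarrow> segment f \<and> lo f = lo e \<and> hi f = hi e \<and> source f = source e \<and> sink f = sink e \<and>
     (\<forall>u\<in>{lo e<..<hi e}. pt f u \<noteq> pt e u) \<and>
     (\<exists>u\<in>{lo e<..<hi e}. \<alpha> * (hi e - lo e) \<le> d (pt e u) (pt f u))"

lemma good_gap_imp_bubble:
  assumes e: "segment e" and g: "good_gap d F \<alpha> (pt e) (lo e) (hi e)"
  shows "\<exists>f. bubble e f"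
proof -
  note b = segment_bounds[OF e]
  obtain \<eta> where eta: "\<eta> \<in> F" "\<eta> (lo e) = source e" "\<eta> (hi e) = sink e"
    "\<forall>u\<in>{lo e<..<hi e}. \<eta> u \<noteq> pt e u" "\<exists>u\<in>{lo e<..<hi e}. \<alpha> * (hi e - lo e) \<le> d (pt e u) (\<eta> u)"
    using g unfolding good_gap_def by blast
  note s = segmentI[OF eta(1) b]
  have "bubble e (\<eta> ` {lo e..hi e})"
    unfolding bubble_def using s eta b by simp
  then show ?thesis by blast
qed

text \<open>The interface between the construction of one stage and the verification of the axioms.
  The clauses give the subdivision, the circles with (A5) inside \<open>bubble\<close>, the
  disjointness of new arcs from everything else up to ends, the terminal edges, (A6), the bounds for
  \<open>delta_E\<close> and \<open>delta_d\<close>, and the lengths that the masses of edges depend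
  on. (A6) is stated for curves of \<open>F\<close> in the graph, since each directed path from
  \<open>v0\<close> to \<open>v1\<close> is the image of such a curve.\<close>

definition refinement :: "'a set set \<Rightarrow> real \<Rightarrow> 'a set set \<Rightarrow> ('a set \<Rightarrow> 'a set) \<Rightarrow> bool" where
  "refinement E \<delta> E' op \<longleftrightarrow>
     edge_system E' \<and> \<Union>E' = \<Union>E \<and> (\<forall>e'\<in>E'. \<exists>e\<in>E. e' \<subseteq> e) \<and>
     source ` E \<union> sink ` E \<subseteq> source ` E' \<union> sink ` E' \<and>
     (\<forall>e'\<in>E'. op e' = e' \<or> bubble e' (op e')) \<and>
     (\<forall>e'\<in>E'. \<forall>f\<in>E'. \<forall>z\<in>op e'. op e' \<noteq> e' \<and> (z \<in> f \<or> z \<in> op f \<and> f \<noteq> e') \<longrightarrow>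
        height z = lo e' \<or> height z = hi e') \<and>
     (\<forall>e\<in>E. \<forall>e'\<in>E'. e' \<subseteq> e \<and> (lo e' = lo e \<or> hi e' = hi e) \<longrightarrow> op e' = e') \<and>
     (\<forall>\<gamma>\<in>F. \<gamma> ` {0..1} \<subseteq> \<Union>E \<longrightarrow>
        \<alpha> / 4 \<le> (\<Sum>e' | e' \<in> E' \<and> e' \<subseteq> \<gamma> ` {0..1} \<and> op e' \<noteq> e'. hi e' - lo e')) \<and>
     (\<forall>e'\<in>E'. \<forall>e\<in>E. hi e' - lo e' \<le> \<delta> * (hi e - lo e)) \<and>
     (\<exists>\<eta>>0. \<forall>e\<in>E. \<forall>e'\<in>E'. e' \<subseteq> e \<and> lo e' \<noteq> lo e \<and> hi e' \<noteq> hi e \<longrightarrow>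
        hi e' - lo e' \<le> \<delta> * \<eta> \<and> (\<forall>z\<in>e'. \<forall>w\<in>\<Union>E - e. \<eta> \<le> d z w)) \<and>
     (\<forall>e\<in>E. (\<Sum>e' | e' \<in> E' \<and> e' \<subseteq> e. hi e' - lo e') = hi e - lo e)"

text \<open>The midpoint of \<open>s\<close> has a height strictly between those of the ends of
  \<open>e\<close>, whereas distinct edges share only ends.\<close>

lemma parent_unique:
  assumes "edge_system E" "e \<in> E" "f \<in> E" "segment s" "s \<subseteq> e" "s \<subseteq> f"
  shows "e = f"
proof (rule ccontr)
  assume "e \<noteq> f"
  define u where "u = (lo s + hi s) / 2"
  note b = segment_bounds[OF assms(4)]
  have u: "lo s < u" "u < hi s" "u \<in> {lo s..hi s}" using b by (auto simp: u_def)
  have e: "segment e" using assms edge_systemD by blast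
  have "lo s \<in> {lo e..hi e}" "hi s \<in> {lo e..hi e}"
    using pt_subset(2)[OF e assms(4,5)] b by auto
  moreover have "height (pt s u) = lo e \<or> height (pt s u) = hi e"
    using edge_systemD(4)[OF assms(1-3) \<open>e \<noteq> f\<close>] pt_in[OF assms(4) u(3)] assms(5,6) by blast
  ultimately show False using height_pt[OF assms(4) u(3)] u by auto
qed

text \<open>Edges meet only at ends, so once pieces of length \<tau> are removed at both ends of
  \<open>e\<close>, the distance to another edge attains a positive minimum by compactness; there
  are finitely many pairs of edges.\<close>

lemma middle_separated:
  assumes E: "edge_system E" and \<tau>: "\<tau> > 0"
  obtains \<eta> where "\<eta> > 0"
    "\<And>e t w. e \<in> E \<Longrightarrow> t \<in> {lo e + \<tau>..hi e - \<tau>} \<Longrightarrow> w \<in> \<Union>E - e \<Longrightarrow> \<eta> \<le> d (pt e t) w"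
proof -
  note ES = edge_systemD[OF E]
  have "\<exists>\<eta>>0. \<forall>t\<in>{lo e + \<tau>..hi e - \<tau>}. \<forall>w\<in>f. \<eta> \<le> d (pt e t) w" if ef: "e \<in> E" "f \<in> E" "e \<noteq> f" for e f
  proof (cases "{lo e + \<tau>..hi e - \<tau>} = {}")
    case False
    note e = ES(3)[OF ef(1)] and f = ES(3)[OF ef(2)]
    let ?K = "{lo e + \<tau>..hi e - \<tau>} \<times> {lo f..hi f}"
    have sub: "{lo e + \<tau>..hi e - \<tau>} \<subseteq> {lo e..hi e}" using \<tau> by auto
    have "continuous_on ({lo e..hi e} \<times> {lo f..hi f}) (\<lambda>(s, t). d (pt e s) (pt f t))"
      by (rule curve_dist_continuous[OF Metric_space_axioms])
        (use segment_isometric pt_mem e f in auto)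
    then have "continuous_on ?K (\<lambda>(s, t). d (pt e s) (pt f t))"
      by (rule continuous_on_subset) (use sub in auto)
    moreover have "compact ?K" by (intro compact_Times compact_Icc)
    moreover have "?K \<noteq> {}" using False segment_bounds[OF f] by auto
    ultimately obtain p where p: "p \<in> ?K"
      "\<forall>q\<in>?K. (case p of (s, t) \<Rightarrow> d (pt e s) (pt f t)) \<le> (case q of (s, t) \<Rightarrow> d (pt e s) (pt f t))"
      using continuous_attains_inf[of ?K "\<lambda>(s, t). d (pt e s) (pt f t)"] by blast
    obtain s t where st: "p = (s, t)" by (cases p)
    have s: "s \<in> {lo e..hi e}" "s \<noteq> lo e" "s \<noteq> hi e" and t: "t \<in> {lo f..hi f}" using p(1) st sub \<tau> by auto
    have "pt e s \<noteq> pt f t"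
      using ES(4)[OF ef, of "pt e s"] pt_in[OF e s(1)] pt_in[OF f t] height_pt[OF e s(1)] s by auto
    then have "0 < d (pt e s) (pt f t)" using pt_mem[OF e s(1)] pt_mem[OF f t] by simp
    moreover have "d (pt e s) (pt f t) \<le> d (pt e u) w" if "u \<in> {lo e + \<tau>..hi e - \<tau>}" "w \<in> f" for u w
      using p(2)[rule_format, of "(u, height w)"] segment_mem[OF f that(2)] that(1) st by simp
    ultimately show ?thesis by blast
  qed (auto intro: exI[of _ 1])
  then obtain h where h: "\<And>e f. e \<in> E \<Longrightarrow> f \<in> E \<Longrightarrow> e \<noteq> f \<Longrightarrow> h e f > 0 \<and>
      (\<forall>t\<in>{lo e + \<tau>..hi e - \<tau>}. \<forall>w\<in>f. h e f \<le> d (pt e t) w)" by metis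
  \<comment> \<open>The element 1 serves the graph with a single edge, which has no pair of edges to
    minimise over.\<close>
  define H where "H = insert 1 ((\<lambda>(e, f). h e f) ` {(e, f) \<in> E \<times> E. e \<noteq> f})"
  have fin: "finite H" using ES(1) unfolding H_def
    by (intro finite.insertI finite_imageI finite_subset[OF _ finite_cartesian_product[OF ES(1) ES(1)]]) auto
  have "Min H > 0" using fin h by (subst Min_gr_iff) (auto simp: H_def)
  moreover have "Min H \<le> d (pt e t) w"
    if w: "e \<in> E" "t \<in> {lo e + \<tau>..hi e - \<tau>}" "w \<in> \<Union>E - e" for e t w
  proof -
    obtain f where f: "f \<in> E" "w \<in> f" "e \<noteq> f" using w by blast
    have "Min H \<le> h e f" using fin w f by (intro Min_le) (auto simp: H_def)
    also have "\<dots> \<le> d (pt e t) w" using h[OF w(1) f(1,3)] w(2) f(2) by blast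
    finally show ?thesis .
  qed
  ultimately show thesis using that by blast
qed

end

text \<open>One stage with its parameters fixed: \<tau> is the length of the terminal pieces, \<eta>
  the distance of the middle part of an edge from the other edges, \<open>m\<close> the mesh in the
  middle part. The bound on \<open>4 * \<tau>\<close> by \<alpha> times the length lets the two
  terminal pieces cost at most half of \<alpha> times the length; \<open>4 * m < \<eta>\<close>
  leaves room for two deviations of size \<open>2 * m\<close>;
  \<open>m \<le> \<delta> * \<eta>\<close> is the bound for \<open>delta_d\<close>. Up to the factor
  2, \<open>T e\<close> is optimal among the sets that contain the grid \<open>G e\<close>.\<close>

locale subdivided = thick_curves +
  fixes E :: "'a set set" and \<delta> \<tau> \<eta> m :: real and G T :: "'a set \<Rightarrow> real set"
  assumes E: "edge_system E"
    and pos: "\<tau> > 0" "\<eta> > 0" "m > 0"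
    and \<tau>: "\<And>e. e \<in> E \<Longrightarrow> \<tau> \<le> \<delta> * (hi e - lo e)" "\<And>e. e \<in> E \<Longrightarrow> 4 * \<tau> \<le> \<alpha> * (hi e - lo e)"
      "\<And>e. e \<in> E \<Longrightarrow> 4 * \<tau> \<le> hi e - lo e"
    and m: "\<And>e. e \<in> E \<Longrightarrow> m \<le> \<delta> * (hi e - lo e)" "m \<le> \<delta> * \<eta>" "4 * m < \<eta>"
    and separated: "\<And>e t w. e \<in> E \<Longrightarrow> t \<in> {lo e + \<tau>..hi e - \<tau>} \<Longrightarrow> w \<in> \<Union>E - e \<Longrightarrow> \<eta> \<le> d (pt e t) w"
    and G: "\<And>e. e \<in> E \<Longrightarrow> finite (G e) \<and> G e \<subseteq> {lo e + \<tau>..hi e - \<tau>}"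
    and T: "\<And>e. e \<in> E \<Longrightarrow> finite (T e) \<and> T e \<subseteq> {lo e + \<tau>..hi e - \<tau>} \<and> lo e + \<tau> \<in> T e \<and> hi e - \<tau> \<in> T e"
    and mesh: "\<And>e s t. e \<in> E \<Longrightarrow> (s, t) \<in> gaps (T e) \<Longrightarrow> t - s \<le> m"
    and half_opt: "\<And>e T'. e \<in> E \<Longrightarrow> finite T' \<Longrightarrow> G e \<subseteq> T' \<Longrightarrow> T' \<subseteq> {lo e + \<tau>..hi e - \<tau>} \<Longrightarrow>
      good_length d F \<alpha> (pt e) T' \<le> 2 * good_length d F \<alpha> (pt e) (T e)"
begin

lemmas ES = edge_systemD[OF E]

definition S :: "'a set \<Rightarrow> real set" where
  "S e = T e \<union> {lo e, hi e}"

definition E' :: "'a set set" where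
  "E' = {part e s t | e s t. e \<in> E \<and> (s, t) \<in> gaps (S e)}"

text \<open>The first conjunct excludes the two terminal pieces, as required by (A2), and places the
  edge where the separation \<eta> is available.\<close>

definition circle :: "'a set \<Rightarrow> bool" where
  "circle e' \<longleftrightarrow> (\<exists>e\<in>E. e' \<subseteq> e \<and> lo e + \<tau> \<le> lo e' \<and> hi e' \<le> hi e - \<tau>) \<and> (\<exists>f. bubble e' f)"

text \<open>An arbitrary detour can be chosen: it will avoid the rest of the graph merely because
  \<open>e'\<close> is short.\<close>

definition op :: "'a set \<Rightarrow> 'a set" where
  "op e' = (if circle e' then SOME f. bubble e' f else e')"

lemma S_basic:
  assumes "e \<in> E"
  shows "finite (S e)" "S e \<subseteq> {lo e..hi e}" "lo e \<in> S e" "hi e \<in> S e" "Max (S e) = hi e" "Min (S e) = lo e"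
proof -
  show *: "finite (S e)" "S e \<subseteq> {lo e..hi e}" "lo e \<in> S e" "hi e \<in> S e"
    using T[OF assms] pos segment_bounds[OF ES(3)[OF assms]] by (auto simp: S_def)
  show "Max (S e) = hi e" by (rule Max_eqI) (use * in auto)
  show "Min (S e) = lo e" by (rule Min_eqI) (use * in auto)
qed

lemma gap_S_part:
  assumes e: "e \<in> E" and st: "(s, t) \<in> gaps (S e)"
  shows "segment (part e s t)" "lo (part e s t) = s" "hi (part e s t) = t"
    "\<And>u. u \<in> {s..t} \<Longrightarrow> pt (part e s t) u = pt e u" "part e s t \<subseteq> e" "part e s t \<in> E'"
proof -
  have "lo e \<le> s" "s < t" "t \<le> hi e" using gapsD(1-3)[OF st] S_basic(2)[OF e] by auto
  from partI[OF ES(3)[OF e] this]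
  show "segment (part e s t)" "lo (part e s t) = s" "hi (part e s t) = t"
    "\<And>u. u \<in> {s..t} \<Longrightarrow> pt (part e s t) u = pt e u" "part e s t \<subseteq> e" by auto
  show "part e s t \<in> E'" using e st by (auto simp: E'_def)
qed

lemma gap_T_S: "e \<in> E \<Longrightarrow> (s, t) \<in> gaps (T e) \<Longrightarrow> (s, t) \<in> gaps (S e)"
  using T[of e] gapsD[of s t "T e"] pos by (intro gapsI) (force simp: S_def)+

lemma gap_S_cases:
  assumes e: "e \<in> E" and st: "(s, t) \<in> gaps (S e)"
  shows "s = lo e \<and> t = lo e + \<tau> \<or> s = hi e - \<tau> \<and> t = hi e \<or> (s, t) \<in> gaps (T e)"
proof -
  note g = gapsD[OF st]
  note t = T[OF e] \<tau>(3)[OF e] pos(1)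
  have mem: "s \<in> T e \<or> s = lo e \<or> s = hi e" "t \<in> T e \<or> t = lo e \<or> t = hi e" using g(1,2) by (auto simp: S_def)
  have a: "lo e + \<tau> \<le> s \<or> t \<le> lo e + \<tau>" "hi e - \<tau> \<le> s \<or> t \<le> hi e - \<tau>"
    using g(4)[of "lo e + \<tau>"] g(4)[of "hi e - \<tau>"] t by (auto simp: S_def)
  consider "s = lo e" | "t = hi e" | "s \<noteq> lo e" "t \<noteq> hi e" by blast
  then show ?thesis
  proof cases
    case 1
    then have "t = lo e + \<tau>" using mem(2) a t g(3) by force
    then show ?thesis using 1 by simp
  next
    case 2
    then have "s = hi e - \<tau>" using mem(1) a t g(3) by force
    then show ?thesis using 2 by simp
  next
    case 3
    have "lo e \<le> t" "s \<le> hi e" using g(1,2) S_basic(2)[OF e] by auto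
    then have "s \<in> T e" "t \<in> T e" using mem 3 g(3) S_basic(2)[OF e] g(1,2) by fastforce+
    moreover have False if "v \<in> T e" "s < v" "v < t" for v
      using g(4)[of v] that by (auto simp: S_def)
    ultimately have "(s, t) \<in> gaps (T e)" using g(3) by (intro gapsI) blast+
    then show ?thesis by blast
  qed
qed

lemma E'_cases:
  assumes "e' \<in> E'"
  obtains e where "e \<in> E" "(lo e', hi e') \<in> gaps (S e)" "e' = part e (lo e') (hi e')" "segment e'" "e' \<subseteq> e"
    "\<And>u. u \<in> {lo e'..hi e'} \<Longrightarrow> pt e' u = pt e u"
proof -
  obtain e s t where e: "e \<in> E" "(s, t) \<in> gaps (S e)" "e' = part e s t" using assms by (auto simp: E'_def)
  note p = gap_S_part[OF e(1,2), folded e(3)]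
  show thesis by (rule that[of e]) (use e p in auto)
qed

lemma E'_segment: "e' \<in> E' \<Longrightarrow> segment e'"
  by (rule E'_cases)

lemma E'_same_parent:
  assumes "e' \<in> E'" "f \<in> E'" "e \<in> E" "e' \<subseteq> e" "f \<subseteq> e" "lo e' < hi f" "lo f < hi e'"
  shows "e' = f"
proof -
  obtain e1 where 1: "e1 \<in> E" "(lo e', hi e') \<in> gaps (S e1)" "e' = part e1 (lo e') (hi e')" "segment e'" "e' \<subseteq> e1"
    using E'_cases[OF assms(1)] by metis
  obtain e2 where 2: "e2 \<in> E" "(lo f, hi f) \<in> gaps (S e2)" "f = part e2 (lo f) (hi f)" "segment f" "f \<subseteq> e2"
    using E'_cases[OF assms(2)] by metis
  have "e1 = e" "e2 = e" using parent_unique[OF E] 1 2 assms by blast+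
  then show ?thesis using gaps_eqI[of "lo e'" "hi e'" "S e" "lo f" "hi f"] 1 2 assms(6,7) by metis
qed

lemma finite_E': "finite E'"
proof -
  have "E' = (\<Union>e\<in>E. (\<lambda>(s, t). part e s t) ` gaps (S e))" by (auto simp: E'_def)
  then show ?thesis using ES(1) S_basic(1) finite_gaps by simp
qed

text \<open>The last conclusion selects, for a point of \<open>S e\<close>, a gap that begins or
  ends there; this is what keeps the old vertices among the new ones.\<close>

lemma E'_at:
  assumes e: "e \<in> E" and u: "u \<in> {lo e..hi e}"
  obtains e' where "e' \<in> E'" "e' \<subseteq> e" "u \<in> {lo e'..hi e'}" "u \<in> S e \<Longrightarrow> u = lo e' \<or> u = hi e'"
proof -
  note b = S_basic[OF e] segment_bounds[OF ES(3)[OF e]]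
  have "\<exists>s t. (s, t) \<in> gaps (S e) \<and> u \<in> {s..t} \<and> (u \<in> S e \<longrightarrow> u = s \<or> u = t)"
  proof (cases "u \<in> S e")
    case False
    then have "lo e < u" "u < hi e" using u b by (auto simp: order_le_less)
    from gap_around[OF b(1,3,4) this False] show ?thesis using False by (metis atLeastAtMost_iff less_imp_le)
  next
    case True
    show ?thesis
    proof (cases "u = hi e")
      case hi: True
      let ?s = "Max (S e - {hi e})"
      have fin: "finite (S e - {hi e})" "lo e \<in> S e - {hi e}" using b by auto
      then have "?s \<in> S e - {hi e}" by (intro Max_in) auto
      moreover have "v \<le> ?s" if "v \<in> S e - {hi e}" for v using fin(1) that by (rule Max_ge)
      ultimately have "(?s, hi e) \<in> gaps (S e)" using b(2,4) by (intro gapsI) (force simp: not_less[symmetric])+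
      then show ?thesis using hi gapsD(3) by (intro exI[of _ ?s] exI[of _ "hi e"]) (auto intro: less_imp_le)
    next
      case False
      let ?t = "Min {v \<in> S e. u < v}"
      have fin: "finite {v \<in> S e. u < v}" "hi e \<in> {v \<in> S e. u < v}" using b u False by auto
      then have "?t \<in> {v \<in> S e. u < v}" by (intro Min_in) auto
      moreover have "?t \<le> v" if "v \<in> {v \<in> S e. u < v}" for v using fin(1) that by (rule Min_le)
      ultimately have "(u, ?t) \<in> gaps (S e)" using True by (intro gapsI) (force simp: not_less[symmetric])+
      then show ?thesis using gapsD(3) by (intro exI[of _ u] exI[of _ ?t]) (auto intro: less_imp_le)
    qed
  qed
  then obtain s t where st: "(s, t) \<in> gaps (S e)" "u \<in> {s..t}" "u \<in> S e \<longrightarrow> u = s \<or> u = t" by blast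
  show thesis by (rule that[of "part e s t"]) (use gap_S_part[OF e st(1)] st in auto)
qed

lemma Union_E': "\<Union>E' = \<Union>E"
proof
  show "\<Union>E' \<subseteq> \<Union>E" by (blast elim: E'_cases)
  show "\<Union>E \<subseteq> \<Union>E'"
  proof
    fix z assume "z \<in> \<Union>E"
    then obtain e where e: "e \<in> E" "z \<in> e" by blast
    note z = segment_mem[OF ES(3)[OF e(1)] e(2)]
    obtain e' where e': "e' \<in> E'" "e' \<subseteq> e" "height z \<in> {lo e'..hi e'}" using E'_at[OF e(1) z(1)] by metis
    have "z = pt e' (height z)" using pt_subset(1)[OF ES(3)[OF e(1)] E'_segment[OF e'(1)] e'(2,3)] z by simp
    then show "z \<in> \<Union>E'" using pt_in[OF E'_segment[OF e'(1)] e'(3)] e'(1) by auto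
  qed
qed

lemma edge_system_E': "edge_system E'"
proof (rule edge_systemI)
  show "E' \<noteq> {}" using Union_E' ES(2,3) ends_in by fastforce
  fix e' f z assume ef: "e' \<in> E'" "f \<in> E'" "e' \<noteq> f" and z: "z \<in> e'" "z \<in> f"
  obtain e where e: "e \<in> E" "e' \<subseteq> e" using E'_cases[OF ef(1)] by metis
  obtain e2 where e2: "e2 \<in> E" "f \<subseteq> e2" using E'_cases[OF ef(2)] by metis
  note s = E'_segment[OF ef(1)] E'_segment[OF ef(2)]
  note h = segment_mem(1)[OF s(1) z(1)] segment_mem(1)[OF s(2) z(2)]
  show "height z = lo e' \<or> height z = hi e'"
  proof (cases "e = e2")
    case True
    then show ?thesis using E'_same_parent[OF ef(1,2) e(1,2)] e2 ef(3) h by force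
  next
    case False
    then have "height z = lo e \<or> height z = hi e" using ES(4)[OF e(1) e2(1)] z e e2 by blast
    moreover have "lo e' \<in> {lo e..hi e}" "hi e' \<in> {lo e..hi e}"
      using pt_subset(2)[OF ES(3)[OF e(1)] s(1) e(2)] segment_bounds[OF s(1)] by auto
    ultimately show ?thesis using h(1) by auto
  qed
qed (use finite_E' E'_segment in auto)

lemma vertices_E': "source ` E \<union> sink ` E \<subseteq> source ` E' \<union> sink ` E'"
proof -
  have "pt e u \<in> source ` E' \<union> sink ` E'" if e: "e \<in> E" and u: "u = lo e \<or> u = hi e" for e u
  proof -
    have "u \<in> {lo e..hi e}" "u \<in> S e" using u S_basic[OF e] by auto
    then obtain e' where e': "e' \<in> E'" "e' \<subseteq> e" "u \<in> {lo e'..hi e'}" "u = lo e' \<or> u = hi e'"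
      using E'_at[OF e] by metis
    then have "pt e u = source e' \<or> pt e u = sink e'"
      using pt_subset(1)[OF ES(3)[OF e] E'_segment[OF e'(1)] e'(2,3)] by auto
    then show ?thesis using e'(1) by blast
  qed
  then show ?thesis by blast
qed

section \<open>Detours of the subdivided edges\<close>

lemma bubble_op: "circle e' \<Longrightarrow> bubble e' (op e')"
  unfolding op_def by (simp, rule someI_ex, simp add: circle_def)

lemma op_cases: "op e' = e' \<or> circle e' \<and> bubble e' (op e')"
  using bubble_op[of e'] by (auto simp: op_def)

lemma circle_op_neq:
  assumes "circle e'" "segment e'"
  shows "op e' \<noteq> e'"
proof -
  obtain u where "u \<in> {lo e'<..<hi e'}" using dense[OF segment_bounds(2)[OF assms(2)]] by auto
  then have "pt (op e') u \<noteq> pt e' u" using bubble_op[OF assms(1)] by (simp add: bubble_def)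
  then show ?thesis by auto
qed

lemma circle_parent:
  assumes "circle e'" "e' \<in> E'" "e \<in> E" "e' \<subseteq> e"
  shows "lo e + \<tau> \<le> lo e'" "hi e' \<le> hi e - \<tau>" "(lo e', hi e') \<in> gaps (T e)" "hi e' - lo e' \<le> m"
proof -
  obtain e2 where "e2 \<in> E" "e' \<subseteq> e2" "lo e2 + \<tau> \<le> lo e'" "hi e' \<le> hi e2 - \<tau>"
    using assms(1) by (auto simp: circle_def)
  then show *: "lo e + \<tau> \<le> lo e'" "hi e' \<le> hi e - \<tau>"
    using parent_unique[OF E _ assms(3) E'_segment[OF assms(2)] _ assms(4)] by blast+
  obtain e3 where "e3 \<in> E" "(lo e', hi e') \<in> gaps (S e3)" "e' \<subseteq> e3" using E'_cases[OF assms(2)] by metis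
  then have "(lo e', hi e') \<in> gaps (S e)"
    using parent_unique[OF E _ assms(3) E'_segment[OF assms(2)] _ assms(4)] by blast
  then show "(lo e', hi e') \<in> gaps (T e)" using gap_S_cases[OF assms(3)] * pos(1) by force
  then show "hi e' - lo e' \<le> m" using mesh[OF assms(3)] by blast
qed

lemma op_segment: "e' \<in> E' \<Longrightarrow> segment (op e') \<and> lo (op e') = lo e' \<and> hi (op e') = hi e' \<and>
    source (op e') = source e' \<and> sink (op e') = sink e'"
  using op_cases[of e'] E'_segment[of e'] by (auto simp: bubble_def)

text \<open>Both points are within \<open>m\<close> of the common source.\<close>

lemma op_near:
  assumes e': "e' \<in> E'" and u: "u \<in> {lo e'..hi e'}" and len: "hi e' - lo e' \<le> m"
  shows "d (pt e' u) (pt (op e') u) \<le> 2 * m"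
proof -
  have s: "segment e'" "segment (op e')" and eq: "lo (op e') = lo e'" "hi (op e') = hi e'" "source (op e') = source e'"
    using op_segment[OF e'] E'_segment[OF e'] by auto
  have l: "lo e' \<in> {lo e'..hi e'}" using u by auto
  have "d (pt e' u) (source e') \<le> m" "d (source e') (pt (op e') u) \<le> m"
    using pt_dist[OF s(1) u l] pt_dist[OF s(2), of "lo e'" u] u eq len by auto
  then show ?thesis
    using triangle[of "pt e' u" "source e'" "pt (op e') u"] pt_mem[OF s(1) u] pt_mem[OF s(1) l]
      pt_mem[OF s(2), of u] u eq by auto
qed

text \<open>Points are compared at the height \<open>u\<close> of \<open>z\<close>. If
  \<open>u\<close> is interior to \<open>e'\<close>, then \<open>f\<close> belongs to a different
  old edge, since two subedges of one old edge do not overlap. The point \<open>z\<close> is within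
  \<open>2 * m\<close> of the point of \<open>e\<close> at height \<open>u\<close>, because it lies
  on the detour, and within \<open>2 * m\<close> of the point \<open>w\<close> of \<open>f\<close>
  at height \<open>u\<close>. So \<open>w\<close> is within \<open>4 * m\<close> of the middle part
  of \<open>e\<close>, against the separation \<eta>.\<close>

lemma op_avoids:
  assumes e': "e' \<in> E'" and f: "f \<in> E'" and z: "z \<in> op e'" and ne: "op e' \<noteq> e'"
    and zf: "z \<in> f \<or> z \<in> op f \<and> f \<noteq> e'"
  shows "height z = lo e' \<or> height z = hi e'"
proof (rule ccontr)
  assume not_end: "\<not> ?thesis"
  define u where "u = height z"
  have c: "circle e'" and b: "bubble e' (op e')" using op_cases[of e'] ne by auto
  note se = E'_segment[OF e'] and sf = E'_segment[OF f]
  have so: "segment (op e')" "lo (op e') = lo e'" "hi (op e') = hi e'" using op_segment[OF e'] by auto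
  have sof: "segment (op f)" "lo (op f) = lo f" "hi (op f) = hi f" using op_segment[OF f] by auto
  have u: "lo e' < u" "u < hi e'" "u \<in> {lo e'..hi e'}" "pt (op e') u = z"
    using segment_mem[OF so(1) z] so not_end by (auto simp: u_def)
  have uf: "u \<in> {lo f..hi f}"
    using zf segment_mem(1)[OF sf, of z] segment_mem(1)[OF sof(1), of z] sof(2,3) by (auto simp: u_def)
  obtain e where e: "e \<in> E" "e' \<subseteq> e" using E'_cases[OF e'] by metis
  obtain e2 where e2: "e2 \<in> E" "f \<subseteq> e2" using E'_cases[OF f] by metis
  have pe: "pt e' u = pt e u" "u \<in> {lo e..hi e}" using pt_subset[OF ES(3)[OF e(1)] se e(2) u(3)] by auto
  note cp = circle_parent[OF c e' e]
  have ne': "z \<noteq> pt e' u" using b u by (auto simp: bubble_def)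
  have "e' \<noteq> f"
  proof
    assume "e' = f"
    then have "z = pt e' u" using zf segment_mem(2)[OF se, of z] by (auto simp: u_def)
    then show False using ne' by simp
  qed
  then have "e \<noteq> e2" using E'_same_parent[OF e' f e(1,2)] e2 u uf by force
  have z_near: "d (pt e u) z \<le> 2 * m" using op_near[OF e' u(3) cp(4)] u(4) pe(1) by simp
  define w where "w = pt f u"
  have w: "w \<in> f" "height w = u" using pt_in[OF sf uf] height_pt[OF sf uf] by (auto simp: w_def)
  \<comment> \<open>Common points of \<open>e\<close> and \<open>e2\<close> have the height of an
    end of \<open>e\<close>, but \<open>u\<close> lies in the middle part.\<close>
  have "w \<notin> e"
    using ES(4)[OF e(1) e2(1) \<open>e \<noteq> e2\<close>, of w] w e2(2) u cp(1,2) pos(1) by force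
  then have "\<eta> \<le> d (pt e u) w" using separated[OF e(1), of u w] u cp(1,2) w e2 by auto
  moreover have "d z w \<le> 2 * m"
  proof (cases "z \<in> f")
    case True
    then have "z = w" using segment_mem(2)[OF sf True] by (simp add: w_def u_def)
    moreover have "z \<in> M" using True segment_subset[OF sf] by blast
    ultimately show ?thesis using pos(3) by simp
  next
    case False
    then have zof: "z \<in> op f" "op f \<noteq> f" using zf by auto
    then have "circle f" using op_cases[of f] by auto
    moreover have "pt (op f) u = z" using segment_mem(2)[OF sof(1) zof(1)] by (simp add: u_def)
    ultimately show ?thesis
      using op_near[OF f uf] circle_parent(4)[OF _ f e2] commute by (simp add: w_def)
  qed
  moreover have "d (pt e u) w \<le> d (pt e u) z + d z w"
    using triangle pt_mem[OF ES(3)[OF e(1)] pe(2)] segment_subset[OF so(1)] segment_subset[OF sf] z w by blast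
  ultimately show False using z_near m(3) by linarith
qed

lemma E'_length:
  assumes "e' \<in> E'" "e \<in> E"
  shows "hi e' - lo e' \<le> \<delta> * (hi e - lo e)"
proof -
  obtain e1 where e1: "e1 \<in> E" "(lo e', hi e') \<in> gaps (S e1)" using E'_cases[OF assms(1)] by metis
  have "hi e' - lo e' = \<tau> \<or> hi e' - lo e' \<le> m"
    using gap_S_cases[OF e1] mesh[OF e1(1)] by auto
  then show ?thesis using \<tau>(1)[OF assms(2)] m(1)[OF assms(2)] by auto
qed

lemma E'_nonterminal:
  assumes "e \<in> E" "e' \<in> E'" "e' \<subseteq> e" "lo e' \<noteq> lo e" "hi e' \<noteq> hi e"
  shows "hi e' - lo e' \<le> \<delta> * \<eta>" "\<And>z w. z \<in> e' \<Longrightarrow> w \<in> \<Union>E - e \<Longrightarrow> \<eta> \<le> d z w"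
proof -
  obtain e1 where "e1 \<in> E" "(lo e', hi e') \<in> gaps (S e1)" "e' \<subseteq> e1" using E'_cases[OF assms(2)] by metis
  then have "(lo e', hi e') \<in> gaps (S e)"
    using parent_unique[OF E _ assms(1) E'_segment[OF assms(2)] _ assms(3)] by blast
  then have gap: "(lo e', hi e') \<in> gaps (T e)" using gap_S_cases[OF assms(1)] assms(4,5) by blast
  then show "hi e' - lo e' \<le> \<delta> * \<eta>" using mesh[OF assms(1)] m(2) by force
  fix z w assume z: "z \<in> e'" and w: "w \<in> \<Union>E - e"
  have "height z \<in> {lo e + \<tau>..hi e - \<tau>}"
    using segment_mem(1)[OF E'_segment[OF assms(2)] z] gapsD(1,2)[OF gap] T[OF assms(1)] by auto
  moreover have "pt e (height z) = z" using segment_mem(2)[OF ES(3)[OF assms(1)]] z assms(3) by blast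
  ultimately show "\<eta> \<le> d z w" using separated[OF assms(1) _ w, of "height z"] by simp
qed

lemma E'_total:
  assumes e: "e \<in> E"
  shows "(\<Sum>e' | e' \<in> E' \<and> e' \<subseteq> e. hi e' - lo e') = hi e - lo e"
proof -
  have img: "{e' \<in> E'. e' \<subseteq> e} = (\<lambda>(s, t). part e s t) ` gaps (S e)"
  proof (intro set_eqI iffI)
    fix e' assume "e' \<in> {e' \<in> E'. e' \<subseteq> e}"
    then have e': "e' \<in> E'" "e' \<subseteq> e" by auto
    obtain e1 where 1: "e1 \<in> E" "(lo e', hi e') \<in> gaps (S e1)" "e' = part e1 (lo e') (hi e')" "e' \<subseteq> e1"
      using E'_cases[OF e'(1)] by metis
    then have "e1 = e" using parent_unique[OF E _ e E'_segment[OF e'(1)] _ e'(2)] by blast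
    then show "e' \<in> (\<lambda>(s, t). part e s t) ` gaps (S e)" using 1 by force
  next
    fix e' assume "e' \<in> (\<lambda>(s, t). part e s t) ` gaps (S e)"
    then obtain s t where "(s, t) \<in> gaps (S e)" "e' = part e s t" by auto
    then show "e' \<in> {e' \<in> E'. e' \<subseteq> e}" using gap_S_part(5,6)[OF e] by blast
  qed
  have "inj_on (\<lambda>(s, t). part e s t) (gaps (S e))"
    by (rule inj_onI) (use gap_S_part(2,3)[OF e] in \<open>auto, metis+\<close>)
  then have "(\<Sum>e' | e' \<in> E' \<and> e' \<subseteq> e. hi e' - lo e') =
      (\<Sum>st\<in>gaps (S e). hi (case st of (s, t) \<Rightarrow> part e s t) - lo (case st of (s, t) \<Rightarrow> part e s t))"
    unfolding img by (simp add: sum.reindex)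
  also have "\<dots> = (\<Sum>(s, t)\<in>gaps (S e). t - s)"
    by (rule sum.cong) (use gap_S_part(2,3)[OF e] in auto)
  also have "\<dots> = hi e - lo e" using sum_gaps[of "S e"] S_basic[OF e] by fastforce
  finally show ?thesis .
qed

text \<open>Every gap of \<open>T'\<close> at which \<open>\<gamma>\<close> has a detour lies in an edge \<open>e\<close> traversed by \<open>\<gamma>\<close>. Up to the two
  terminal pieces of \<open>e\<close>, the gaps in \<open>e\<close> compete with \<open>T e\<close>.\<close>

lemma circle_length:
  assumes g: "\<gamma> \<in> F" "\<gamma> ` {0..1} \<subseteq> \<Union>E"
  shows "\<alpha> / 4 \<le> (\<Sum>e' | e' \<in> E' \<and> e' \<subseteq> \<gamma> ` {0..1} \<and> op e' \<noteq> e'. hi e' - lo e')"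
proof -
  define P where "P = {e \<in> E. \<forall>t\<in>{lo e..hi e}. \<gamma> t = pt e t}"
  have P: "e \<in> E" "\<And>t. t \<in> {lo e..hi e} \<Longrightarrow> \<gamma> t = pt e t" if "e \<in> P" for e using that by (auto simp: P_def)
  have finP: "finite P" using ES(1) by (simp add: P_def)
  \<comment> \<open>The end heights in \<open>S e\<close> prevent a gap of \<open>T'\<close> from
    crossing an end of an edge; the grids \<open>G e\<close> make the restriction of
    \<open>T'\<close> to an edge a competitor of \<open>T e\<close>.\<close>
  define T\<^sub>0 where "T\<^sub>0 = (\<Union>e\<in>E. S e \<union> G e)"
  have bd: "0 \<le> lo e" "lo e < hi e" "hi e \<le> 1" if "e \<in> E" for e using segment_bounds ES(3)[OF that] by auto
  have G': "G e \<subseteq> {lo e..hi e}" if "e \<in> E" for e using G[OF that] pos(1) by fastforce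
  have "finite T\<^sub>0" using ES(1) S_basic(1) G by (auto simp: T\<^sub>0_def)
  moreover have "T\<^sub>0 \<subseteq> {0..1}"
  proof -
    have "S e \<union> G e \<subseteq> {0..1}" if "e \<in> E" for e
      using S_basic(2)[OF that] G'[OF that] bd[OF that] by fastforce
    then show ?thesis by (auto simp: T\<^sub>0_def)
  qed
  ultimately obtain T' where T': "finite T'" "T\<^sub>0 \<subseteq> T'" "T' \<subseteq> {0..1}" "\<alpha> \<le> good_length d F \<alpha> \<gamma> T'"
    using thick g(1) unfolding uniformly_thick_def by meson
  have ST': "S e \<subseteq> T'" "G e \<subseteq> T'" if "e \<in> E" for e using T'(2) that by (auto simp: T\<^sub>0_def)
  define H where "H = good_gaps d F \<alpha> \<gamma> T'"
  define He where "He e = {(s, t) \<in> H. lo e \<le> s \<and> t \<le> hi e}" for e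
  have finH: "finite H" using finite_good_gaps[OF T'(1)] by (simp add: H_def)
  \<comment> \<open>The midpoint of the gap lies on some edge \<open>e\<close>. Neither end height
    of \<open>e\<close> is inside the gap, so the midpoint is interior to \<open>e\<close>, and a
    curve in the graph through an interior point traverses the whole edge.\<close>
  have cover: "\<exists>e\<in>P. st \<in> He e" if "st \<in> H" for st
  proof -
    obtain s t where st: "st = (s, t)" "(s, t) \<in> H" using \<open>st \<in> H\<close> by (cases st) auto
    note gp = gapsD[OF good_gapsD(1)[OF st(2)[unfolded H_def]]]
    define u where "u = (s + t) / 2"
    have u: "s < u" "u < t" using gp(3) by (auto simp: u_def)
    have u01: "u \<in> {0..1}" using gp(1,2) T'(3) u by fastforce
    then obtain e where e: "e \<in> E" "\<gamma> u \<in> e" using g(2) by blast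
    have ue: "u \<in> {lo e..hi e}" using segment_mem(1)[OF ES(3)[OF e(1)] e(2)] height_curve[OF g(1) u01] by simp
    have "lo e \<le> s" "t \<le> hi e"
      using gp(4)[of "lo e"] gp(4)[of "hi e"] ST'(1)[OF e(1)] S_basic(3,4)[OF e(1)] ue u by auto
    then have "e \<in> P" "st \<in> He e"
      using curve_contains_edge[OF E g e(1) _ _ e(2)] u e(1) st by (auto simp: P_def He_def)
    then show ?thesis by blast
  qed
  define L where "L e = good_length d F \<alpha> (pt e) (T e)" for e
  \<comment> \<open>The gaps in the middle part are good for \<open>pt e\<close> because
    \<open>\<gamma>\<close> coincides with it, so near-optimality applies; the gaps in each terminal
    piece have total length at most \<tau>.\<close>
  have local: "(\<Sum>(s, t)\<in>He e. t - s) \<le> 2 * L e + 2 * \<tau>" if e: "e \<in> P" for e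
  proof -
    let ?T = "T' \<inter> {lo e + \<tau>..hi e - \<tau>}"
    let ?A = "good_gaps d F \<alpha> (pt e) ?T" and ?B = "{(s, t) \<in> gaps T'. lo e \<le> s \<and> t \<le> lo e + \<tau>}"
      and ?C = "{(s, t) \<in> gaps T'. hi e - \<tau> \<le> s \<and> t \<le> hi e}"
    note eE = P(1)[OF e]
    have "He e \<subseteq> ?A \<union> (?B \<union> ?C)"
    proof
      fix st assume "st \<in> He e"
      then obtain s t where st: "st = (s, t)" "(s, t) \<in> H" "lo e \<le> s" "t \<le> hi e" by (auto simp: He_def)
      note gp = good_gapsD[OF st(2)[unfolded H_def]]
      note gp' = gapsD[OF gp(1)]
      have "lo e + \<tau> \<in> T'" "hi e - \<tau> \<in> T'" using T[OF eE] ST'(1)[OF eE] by (auto simp: S_def)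
      then consider "t \<le> lo e + \<tau>" | "hi e - \<tau> \<le> s" | "lo e + \<tau> \<le> s" "t \<le> hi e - \<tau>"
        using gp'(4) by blast
      then show "st \<in> ?A \<union> (?B \<union> ?C)"
      proof cases
        case 3
        then have "(s, t) \<in> gaps ?T" using gp' by (intro gapsI) (auto dest: leD)
        moreover have "good_gap d F \<alpha> (pt e) s t"
        proof -
          have "\<gamma> u = pt e u" if "u \<in> {s..t}" for u using P(2)[OF e, of u] that st by auto
          then show ?thesis using gp(2,3) unfolding good_gap_def by auto
        qed
        ultimately show ?thesis using st(1) by (simp add: good_gaps_def)
      qed (use st gp in auto)
    qed
    moreover have finAll: "finite ?A" "finite (?B \<union> ?C)" "finite ?B" "finite ?C"
    proof -
      show "finite ?A" using finite_good_gaps[of ?T] T'(1) by simp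
      show BC: "finite ?B" "finite ?C" by (rule finite_subset[OF _ finite_gaps[OF T'(1)]], blast)+
      show "finite (?B \<union> ?C)" using BC by blast
    qed
    moreover have nn: "0 \<le> (case st of (s, t) \<Rightarrow> t - s)" if "st \<in> ?A \<union> (?B \<union> ?C)" for st :: "real \<times> real"
    proof -
      obtain s t where "st = (s, t)" by (cases st)
      then show ?thesis using that good_gapsD(3)[of s t] gapsD(3)[of s t] by force
    qed
    ultimately have "(\<Sum>(s, t)\<in>He e. t - s) \<le> (\<Sum>(s, t)\<in>?A \<union> (?B \<union> ?C). t - s)"
      by (intro sum_mono2) auto
    also have "\<dots> \<le> (\<Sum>(s, t)\<in>?A. t - s) + ((\<Sum>(s, t)\<in>?B. t - s) + (\<Sum>(s, t)\<in>?C. t - s))"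
    proof -
      have 1: "0 \<le> (\<Sum>(s, t)\<in>?A \<inter> (?B \<union> ?C). t - s)" "0 \<le> (\<Sum>(s, t)\<in>?B \<inter> ?C. t - s)"
        using nn by (intro sum_nonneg, blast)+
      then show ?thesis
        using sum_Un[OF finAll(1,2), of "\<lambda>(s, t). t - s"] sum_Un[OF finAll(3,4), of "\<lambda>(s, t). t - s"]
        by linarith
    qed
    also have "(\<Sum>(s, t)\<in>?A. t - s) \<le> 2 * L e"
      using half_opt[OF eE, of ?T] ST'(2)[OF eE] G[OF eE] T'(1) by (simp add: good_length_def L_def)
    also have "(\<Sum>(s, t)\<in>?B. t - s) \<le> \<tau>"
      using sum_gaps_within_le[OF finAll(3), of "lo e" "lo e + \<tau>" T'] pos(1) by simp
    also have "(\<Sum>(s, t)\<in>?C. t - s) \<le> \<tau>"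
      using sum_gaps_within_le[OF finAll(4), of "hi e - \<tau>" "hi e" T'] pos(1) by simp
    finally show ?thesis by simp
  qed
  have "\<alpha> \<le> (\<Sum>st\<in>H. snd st - fst st)" using T'(4) by (simp add: good_length_def H_def case_prod_unfold)
  \<comment> \<open>A gap counted for several edges only increases the right-hand side.\<close>
  also have "\<dots> \<le> (\<Sum>st\<in>H. \<Sum>e\<in>P. if st \<in> He e then snd st - fst st else 0)"
  proof (rule sum_mono)
    fix st assume st: "st \<in> H"
    obtain e where e: "e \<in> P" "st \<in> He e" using cover[OF st] by blast
    have pos': "0 \<le> snd st - fst st" using st by (cases st) (auto simp: H_def dest: good_gapsD(3))
    have "snd st - fst st = (\<Sum>e\<in>{e}. if st \<in> He e then snd st - fst st else 0)" using e by simp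
    also have "\<dots> \<le> (\<Sum>e\<in>P. if st \<in> He e then snd st - fst st else 0)"
      using e finP pos' by (intro sum_mono2) auto
    finally show "snd st - fst st \<le> (\<Sum>e\<in>P. if st \<in> He e then snd st - fst st else 0)" .
  qed
  also have "\<dots> = (\<Sum>e\<in>P. \<Sum>st\<in>H. if st \<in> He e then snd st - fst st else 0)" by (rule sum.swap)
  also have "\<dots> = (\<Sum>e\<in>P. \<Sum>(s, t)\<in>He e. t - s)"
  proof (rule sum.cong)
    fix e
    have "He e \<subseteq> H" by (auto simp: He_def)
    then have "H \<inter> He e = He e" by blast
    then show "(\<Sum>st\<in>H. if st \<in> He e then snd st - fst st else 0) = (\<Sum>(s, t)\<in>He e. t - s)"
      using finH by (simp add: sum.If_cases case_prod_unfold)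
  qed simp
  also have "\<dots> \<le> (\<Sum>e\<in>P. 2 * L e + \<alpha> / 2 * (hi e - lo e))"
  proof (rule sum_mono)
    fix e assume e: "e \<in> P"
    show "(\<Sum>(s, t)\<in>He e. t - s) \<le> 2 * L e + \<alpha> / 2 * (hi e - lo e)"
      using local[OF e] \<tau>(2)[OF P(1)[OF e]] by simp
  qed
  also have "\<dots> = 2 * (\<Sum>e\<in>P. L e) + \<alpha> / 2 * (\<Sum>e\<in>P. hi e - lo e)"
    by (simp only: sum.distrib sum_distrib_left)
  \<comment> \<open>The edges traversed by \<open>\<gamma>\<close> occupy disjoint parameter
    intervals in \<open>[0,1]\<close>.\<close>
  also have "\<alpha> / 2 * (\<Sum>e\<in>P. hi e - lo e) \<le> \<alpha> / 2 * 1"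
  proof (rule mult_left_mono)
    have "(\<Sum>e\<in>P. hi e - lo e) \<le> 1 - 0"
    proof (rule sum_disjoint_intervals_le[OF finP])
      fix e f assume ef: "e \<in> P" "f \<in> P" "e \<noteq> f"
      show "{lo e<..<hi e} \<inter> {lo f<..<hi f} = {}"
      proof (rule ccontr)
        assume "\<not> ?thesis"
        then obtain u where u: "u \<in> {lo e<..<hi e}" "u \<in> {lo f<..<hi f}" by blast
        then have u': "u \<in> {lo e..hi e}" "u \<in> {lo f..hi f}" by auto
        note s = ES(3)[OF P(1)[OF ef(1)]] ES(3)[OF P(1)[OF ef(2)]]
        have "pt e u = pt f u" using P(2)[OF ef(1) u'(1)] P(2)[OF ef(2) u'(2)] by simp
        then have "pt e u \<in> e" "pt e u \<in> f" using pt_in[OF s(1) u'(1)] pt_in[OF s(2) u'(2)] by auto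
        then show False
          using ES(4)[OF P(1)[OF ef(1)] P(1)[OF ef(2)] ef(3), of "pt e u"] height_pt[OF s(1) u'(1)] u by auto
      qed
    qed (use bd P(1) in \<open>auto simp: less_imp_le\<close>)
    then show "(\<Sum>e\<in>P. hi e - lo e) \<le> 1" by simp
  qed (use \<alpha>_pos in simp)
  finally have "\<alpha> / 4 \<le> (\<Sum>e\<in>P. L e)" by simp
  \<comment> \<open>The gaps counted in the sums \<open>L e\<close> correspond injectively to edges
    of \<open>E'\<close> that lie on \<open>\<gamma>\<close> and are circles.\<close>
  also have "(\<Sum>e\<in>P. L e) = (\<Sum>(e, st)\<in>Sigma P (\<lambda>e. good_gaps d F \<alpha> (pt e) (T e)). snd st - fst st)"
    unfolding L_def good_length_def
  proof (subst sum.Sigma[OF finP])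
    show "\<forall>e\<in>P. finite (good_gaps d F \<alpha> (pt e) (T e))"
      using finite_good_gaps T P(1) by blast
  qed (simp add: case_prod_unfold)
  also have "\<dots> = (\<Sum>x\<in>Sigma P (\<lambda>e. good_gaps d F \<alpha> (pt e) (T e)).
      (\<lambda>e'. hi e' - lo e') (part (fst x) (fst (snd x)) (snd (snd x))))"
  proof (rule sum.cong)
    fix x assume "x \<in> Sigma P (\<lambda>e. good_gaps d F \<alpha> (pt e) (T e))"
    then obtain e s t where x: "x = (e, s, t)" "e \<in> P" "(s, t) \<in> good_gaps d F \<alpha> (pt e) (T e)" by auto
    note gp = gap_T_S[OF P(1)[OF x(2)] good_gapsD(1)[OF x(3)]]
    show "(case x of (e, st) \<Rightarrow> snd st - fst st) =
        (\<lambda>e'. hi e' - lo e') (part (fst x) (fst (snd x)) (snd (snd x)))"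
      using gap_S_part(2,3)[OF P(1)[OF x(2)] gp] x(1) by simp
  qed simp
  also have "\<dots> = (\<Sum>e'\<in>(\<lambda>x. part (fst x) (fst (snd x)) (snd (snd x))) `
      Sigma P (\<lambda>e. good_gaps d F \<alpha> (pt e) (T e)). hi e' - lo e')"
  proof (subst sum.reindex)
    show "inj_on (\<lambda>x. part (fst x) (fst (snd x)) (snd (snd x))) (Sigma P (\<lambda>e. good_gaps d F \<alpha> (pt e) (T e)))"
    proof (rule inj_onI)
      fix x y assume xy: "x \<in> Sigma P (\<lambda>e. good_gaps d F \<alpha> (pt e) (T e))"
        "y \<in> Sigma P (\<lambda>e. good_gaps d F \<alpha> (pt e) (T e))"
        "part (fst x) (fst (snd x)) (snd (snd x)) = part (fst y) (fst (snd y)) (snd (snd y))"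
      then obtain e s t e2 s2 t2 where x: "x = (e, s, t)" "e \<in> P" "(s, t) \<in> good_gaps d F \<alpha> (pt e) (T e)"
        and y: "y = (e2, s2, t2)" "e2 \<in> P" "(s2, t2) \<in> good_gaps d F \<alpha> (pt e2) (T e2)" by auto
      note px = gap_S_part[OF P(1)[OF x(2)] gap_T_S[OF P(1)[OF x(2)] good_gapsD(1)[OF x(3)]]]
      note py = gap_S_part[OF P(1)[OF y(2)] gap_T_S[OF P(1)[OF y(2)] good_gapsD(1)[OF y(3)]]]
      have eq: "part e s t = part e2 s2 t2" using xy(3) x(1) y(1) by simp
      have "e = e2" using parent_unique[OF E P(1)[OF x(2)] P(1)[OF y(2)] px(1)] px(5) py(5) eq by simp
      moreover have "s = s2" "t = t2" using px(2,3) py(2,3) eq by auto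
      ultimately show "x = y" using x(1) y(1) by simp
    qed
  qed simp
  also have "\<dots> \<le> (\<Sum>e' | e' \<in> E' \<and> e' \<subseteq> \<gamma> ` {0..1} \<and> op e' \<noteq> e'. hi e' - lo e')"
  proof (rule sum_mono2)
    show "(\<lambda>x. part (fst x) (fst (snd x)) (snd (snd x))) ` Sigma P (\<lambda>e. good_gaps d F \<alpha> (pt e) (T e))
        \<subseteq> {e' \<in> E'. e' \<subseteq> \<gamma> ` {0..1} \<and> op e' \<noteq> e'}"
    proof (intro image_subsetI)
      fix x assume "x \<in> Sigma P (\<lambda>e. good_gaps d F \<alpha> (pt e) (T e))"
      then obtain e s t where x: "x = (e, s, t)" "e \<in> P" "(s, t) \<in> good_gaps d F \<alpha> (pt e) (T e)" by auto
      note eE = P(1)[OF x(2)]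
      note gT = good_gapsD[OF x(3)]
      note p = gap_S_part[OF eE gap_T_S[OF eE gT(1)]]
      have in01: "{lo e..hi e} \<subseteq> {0..1}" using bd[OF eE] by auto
      have "e \<subseteq> \<gamma> ` {0..1}"
      proof
        fix z assume z: "z \<in> e"
        note zm = segment_mem[OF ES(3)[OF eE] z]
        then show "z \<in> \<gamma> ` {0..1}" using P(2)[OF x(2) zm(1)] in01 by (intro image_eqI[of _ _ "height z"]) auto
      qed
      then have sub: "part e s t \<subseteq> \<gamma> ` {0..1}" using p(5) by blast
      have "good_gap d F \<alpha> (pt (part e s t)) s t"
        using gT(2,3) p(4) unfolding good_gap_def by auto
      then have "\<exists>f. bubble (part e s t) f" using good_gap_imp_bubble[OF p(1)] p(2,3) by simp
      moreover have "lo e + \<tau> \<le> s" "t \<le> hi e - \<tau>" using gapsD(1,2)[OF gT(1)] T[OF eE] by auto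
      ultimately have "circle (part e s t)" using p eE by (auto simp: circle_def)
      then show "part (fst x) (fst (snd x)) (snd (snd x)) \<in> {e' \<in> E'. e' \<subseteq> \<gamma> ` {0..1} \<and> op e' \<noteq> e'}"
        using circle_op_neq p(1,6) sub x(1) by simp
    qed
    show "0 \<le> hi e' - lo e'" if "e' \<in> {e' \<in> E'. e' \<subseteq> \<gamma> ` {0..1} \<and> op e' \<noteq> e'} -
        (\<lambda>x. part (fst x) (fst (snd x)) (snd (snd x))) ` Sigma P (\<lambda>e. good_gaps d F \<alpha> (pt e) (T e))" for e'
      using segment_bounds[OF E'_segment[of e']] that by auto
  qed (use finite_E' in simp)
  finally show ?thesis .
qed

lemma refinement_E': "refinement E \<delta> E' op"
proof -
  have terminal: "op e' = e'" if "e \<in> E" "e' \<in> E'" "e' \<subseteq> e" "lo e' = lo e \<or> hi e' = hi e" for e e'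
    using op_cases[of e'] circle_parent(1,2)[OF _ that(2,1,3)] that(4) pos(1) by force
  have par: "\<exists>e\<in>E. e' \<subseteq> e" if "e' \<in> E'" for e' using E'_cases[OF that] by metis
  show ?thesis
    unfolding refinement_def
  proof (intro conjI)
    show "\<forall>e'\<in>E'. op e' = e' \<or> bubble e' (op e')" using op_cases by blast
    show "\<forall>e'\<in>E'. \<forall>f\<in>E'. \<forall>z\<in>op e'. op e' \<noteq> e' \<and> (z \<in> f \<or> z \<in> op f \<and> f \<noteq> e') \<longrightarrow>
        height z = lo e' \<or> height z = hi e'"
      using op_avoids by metis
    show "\<exists>\<eta>>0. \<forall>e\<in>E. \<forall>e'\<in>E'. e' \<subseteq> e \<and> lo e' \<noteq> lo e \<and> hi e' \<noteq> hi e \<longrightarrow>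
        hi e' - lo e' \<le> \<delta> * \<eta> \<and> (\<forall>z\<in>e'. \<forall>w\<in>\<Union>E - e. \<eta> \<le> d z w)"
      using pos(2) E'_nonterminal by (intro exI[of _ \<eta>]) blast
    show "\<forall>\<gamma>\<in>F. \<gamma> ` {0..1} \<subseteq> \<Union>E \<longrightarrow>
        \<alpha> / 4 \<le> (\<Sum>e' | e' \<in> E' \<and> e' \<subseteq> \<gamma> ` {0..1} \<and> op e' \<noteq> e'. hi e' - lo e')"
      using circle_length by blast
    show "\<forall>e'\<in>E'. \<forall>e\<in>E. hi e' - lo e' \<le> \<delta> * (hi e - lo e)" using E'_length by blast
    show "\<forall>e\<in>E. (\<Sum>e' | e' \<in> E' \<and> e' \<subseteq> e. hi e' - lo e') = hi e - lo e" using E'_total by blast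
    show "\<forall>e\<in>E. \<forall>e'\<in>E'. e' \<subseteq> e \<and> (lo e' = lo e \<or> hi e' = hi e) \<longrightarrow> op e' = e'"
      using terminal by metis
    show "\<forall>e'\<in>E'. \<exists>e\<in>E. e' \<subseteq> e" using par by metis
  qed (rule edge_system_E' Union_E' vertices_E')+
qed

end

section \<open>Choice of the parameters of one stage\<close>

context thick_curves begin

lemma refinement_exists:
  assumes E: "edge_system E" and \<delta>: "\<delta> > 0"
  obtains E' op where "refinement E \<delta> E' op"
proof -
  note ES = edge_systemD[OF E]
  define \<Delta> where "\<Delta> = Min ((\<lambda>e. hi e - lo e) ` E)"
  have \<Delta>: "\<Delta> > 0" "\<And>e. e \<in> E \<Longrightarrow> \<Delta> \<le> hi e - lo e"
    unfolding \<Delta>_def using ES segment_bounds by (auto simp: Min_gr_iff)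
  \<comment> \<open>The choices depend on each other in this order: \<tau> comes from the shortest
    edge, the separation \<eta> from \<tau>, the mesh \<open>m\<close> from \<eta>, the grid from
    \<open>m\<close>, and the near-optimal set from the grid.\<close>
  define \<tau> where "\<tau> = min \<delta> (min (\<alpha> / 4) (1 / 4)) * \<Delta>"
  have \<tau>: "\<tau> > 0" "\<tau> \<le> \<delta> * \<Delta>" "4 * \<tau> \<le> \<alpha> * \<Delta>" "4 * \<tau> \<le> \<Delta>"
    using \<Delta>(1) \<delta> \<alpha>_pos by (auto simp: \<tau>_def min_def)
  obtain \<eta> where \<eta>: "\<eta> > 0"
    "\<And>e t w. e \<in> E \<Longrightarrow> t \<in> {lo e + \<tau>..hi e - \<tau>} \<Longrightarrow> w \<in> \<Union>E - e \<Longrightarrow> \<eta> \<le> d (pt e t) w"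
    using middle_separated[OF E \<tau>(1)] by metis
  \<comment> \<open>A fifth of \<eta> makes \<open>4 * m < \<eta>\<close> strict.\<close>
  define m where "m = min (\<delta> * \<Delta>) (min (\<delta> * \<eta>) (\<eta> / 5))"
  have m: "m > 0" "m \<le> \<delta> * \<Delta>" "m \<le> \<delta> * \<eta>" "m \<le> \<eta> / 5" unfolding m_def
    using \<Delta>(1) \<delta> \<eta>(1) by auto
  have ex: "\<exists>G T. finite G \<and> G \<subseteq> {lo e + \<tau>..hi e - \<tau>} \<and>
      (finite T \<and> T \<subseteq> {lo e + \<tau>..hi e - \<tau>} \<and> lo e + \<tau> \<in> T \<and> hi e - \<tau> \<in> T) \<and>
      (\<forall>s t. (s, t) \<in> gaps T \<longrightarrow> t - s \<le> m) \<and>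
      (\<forall>T'. finite T' \<longrightarrow> G \<subseteq> T' \<longrightarrow> T' \<subseteq> {lo e + \<tau>..hi e - \<tau>} \<longrightarrow>
        good_length d F \<alpha> (pt e) T' \<le> 2 * good_length d F \<alpha> (pt e) T)" if e: "e \<in> E" for e
  proof -
    let ?x = "lo e + \<tau>" and ?y = "hi e - \<tau>"
    have xy: "?x < ?y" using \<tau>(1,4) \<Delta>(2)[OF e] by linarith
    obtain G where G: "finite G" "G \<subseteq> {?x..?y}" "?x \<in> G" "?y \<in> G"
      "\<And>T s t. G \<subseteq> T \<Longrightarrow> T \<subseteq> {?x..?y} \<Longrightarrow> (s, t) \<in> gaps T \<Longrightarrow> t - s \<le> m"
      using fine_grid[OF xy m(1)] by blast
    let ?S = "good_length d F \<alpha> (pt e) ` {T. finite T \<and> G \<subseteq> T \<and> T \<subseteq> {?x..?y}}"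
    have ne: "?S \<noteq> {}" using G by blast
    have bdd: "bdd_above ?S"
    proof (rule bdd_aboveI[of _ "?y - ?x"])
      fix l assume "l \<in> ?S"
      then obtain T where "finite T" "T \<subseteq> {?x..?y}" "l = good_length d F \<alpha> (pt e) T" by blast
      then show "l \<le> ?y - ?x" using good_length_le[of T ?x ?y] xy by simp
    qed
    have nn: "0 \<le> l" if "l \<in> ?S" for l using that good_length_nonneg by auto
    obtain l where l: "l \<in> ?S" "\<And>l'. l' \<in> ?S \<Longrightarrow> l' \<le> 2 * l"
      by (rule half_optimal[OF ne bdd nn], assumption, rule that)
    then obtain T where T: "finite T" "G \<subseteq> T" "T \<subseteq> {?x..?y}" "l = good_length d F \<alpha> (pt e) T" by blast
    have "good_length d F \<alpha> (pt e) T' \<le> 2 * good_length d F \<alpha> (pt e) T"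
      if "finite T'" "G \<subseteq> T'" "T' \<subseteq> {?x..?y}" for T'
      unfolding T(4)[symmetric] by (rule l(2), rule imageI) (use that in simp)
    moreover have "t - s \<le> m" if "(s, t) \<in> gaps T" for s t by (rule G(5)[OF T(2,3) that])
    moreover have "?x \<in> T" "?y \<in> T" using G(3,4) T(2) by auto
    ultimately show ?thesis using G(1,2) T(1,3) by (intro exI[of _ G] exI[of _ T] conjI allI impI)
  qed
  obtain G T where GT: "\<And>e. e \<in> E \<Longrightarrow> finite (G e) \<and> G e \<subseteq> {lo e + \<tau>..hi e - \<tau>} \<and>
      (finite (T e) \<and> T e \<subseteq> {lo e + \<tau>..hi e - \<tau>} \<and> lo e + \<tau> \<in> T e \<and> hi e - \<tau> \<in> T e) \<and>
      (\<forall>s t. (s, t) \<in> gaps (T e) \<longrightarrow> t - s \<le> m) \<and>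
      (\<forall>T'. finite T' \<longrightarrow> G e \<subseteq> T' \<longrightarrow> T' \<subseteq> {lo e + \<tau>..hi e - \<tau>} \<longrightarrow>
        good_length d F \<alpha> (pt e) T' \<le> 2 * good_length d F \<alpha> (pt e) (T e))"
    using ex by metis
  have sub: "\<delta> * \<Delta> \<le> \<delta> * (hi e - lo e)" "\<alpha> * \<Delta> \<le> \<alpha> * (hi e - lo e)" if "e \<in> E" for e
    using \<Delta>(2)[OF that] \<delta> \<alpha>_pos by auto
  interpret subdivided M d F v0 v1 \<alpha> E \<delta> \<tau> \<eta> m G T
  proof unfold_locales
    show "4 * m < \<eta>" using m(4) \<eta>(1) by simp
    show "\<tau> \<le> \<delta> * (hi e - lo e)" "4 * \<tau> \<le> \<alpha> * (hi e - lo e)" "4 * \<tau> \<le> hi e - lo e" "m \<le> \<delta> * (hi e - lo e)"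
      if "e \<in> E" for e using sub[OF that] \<tau> m(2) \<Delta>(2)[OF that] by linarith+
  qed (use E \<tau>(1) \<eta> m(1,3) GT in blast)+
  show thesis using that refinement_E' by blast
qed

section \<open>The next graph and its retraction\<close>

lemma refinementD:
  assumes "refinement E \<delta> E' op"
  shows "edge_system E'" "\<Union>E' = \<Union>E" "\<And>e'. e' \<in> E' \<Longrightarrow> \<exists>e\<in>E. e' \<subseteq> e"
    "source ` E \<union> sink ` E \<subseteq> source ` E' \<union> sink ` E'"
    "\<And>e'. e' \<in> E' \<Longrightarrow> op e' \<noteq> e' \<Longrightarrow> bubble e' (op e')"
    "\<And>e' f z. e' \<in> E' \<Longrightarrow> f \<in> E' \<Longrightarrow> op e' \<noteq> e' \<Longrightarrow> z \<in> op e' \<Longrightarrow> z \<in> f \<or> z \<in> op f \<and> f \<noteq> e' \<Longrightarrow>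
      height z = lo e' \<or> height z = hi e'"
    "\<And>e e'. e \<in> E \<Longrightarrow> e' \<in> E' \<Longrightarrow> e' \<subseteq> e \<Longrightarrow> lo e' = lo e \<or> hi e' = hi e \<Longrightarrow> op e' = e'"
    "\<And>\<gamma>. \<gamma> \<in> F \<Longrightarrow> \<gamma> ` {0..1} \<subseteq> \<Union>E \<Longrightarrow>
      \<alpha> / 4 \<le> (\<Sum>e' | e' \<in> E' \<and> e' \<subseteq> \<gamma> ` {0..1} \<and> op e' \<noteq> e'. hi e' - lo e')"
    "\<And>e e'. e' \<in> E' \<Longrightarrow> e \<in> E \<Longrightarrow> hi e' - lo e' \<le> \<delta> * (hi e - lo e)"
    "\<exists>\<eta>>0. \<forall>e\<in>E. \<forall>e'\<in>E'. e' \<subseteq> e \<and> lo e' \<noteq> lo e \<and> hi e' \<noteq> hi e \<longrightarrow>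
      hi e' - lo e' \<le> \<delta> * \<eta> \<and> (\<forall>z\<in>e'. \<forall>w\<in>\<Union>E - e. \<eta> \<le> d z w)"
    "\<And>e. e \<in> E \<Longrightarrow> (\<Sum>e' | e' \<in> E' \<and> e' \<subseteq> e. hi e' - lo e') = hi e - lo e"
proof -
  note * = assms[unfolded refinement_def]
  show "edge_system E'" by (rule *[THEN conjunct1])
  note * = *[THEN conjunct2]
  show "\<Union>E' = \<Union>E" by (rule *[THEN conjunct1])
  note * = *[THEN conjunct2]
  show "\<exists>e\<in>E. e' \<subseteq> e" if "e' \<in> E'" for e' by (rule bspec[OF *[THEN conjunct1] that])
  note * = *[THEN conjunct2]
  show "source ` E \<union> sink ` E \<subseteq> source ` E' \<union> sink ` E'" by (rule *[THEN conjunct1])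
  note * = *[THEN conjunct2]
  show "bubble e' (op e')" if "e' \<in> E'" "op e' \<noteq> e'" for e'
    using *[THEN conjunct1, rule_format, OF that(1)] that(2) by blast
  note * = *[THEN conjunct2]
  show "height z = lo e' \<or> height z = hi e'"
    if "e' \<in> E'" "f \<in> E'" "op e' \<noteq> e'" "z \<in> op e'" "z \<in> f \<or> z \<in> op f \<and> f \<noteq> e'" for e' f z
    by (rule *[THEN conjunct1, rule_format, OF that(1,2,4) conjI[OF that(3,5)]])
  note * = *[THEN conjunct2]
  show "op e' = e'" if "e \<in> E" "e' \<in> E'" "e' \<subseteq> e" "lo e' = lo e \<or> hi e' = hi e" for e e'
    by (rule *[THEN conjunct1, rule_format, OF that(1,2) conjI[OF that(3,4)]])
  note * = *[THEN conjunct2]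
  show "\<alpha> / 4 \<le> (\<Sum>e' | e' \<in> E' \<and> e' \<subseteq> \<gamma> ` {0..1} \<and> op e' \<noteq> e'. hi e' - lo e')"
    if "\<gamma> \<in> F" "\<gamma> ` {0..1} \<subseteq> \<Union>E" for \<gamma>
    by (rule *[THEN conjunct1, rule_format, OF that])
  note * = *[THEN conjunct2]
  show "hi e' - lo e' \<le> \<delta> * (hi e - lo e)" if "e' \<in> E'" "e \<in> E" for e e'
    by (rule *[THEN conjunct1, rule_format, OF that])
  note * = *[THEN conjunct2]
  show "\<exists>\<eta>>0. \<forall>e\<in>E. \<forall>e'\<in>E'. e' \<subseteq> e \<and> lo e' \<noteq> lo e \<and> hi e' \<noteq> hi e \<longrightarrow>
      hi e' - lo e' \<le> \<delta> * \<eta> \<and> (\<forall>z\<in>e'. \<forall>w\<in>\<Union>E - e. \<eta> \<le> d z w)" by (rule *[THEN conjunct1])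
  note * = *[THEN conjunct2]
  show "(\<Sum>e' | e' \<in> E' \<and> e' \<subseteq> e. hi e' - lo e') = hi e - lo e" if "e \<in> E" for e
    by (rule *[rule_format, OF that])
qed

text \<open>A point of a new arc outside the old graph lies on no other new arc, so the choice of
  \<open>e'\<close> is unambiguous; the projection keeps the height.\<close>

definition retract :: "'a set set \<Rightarrow> 'a set set \<Rightarrow> ('a set \<Rightarrow> 'a set) \<Rightarrow> 'a \<Rightarrow> 'a" where
  "retract E E' op z = (if z \<in> \<Union>E then z else pt (SOME e'. e' \<in> E' \<and> z \<in> op e') (height z))"

lemma segment_inner_point:
  assumes "segment e"
  obtains z where "z \<in> e" "height z \<noteq> lo e" "height z \<noteq> hi e"
proof -
  obtain u where u: "lo e < u" "u < hi e" using dense[OF segment_bounds(2)[OF assms]] by blast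
  then have "u \<in> {lo e..hi e}" by simp
  from pt_in[OF assms this] height_pt[OF assms this] that[of "pt e u"] u show thesis by simp
qed

context
  fixes E :: "'a set set" and \<delta> :: real and E' :: "'a set set" and op :: "'a set \<Rightarrow> 'a set"
  assumes E: "edge_system E" and R: "refinement E \<delta> E' op"
begin

lemmas RD = refinementD[OF R]
lemmas ES = edge_systemD[OF E]
lemmas ES' = edge_systemD[OF RD(1)]

lemma op_edge:
  assumes "e' \<in> E'"
  shows "segment (op e')" "lo (op e') = lo e'" "hi (op e') = hi e'" "source (op e') = source e'" "sink (op e') = sink e'"
  using ES'(3)[OF assms] RD(5)[OF assms] by (cases "op e' = e'"; simp add: bubble_def)+

text \<open>An interior point of a new arc lies on no edge of \<open>E'\<close>.\<close>

lemma op_new: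
  assumes "e' \<in> E'" "op e' \<in> E'"
  shows "op e' = e'"
proof (rule ccontr)
  assume ne: "op e' \<noteq> e'"
  obtain z where "z \<in> op e'" "height z \<noteq> lo (op e')" "height z \<noteq> hi (op e')"
    using segment_inner_point[OF op_edge(1)[OF assms(1)]] by metis
  then show False using RD(6)[OF assms ne, of z] op_edge(2,3)[OF assms(1)] by simp
qed

text \<open>An interior point of a new arc lies on no arc \<open>op f\<close> of a different edge
  \<open>f\<close>.\<close>

lemma op_inj:
  assumes "e' \<in> E'" "f \<in> E'" "op e' = op f" "op e' \<noteq> e'"
  shows "e' = f"
proof (rule ccontr)
  assume ne: "e' \<noteq> f"
  obtain z where "z \<in> op e'" "height z \<noteq> lo (op e')" "height z \<noteq> hi (op e')"
    using segment_inner_point[OF op_edge(1)[OF assms(1)]] by metis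
  then show False using RD(6)[OF assms(1,2,4), of z] assms(3) ne op_edge(2,3)[OF assms(1)] by simp
qed

lemma op_meets:
  assumes e': "e' \<in> E'" and f: "f \<in> E' \<union> op ` E'" and ne: "op e' \<noteq> e'" "f \<noteq> op e'" and z: "z \<in> op e'" "z \<in> f"
  shows "height z = lo e' \<or> height z = hi e'"
  using f
proof
  assume "f \<in> op ` E'"
  then obtain g where "g \<in> E'" "f = op g" by blast
  then show ?thesis using RD(6)[OF e' _ ne(1) z(1), of g] z(2) ne(2) by blast
qed (use RD(6)[OF e' _ ne(1) z(1)] z(2) in blast)

lemma edge_system_next: "edge_system (E' \<union> op ` E')"
proof (rule edge_systemI)
  fix e f z assume ef: "e \<in> E' \<union> op ` E'" "f \<in> E' \<union> op ` E'" "e \<noteq> f" and z: "z \<in> e" "z \<in> f"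
  consider "e \<in> E'" "f \<in> E'" | e' where "e' \<in> E'" "e = op e'" "op e' \<noteq> e'"
    | f' where "e \<in> E'" "f' \<in> E'" "f = op f'" "op f' \<noteq> f'"
    using ef(1,2) by (metis UnE imageE)
  then show "height z = lo e \<or> height z = hi e"
  proof cases
    case 1
    then show ?thesis using ES'(4)[OF 1 ef(3)] z by blast
  next
    case 2
    then show ?thesis using op_meets[OF 2(1) ef(2) 2(3) _ _ z(2)] z ef(3) op_edge(2,3)[OF 2(1)] by auto
  next
    case 3
    \<comment> \<open>The avoidance property locates \<open>z\<close> relative to \<open>f'\<close>,
      not to \<open>e\<close>. But an end of \<open>op f'\<close> is an end of \<open>f'\<close>, so
      \<open>z\<close> is also a common point of the edges \<open>e\<close> and \<open>f'\<close> of
      \<open>E'\<close>.\<close>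
    have "height z = lo f' \<or> height z = hi f'"
      using op_meets[OF 3(2) ef(1) 3(4) _ _ z(1)] z ef(3) 3(3) by auto
    then have zf: "z = source f' \<or> z = sink f'"
      using segment_end[OF op_edge(1)[OF 3(2)]] z(2) 3(3) op_edge(2-5)[OF 3(2)] by metis
    show ?thesis
    proof (cases "e = f'")
      case True
      then show ?thesis using \<open>height z = lo f' \<or> height z = hi f'\<close> by simp
    next
      case False
      have "z \<in> f'" using zf ends_in[OF ES'(3)[OF 3(2)]] by blast
      then show ?thesis using ES'(4)[OF 3(1,2) False z(1)] by blast
    qed
  qed
next
  fix e assume "e \<in> E' \<union> op ` E'"
  then show "segment e" using ES'(3) op_edge(1) by blast
qed (use ES' in auto)

text \<open>A point of a new arc that belongs to the old graph is an end of the arc, where both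
  parametrisations agree. Any other point of the arc lies on no second arc, so the choice in
  \<open>retract\<close> can only give \<open>e'\<close>.\<close>

lemma retract_op:
  assumes e': "e' \<in> E'" and x: "x \<in> op e'"
  shows "retract E E' op x = pt e' (height x)"
proof (cases "x \<in> \<Union>E")
  case True
  then obtain f where f: "f \<in> E'" "x \<in> f" using RD(2) by blast
  show ?thesis
  proof (cases "op e' = e'")
    case same: True
    then show ?thesis using True segment_mem(2)[OF ES'(3)[OF e']] x by (simp add: retract_def)
  next
    case False
    then have "height x = lo e' \<or> height x = hi e'" using RD(6)[OF e' f(1) _ x] f(2) by blast
    moreover have "pt (op e') (height x) = x" using segment_mem(2)[OF op_edge(1)[OF e'] x] .
    ultimately show ?thesis using True op_edge(2-5)[OF e'] by (auto simp: retract_def)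
  qed
next
  case False
  define f where "f = (SOME f. f \<in> E' \<and> x \<in> op f)"
  have f: "f \<in> E' \<and> x \<in> op f" unfolding f_def by (rule someI[of _ e']) (use e' x in simp)
  have "f = e'"
  proof (rule ccontr)
    assume "f \<noteq> e'"
    have "op e' \<noteq> e'" using False x e' RD(2) by auto
    then have h: "height x = lo e' \<or> height x = hi e'" using RD(6)[OF e' _ _ x, of f] f \<open>f \<noteq> e'\<close> by blast
    have "pt (op e') (height x) = x" using segment_mem(2)[OF op_edge(1)[OF e'] x] .
    then have "x = source e' \<or> x = sink e'" using h op_edge(2-5)[OF e'] by auto
    then have "x \<in> e'" using ends_in[OF ES'(3)[OF e']] by auto
    then show False using False e' RD(2) by blast
  qed
  then show ?thesis using False by (simp add: retract_def f_def)
qed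

lemma retract_id: "x \<in> \<Union>E \<Longrightarrow> retract E E' op x = x"
  by (simp add: retract_def)

lemma retract_in: "e' \<in> E' \<Longrightarrow> x \<in> op e' \<Longrightarrow> retract E E' op x \<in> e' \<and> height (retract E E' op x) = height x"
  using retract_op[of e' x] segment_mem(1)[OF op_edge(1), of e' x] op_edge(2,3)[of e']
    pt_in[OF ES'(3), of e' "height x"] height_pt[OF ES'(3), of e' "height x"] by auto

text \<open>A new point on the arc of another edge \<open>f\<close> with image in \<open>e'\<close>
  would project to a common point of \<open>f\<close> and \<open>e'\<close>; its height would be
  that of an end of \<open>f\<close>, so the point itself would be an end and hence old.\<close>

lemma retract_preimage:
  assumes e': "e' \<in> E'"
  shows "{x \<in> \<Union>(E' \<union> op ` E'). retract E E' op x \<in> e'} = e' \<union> op e'"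
proof (intro set_eqI iffI)
  fix x assume "x \<in> e' \<union> op e'"
  then show "x \<in> {x \<in> \<Union>(E' \<union> op ` E'). retract E E' op x \<in> e'}"
  proof
    assume "x \<in> e'"
    moreover from this have "x \<in> \<Union>E" using e' RD(2) by blast
    ultimately show ?thesis using e' retract_id by auto
  next
    assume "x \<in> op e'"
    then show ?thesis using retract_in[OF e'] e' by auto
  qed
next
  fix x assume "x \<in> {x \<in> \<Union>(E' \<union> op ` E'). retract E E' op x \<in> e'}"
  then have x: "x \<in> \<Union>(E' \<union> op ` E')" "retract E E' op x \<in> e'" by auto
  show "x \<in> e' \<union> op e'"
  proof (cases "x \<in> \<Union>E")
    case True
    then show ?thesis using x(2) retract_id by simp
  next
    case False
    then obtain f where f: "f \<in> E'" "x \<in> op f" using x(1) RD(2) by auto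
    note rf = retract_in[OF f]
    show ?thesis
    proof (cases "f = e'")
      case ne: False
      have "height x = lo f \<or> height x = hi f"
        using ES'(4)[OF f(1) e' ne] rf x(2) by metis
      then have "x = source f \<or> x = sink f"
        using segment_mem(2)[OF op_edge(1)[OF f(1)] f(2)] op_edge(2-5)[OF f(1)] by auto
      then have "x \<in> f" using ends_in[OF ES'(3)[OF f(1)]] by auto
      then show ?thesis using False f(1) RD(2) by blast
    qed (use f in simp)
  qed
qed

lemma retract_isometric:
  assumes e': "e' \<in> E'"
  shows "retract E E' op ` op e' = e'"
    "\<And>x y. x \<in> op e' \<Longrightarrow> y \<in> op e' \<Longrightarrow> d (retract E E' op x) (retract E E' op y) = d x y"
proof -
  note s = ES'(3)[OF e'] and o = op_edge[OF e']
  show "retract E E' op ` op e' = e'"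
  proof
    show "retract E E' op ` op e' \<subseteq> e'" using retract_in[OF e'] by blast
    show "e' \<subseteq> retract E E' op ` op e'"
    proof
      fix z assume z: "z \<in> e'"
      have h: "height z \<in> {lo (op e')..hi (op e')}" using segment_mem(1)[OF s z] o by simp
      have "retract E E' op (pt (op e') (height z)) = z"
        using retract_op[OF e' pt_in[OF o(1) h]] height_pt[OF o(1) h] segment_mem(2)[OF s z] by simp
      then show "z \<in> retract E E' op ` op e'" using pt_in[OF o(1) h] by (metis image_eqI)
    qed
  qed
  fix x y assume xy: "x \<in> op e'" "y \<in> op e'"
  note h = segment_mem[OF o(1) xy(1)] segment_mem[OF o(1) xy(2)]
  have "d (retract E E' op x) (retract E E' op y) = \<bar>height x - height y\<bar>"
    using retract_op[OF e'] xy pt_dist[OF s] h o by simp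
  also have "\<dots> = d x y" using pt_dist[OF o(1) h(1,3)] h by simp
  finally show "d (retract E E' op x) (retract E E' op y) = d x y" .
qed

lemma opp_point_retract:
  assumes e': "e' \<in> E'" and p: "p \<in> e'"
  shows "opp_point (retract E E' op) (op e') p = pt (op e') (height p)"
  unfolding opp_point_def
proof (rule the_equality)
  note s = ES'(3)[OF e'] and o = op_edge[OF e']
  have h: "height p \<in> {lo (op e')..hi (op e')}" using segment_mem(1)[OF s p] o by simp
  show "pt (op e') (height p) \<in> op e' \<and> retract E E' op (pt (op e') (height p)) = p"
    using retract_op[OF e' pt_in[OF o(1) h]] height_pt[OF o(1) h] segment_mem(2)[OF s p] pt_in[OF o(1) h] by simp
  fix x assume x: "x \<in> op e' \<and> retract E E' op x = p"
  then have "height x = height p" using retract_in[OF e'] by metis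
  then show "x = pt (op e') (height p)" using segment_mem(2)[OF o(1)] x by metis
qed

section \<open>Weights\<close>

definition parent :: "'a set \<Rightarrow> 'a set" where
  "parent e' = (SOME e. e \<in> E \<and> e' \<subseteq> e)"

lemma parent:
  assumes "e' \<in> E'"
  shows "parent e' \<in> E" "e' \<subseteq> parent e'" "\<And>e. e \<in> E \<Longrightarrow> e' \<subseteq> e \<longleftrightarrow> parent e' = e"
proof -
  have "\<exists>e. e \<in> E \<and> e' \<subseteq> e" using RD(3)[OF assms] by blast
  then show *: "parent e' \<in> E" "e' \<subseteq> parent e'" unfolding parent_def by (metis (no_types, lifting) someI_ex)+
  show "e' \<subseteq> e \<longleftrightarrow> parent e' = e" if "e \<in> E" for e
    using parent_unique[OF E *(1) that ES'(3)[OF assms] *(2)] * by blast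
qed

text \<open>Recovers the edge of \<open>E'\<close> from either arc of a circle; this is unambiguous
  by \<open>op_new\<close> and \<open>op_inj\<close>.\<close>

definition base :: "'a set \<Rightarrow> 'a set" where
  "base f = (SOME e'. e' \<in> E' \<and> (f = e' \<or> f = op e'))"

text \<open>\<open>c\<close> is the density of the measure with respect to length, constant on each
  edge; on a circle each of the two arcs receives half of the density of the parent edge.\<close>

definition next_weight :: "('a set \<Rightarrow> real) \<Rightarrow> 'a set \<Rightarrow> real" where
  "next_weight c f = c (parent (base f)) * (if op (base f) = base f then 1 else 1 / 2)"

lemma base:
  assumes e': "e' \<in> E'" and f: "f = e' \<or> f = op e'"
  shows "base f = e'"
proof -
  have "base f \<in> E' \<and> (f = base f \<or> f = op (base f))"
    unfolding base_def by (rule someI[of _ e']) (use assms in blast)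
  then show ?thesis using op_new op_inj e' f by metis
qed

lemma next_weight:
  assumes "e' \<in> E'" "e \<in> E" "e' \<subseteq> e"
  shows "next_weight c e' = c e * (if op e' = e' then 1 else 1 / 2)"
    "next_weight c (op e') = c e * (if op e' = e' then 1 else 1 / 2)"
  using base[OF assms(1)] parent(3)[OF assms(1,2)] assms(3) by (auto simp: next_weight_def)

lemma next_weight_nonneg:
  assumes "\<And>e. e \<in> E \<Longrightarrow> 0 \<le> c e" "f \<in> E' \<union> op ` E'"
  shows "0 \<le> next_weight c f"
proof -
  obtain e' where e': "e' \<in> E'" "f = e' \<or> f = op e'" using assms(2) by blast
  then show ?thesis using next_weight[OF e'(1) parent(1,2)[OF e'(1)], of c] assms(1)[OF parent(1)[OF e'(1)]]
    by auto
qed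

text \<open>The two arcs of a circle have the length of the subdivided edge and half of its density,
  so together they carry its mass; the subedges of one old edge then add up to that edge.\<close>

lemma next_weight_total:
  "(\<Sum>f\<in>E' \<union> op ` E'. next_weight c f * (hi f - lo f)) = (\<Sum>e\<in>E. c e * (hi e - lo e))"
proof -
  define C where "C = {e' \<in> E'. op e' \<noteq> e'}"
  have C: "C \<subseteq> E'" by (auto simp: C_def)
  have un: "E' \<union> op ` E' = E' \<union> op ` C" by (auto simp: C_def)
  have disj: "E' \<inter> op ` C = {}" using op_new by (auto simp: C_def)
  have inj: "inj_on op C" using op_inj by (auto simp: inj_on_def C_def)
  have finC: "finite C" using C ES'(1) by (rule finite_subset)
  have "(\<Sum>f\<in>E' \<union> op ` E'. next_weight c f * (hi f - lo f)) =
      (\<Sum>f\<in>E'. next_weight c f * (hi f - lo f)) + (\<Sum>f\<in>C. next_weight c (op f) * (hi (op f) - lo (op f)))"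
    unfolding un using disj inj finC ES'(1) by (simp add: sum.union_disjoint sum.reindex)
  also have "(\<Sum>f\<in>C. next_weight c (op f) * (hi (op f) - lo (op f))) =
      (\<Sum>f\<in>E'. if f \<in> C then next_weight c f * (hi f - lo f) else 0)"
  proof -
    have "next_weight c (op f) * (hi (op f) - lo (op f)) = next_weight c f * (hi f - lo f)" if "f \<in> C" for f
    proof -
      have f: "f \<in> E'" using that C by blast
      show ?thesis using next_weight[OF f parent(1,2)[OF f], of c] op_edge(2,3)[OF f] by simp
    qed
    moreover have "E' \<inter> C = C" using C by blast
    ultimately show ?thesis using ES'(1) by (simp add: sum.If_cases)
  qed
  also have "(\<Sum>f\<in>E'. next_weight c f * (hi f - lo f)) + \<dots> =
      (\<Sum>f\<in>E'. next_weight c f * (hi f - lo f) + (if f \<in> C then next_weight c f * (hi f - lo f) else 0))"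
    by (simp add: sum.distrib)
  also have "\<dots> = (\<Sum>f\<in>E'. c (parent f) * (hi f - lo f))"
  proof (rule sum.cong)
    fix f assume f: "f \<in> E'"
    show "next_weight c f * (hi f - lo f) + (if f \<in> C then next_weight c f * (hi f - lo f) else 0) =
        c (parent f) * (hi f - lo f)"
      using next_weight(1)[OF f parent(1,2)[OF f], of c] f by (simp add: C_def)
  qed simp
  also have "\<dots> = (\<Sum>e\<in>E. \<Sum>f | f \<in> E' \<and> parent f = e. c (parent f) * (hi f - lo f))"
    by (rule sum.group[symmetric]) (use ES ES' parent(1) in auto)
  also have "\<dots> = (\<Sum>e\<in>E. c e * (\<Sum>f | f \<in> E' \<and> f \<subseteq> e. hi f - lo f))"
  proof (rule sum.cong)
    fix e assume e: "e \<in> E"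
    have "{f. f \<in> E' \<and> parent f = e} = {f. f \<in> E' \<and> f \<subseteq> e}" using parent(3) e by blast
    then show "(\<Sum>f | f \<in> E' \<and> parent f = e. c (parent f) * (hi f - lo f)) =
        c e * (\<Sum>f | f \<in> E' \<and> f \<subseteq> e. hi f - lo f)"
      unfolding sum_distrib_left by (intro sum.cong) (use parent(3) e in auto)
  qed simp
  also have "\<dots> = (\<Sum>e\<in>E. c e * (hi e - lo e))"
    by (intro sum.cong) (use RD(11) in auto)
  finally show ?thesis .
qed

section \<open>Mesh parameters\<close>

lemma len_E: "e \<in> E \<Longrightarrow> len d (graph_of E) e = hi e - lo e"
  using len_sub_edge[OF E _ ES(3)] by blast

lemma len_E': "e' \<in> E' \<Longrightarrow> len d (graph_of E) e' = hi e' - lo e'"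
  using len_sub_edge[OF E _ ES'(3)] RD(3) by blast

lemma delta_E_le:
  assumes "\<delta> > 0"
  shows "delta_E d (graph_of E) (graph_of E') \<le> \<delta>"
proof -
  have "Min (len d (graph_of E) ` E) \<in> len d (graph_of E) ` E" using ES by (intro Min_in) auto
  then obtain e where e: "e \<in> E" "Min (len d (graph_of E) ` E) = hi e - lo e" using len_E by auto
  have "Max (len d (graph_of E) ` E') \<le> \<delta> * (hi e - lo e)"
    using ES' RD(9)[OF _ e(1)] len_E' by simp
  then show ?thesis
    using e(2) segment_bounds(2)[OF ES(3)[OF e(1)]] by (simp add: delta_E_def Delta_E_def divide_le_eq)
qed

lemma terminal_iff:
  assumes e: "e \<in> E" and e': "e' \<in> E'" "e' \<subseteq> e"
  shows "terminal_subedge (graph_of E) (graph_of E') e e' \<longleftrightarrow> lo e' = lo e \<or> hi e' = hi e"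
proof -
  note s = ES(3)[OF e] and s' = ES'(3)[OF e'(1)]
  note b = segment_bounds[OF s] segment_bounds[OF s']
  have sub: "lo e' \<in> {lo e..hi e}" "hi e' \<in> {lo e..hi e}" using pt_subset(2)[OF s s' e'(2)] b by auto
  have pts: "source e' = pt e (lo e')" "sink e' = pt e (hi e')" using pt_subset(1)[OF s s' e'(2)] b by auto
  have inj: "pt e u = pt e v \<longleftrightarrow> u = v" if "u \<in> {lo e..hi e}" "v \<in> {lo e..hi e}" for u v
    using height_pt[OF s that(1)] height_pt[OF s that(2)] by metis
  have "{source e', sink e'} \<inter> {source e, sink e} \<noteq> {} \<longleftrightarrow>
      lo e' = lo e \<or> lo e' = hi e \<or> hi e' = lo e \<or> hi e' = hi e"
    using inj sub b unfolding pts by auto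
  also have "\<dots> \<longleftrightarrow> lo e' = lo e \<or> hi e' = hi e" using sub b by auto
  finally show ?thesis using e e' by (simp add: terminal_subedge_def)
qed

lemma nonterminal_iff:
  "nonterminal_subedge (graph_of E) (graph_of E') e e' \<longleftrightarrow>
    e \<in> E \<and> e' \<in> E' \<and> e' \<subseteq> e \<and> lo e' \<noteq> lo e \<and> hi e' \<noteq> hi e"
  using terminal_iff by (auto simp: nonterminal_subedge_def)

text \<open>The same \<eta> bounds \<open>Delta_d\<close> from below and, multiplied by \<delta>,
  the lengths in the numerator from above. Without nonterminal subedges the infimum is infinite and
  the supremum is 0, which agrees with both bounds.\<close>

lemma delta_d_le:
  assumes \<delta>: "\<delta> > 0"
  shows "delta_d d (graph_of E) (graph_of E') \<le> ennreal \<delta>"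
proof -
  obtain \<eta> where \<eta>: "\<eta> > 0" "\<forall>e\<in>E. \<forall>e'\<in>E'. e' \<subseteq> e \<and> lo e' \<noteq> lo e \<and> hi e' \<noteq> hi e \<longrightarrow>
      hi e' - lo e' \<le> \<delta> * \<eta> \<and> (\<forall>z\<in>e'. \<forall>w\<in>\<Union>E - e. \<eta> \<le> d z w)"
    using RD(10) by blast
  have "ennreal \<eta> \<le> Delta_d d (graph_of E) (graph_of E')"
    unfolding Delta_d_def
  proof (rule INF_greatest)
    fix x assume "x \<in> {(e, e'). nonterminal_subedge (graph_of E) (graph_of E') e e'}"
    then obtain e e' where x: "x = (e, e')" "e \<in> E \<and> e' \<in> E' \<and> e' \<subseteq> e \<and> lo e' \<noteq> lo e \<and> hi e' \<noteq> hi e"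
      by (auto simp: nonterminal_iff)
    have "ennreal \<eta> \<le> set_distance d e' (pts (graph_of E) - e)"
      unfolding set_distance_def
    proof (intro INF_greatest ennreal_leI)
      fix z w assume "z \<in> e'" "w \<in> pts (graph_of E) - e"
      then show "\<eta> \<le> d z w" using \<eta>(2)[rule_format, of e e'] x(2) by simp
    qed
    then show "ennreal \<eta> \<le> (case x of (e, e') \<Rightarrow> set_distance d e' (pts (graph_of E) - e))"
      using x(1) by simp
  qed
  moreover have "(SUP e'\<in>{e'. \<exists>e. nonterminal_subedge (graph_of E) (graph_of E') e e'}.
      ennreal (len d (graph_of E) e')) \<le> ennreal (\<delta> * \<eta>)"
  proof (rule SUP_least)
    fix e' assume "e' \<in> {e'. \<exists>e. nonterminal_subedge (graph_of E) (graph_of E') e e'}"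
    then obtain e where e: "e \<in> E \<and> e' \<in> E' \<and> e' \<subseteq> e \<and> lo e' \<noteq> lo e \<and> hi e' \<noteq> hi e"
      by (auto simp: nonterminal_iff)
    then have "hi e' - lo e' \<le> \<delta> * \<eta>" using \<eta>(2) by blast
    then show "ennreal (len d (graph_of E) e') \<le> ennreal (\<delta> * \<eta>)" using len_E' e by (intro ennreal_leI) simp
  qed
  ultimately have "delta_d d (graph_of E) (graph_of E') \<le> ennreal (\<delta> * \<eta>) / ennreal \<eta>"
    unfolding delta_d_def divide_ennreal_def by (intro mult_mono inverse_ennreal_antimono \<eta>(1)) auto
  also have "\<dots> = ennreal \<delta>" using \<delta> \<eta>(1) by (simp add: divide_ennreal)
  finally show ?thesis .
qed

lemma subdivision_graph_of: "directed_subdivision d (graph_of E) (graph_of E')"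
proof -
  have "\<exists>e\<in>E. e' \<subseteq> e \<and> d (source e) (source e') < d (source e) (sink e')" if e': "e' \<in> E'" for e'
  proof -
    obtain e where e: "e \<in> E" "e' \<subseteq> e" using RD(3)[OF e'] by blast
    note s = ES(3)[OF e(1)] and s' = ES'(3)[OF e']
    note b = segment_bounds[OF s] segment_bounds[OF s']
    have sub: "lo e' \<in> {lo e..hi e}" "hi e' \<in> {lo e..hi e}" using pt_subset(2)[OF s s' e(2)] b by auto
    have "source e' = pt e (lo e')" "sink e' = pt e (hi e')" using pt_subset(1)[OF s s' e(2)] b by auto
    then have "d (source e) (source e') < d (source e) (sink e')"
      using pt_dist[OF s, of "lo e"] sub b by simp
    then show ?thesis using e by blast
  qed
  then show ?thesis
    unfolding directed_subdivision_def using graph_of_directed[OF RD(1)] RD(2,4) by simp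
qed

end

section \<open>Measures on the graphs\<close>

definition opens :: "'a set set \<Rightarrow> 'a set set" where
  "opens E = {U. openin (Metric_space.mtopology (\<Union>E) d) U}"

text \<open>Lebesgue measure is transported to each edge by the height and weighted there. A vertex
  is counted once for each of its edges, but always with measure zero. Generation by the open sets
  provides the required sigma-algebra.\<close>

definition edge_measure :: "'a set set \<Rightarrow> ('a set \<Rightarrow> real) \<Rightarrow> 'a measure" where
  "edge_measure E c = measure_of (\<Union>E) (opens E)
     (\<lambda>A. \<Sum>e\<in>E. ennreal (c e) * emeasure lborel (height ` (A \<inter> e)))"

context
  fixes E :: "'a set set" and c :: "'a set \<Rightarrow> real"
  assumes E: "edge_system E" and c: "\<And>e. e \<in> E \<Longrightarrow> 0 \<le> c e"
begin

lemmas ES2 = edge_systemD[OF E]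

lemma subspace_E: "Metric_space (\<Union>E) d"
  using subspace[of "\<Union>E"] segment_subset ES2(3) by blast

lemma opens_Pow: "opens E \<subseteq> Pow (\<Union>E)"
  using Metric_space.openin_mtopology[OF subspace_E] by (auto simp: opens_def)

lemma space_edge_measure: "space (edge_measure E c) = \<Union>E"
  using opens_Pow by (simp add: edge_measure_def space_measure_of)

lemma sets_edge_measure: "sets (edge_measure E c) = sigma_sets (\<Union>E) (opens E)"
  using opens_Pow by (simp add: edge_measure_def sets_measure_of)

lemma pt_measurable:
  assumes e: "e \<in> E"
  shows "pt e \<in> measurable (restrict_space borel {lo e..hi e}) (edge_measure E c)"
  unfolding edge_measure_def
proof (rule measurable_measure_of[OF opens_Pow])
  note s = ES2(3)[OF e]
  show "pt e \<in> space (restrict_space borel {lo e..hi e}) \<rightarrow> \<Union>E"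
    using pt_in[OF s] e by (auto simp: space_restrict_space)
  fix U assume "U \<in> opens E"
  then have U: "U \<subseteq> \<Union>E" "\<And>x. x \<in> U \<Longrightarrow> \<exists>r>0. Metric_space.mball (\<Union>E) d x r \<subseteq> U"
    using Metric_space.openin_mtopology[OF subspace_E] by (auto simp: opens_def)
  have "openin (top_of_set {lo e..hi e}) (pt e -` U \<inter> {lo e..hi e})"
    unfolding openin_euclidean_subtopology_iff
  proof (intro conjI ballI)
    fix t assume t: "t \<in> pt e -` U \<inter> {lo e..hi e}"
    then obtain r where r: "r > 0" "Metric_space.mball (\<Union>E) d (pt e t) r \<subseteq> U" using U(2) by blast
    show "\<exists>r>0. \<forall>t'\<in>{lo e..hi e}. dist t' t < r \<longrightarrow> t' \<in> pt e -` U \<inter> {lo e..hi e}"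
    proof (intro exI[of _ r] conjI ballI impI)
      fix t' assume t': "t' \<in> {lo e..hi e}" "dist t' t < r"
      have "pt e t' \<in> Metric_space.mball (\<Union>E) d (pt e t) r"
        using pt_in[OF s] t t' e pt_dist[OF s, of t t']
        by (auto simp: Metric_space.in_mball[OF subspace_E] dist_real_def)
      then show "t' \<in> pt e -` U \<inter> {lo e..hi e}" using r(2) t' by auto
    qed (use r in auto)
  qed auto
  then obtain V where "open V" "pt e -` U \<inter> {lo e..hi e} = {lo e..hi e} \<inter> V" by (auto simp: openin_open)
  then show "pt e -` U \<inter> space (restrict_space borel {lo e..hi e}) \<in> sets (restrict_space borel {lo e..hi e})"
    by (auto simp: space_restrict_space sets_restrict_space)
qed

text \<open>On \<open>e\<close> the height is inverse to \<open>pt e\<close>, so the image is a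
  preimage under a Borel map.\<close>

lemma height_image_borel:
  assumes e: "e \<in> E" and A: "A \<in> sets (edge_measure E c)"
  shows "height ` (A \<inter> e) \<in> sets borel"
proof -
  note s = ES2(3)[OF e]
  have "height ` (A \<inter> e) = pt e -` A \<inter> space (restrict_space borel {lo e..hi e})"
  proof (intro set_eqI iffI)
    fix t assume "t \<in> height ` (A \<inter> e)"
    then show "t \<in> pt e -` A \<inter> space (restrict_space borel {lo e..hi e})"
      using segment_mem[OF s] by (auto simp: space_restrict_space)
  next
    fix t assume "t \<in> pt e -` A \<inter> space (restrict_space borel {lo e..hi e})"
    then have t: "t \<in> {lo e..hi e}" "pt e t \<in> A" by (auto simp: space_restrict_space)
    then show "t \<in> height ` (A \<inter> e)"
      using pt_in[OF s t(1)] height_pt[OF s t(1)] by (intro image_eqI[of _ _ "pt e t"]) auto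
  qed
  also have "\<dots> \<in> sets (restrict_space borel {lo e..hi e})"
    by (rule measurable_sets[OF pt_measurable[OF e] A])
  finally show ?thesis by (subst (asm) sets_restrict_space_iff) auto
qed

text \<open>Height is injective on each edge, so disjoint sets have disjoint images there; this
  gives countable additivity.\<close>

lemma emeasure_edge_measure:
  assumes A: "A \<in> sets (edge_measure E c)"
  shows "emeasure (edge_measure E c) A = (\<Sum>e\<in>E. ennreal (c e) * emeasure lborel (height ` (A \<inter> e)))"
proof (rule emeasure_measure_of[OF edge_measure_def opens_Pow _ _ A])
  show "positive (sets (edge_measure E c)) (\<lambda>A. \<Sum>e\<in>E. ennreal (c e) * emeasure lborel (height ` (A \<inter> e)))"
    by (simp add: positive_def)
  show "countably_additive (sets (edge_measure E c)) (\<lambda>A. \<Sum>e\<in>E. ennreal (c e) * emeasure lborel (height ` (A \<inter> e)))"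
  proof (rule countably_additiveI)
    fix A :: "nat \<Rightarrow> 'a set"
    assume A: "range A \<subseteq> sets (edge_measure E c)" "disjoint_family A"
    have "(\<Sum>n. emeasure lborel (height ` (A n \<inter> e))) = emeasure lborel (height ` ((\<Union>n. A n) \<inter> e))"
      if e: "e \<in> E" for e
    proof -
      have "disjoint_family (\<lambda>n. height ` (A n \<inter> e))"
        unfolding disjoint_family_on_def
      proof (intro ballI impI)
        fix n k :: nat assume "n \<noteq> k"
        then have "A n \<inter> A k = {}" using A(2) by (auto simp: disjoint_family_on_def)
        moreover have "x = y" if "x \<in> e" "y \<in> e" "height x = height y" for x y
          using segment_mem(2)[OF ES2(3)[OF e]] that by metis
        ultimately show "height ` (A n \<inter> e) \<inter> height ` (A k \<inter> e) = {}" by blast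
      qed
      moreover have "range (\<lambda>n. height ` (A n \<inter> e)) \<subseteq> sets lborel"
        using height_image_borel[OF e] A(1) by auto
      ultimately have "(\<Sum>n. emeasure lborel (height ` (A n \<inter> e))) = emeasure lborel (\<Union>n. height ` (A n \<inter> e))"
        by (intro suminf_emeasure)
      also have "(\<Union>n. height ` (A n \<inter> e)) = height ` ((\<Union>n. A n) \<inter> e)" by blast
      finally show ?thesis .
    qed
    then show "(\<Sum>n. \<Sum>e\<in>E. ennreal (c e) * emeasure lborel (height ` (A n \<inter> e))) =
        (\<Sum>e\<in>E. ennreal (c e) * emeasure lborel (height ` (\<Union> (range A) \<inter> e)))"
      by (subst suminf_sum) (auto intro!: sum.cong summableI)
  qed
qed

lemma emeasure_height_finite:
  assumes e: "e \<in> E"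
  shows "emeasure lborel (height ` (A \<inter> e)) < \<infinity>"
proof -
  have "emeasure lborel (height ` (A \<inter> e)) \<le> emeasure lborel {lo e..hi e}"
    by (rule emeasure_mono) (use segment_mem(1)[OF ES2(3)[OF e]] in auto)
  then show ?thesis using segment_bounds[OF ES2(3)[OF e]] by (simp add: le_less_trans[OF _ ennreal_less_top])
qed

lemma measure_edge_measure:
  assumes A: "A \<in> sets (edge_measure E c)"
  shows "measure (edge_measure E c) A = (\<Sum>e\<in>E. c e * measure lborel (height ` (A \<inter> e)))"
proof -
  have "emeasure (edge_measure E c) A = (\<Sum>e\<in>E. ennreal (c e * measure lborel (height ` (A \<inter> e))))"
    unfolding emeasure_edge_measure[OF A]
    using emeasure_height_finite c by (intro sum.cong) (simp_all add: emeasure_eq_ennreal_measure ennreal_mult less_top)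
  also have "\<dots> = ennreal (\<Sum>e\<in>E. c e * measure lborel (height ` (A \<inter> e)))"
    using c by (intro sum_ennreal) simp
  finally show ?thesis using c by (simp add: measure_def sum_nonneg)
qed

lemma measure_sub_edge:
  assumes A: "A \<in> sets (edge_measure E c)" and e: "e \<in> E" "A \<subseteq> e"
  shows "measure (edge_measure E c) A = c e * len d (graph_of E) A"
proof -
  have null: "measure lborel (height ` (A \<inter> f)) = 0" if "f \<in> E - {e}" for f
  proof -
    have "height ` (A \<inter> f) \<subseteq> {lo e, hi e}"
      using ES2(4)[OF e(1), of f] that e(2) by blast
    then have "finite (height ` (A \<inter> f))" by (rule finite_subset) simp
    then show ?thesis by (simp add: measure_eq_0_null_sets finite_imp_null_set_lborel)
  qed
  have Ae: "A \<inter> e = A" using e(2) by blast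
  have "height ` A \<in> sets borel" using height_image_borel[OF e(1) A] Ae by simp
  then show ?thesis
    using null ES2(1) e(1) Ae len_graph_of[OF E e(1,2)] by (simp add: measure_edge_measure[OF A] sum.remove[of E e])
qed

text \<open>The complement is open: for \<open>x\<close> outside \<open>f\<close>, the point of
  \<open>f\<close> whose height is nearest to that of \<open>x\<close> is at most twice as far from
  \<open>x\<close> as any other point of \<open>f\<close>.\<close>

lemma segment_measurable:
  assumes f: "segment f" "f \<subseteq> \<Union>E"
  shows "f \<in> sets (edge_measure E c)"
proof -
  have "\<Union>E - f \<in> opens E"
    unfolding opens_def mem_Collect_eq Metric_space.openin_mtopology[OF subspace_E]
  proof (intro conjI allI impI)
    fix x assume x: "x \<in> \<Union>E - f"
    then obtain e where e: "e \<in> E" "x \<in> e" by blast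
    \<comment> \<open>The height of \<open>x\<close> is clamped to the range of \<open>f\<close>. As
      height is 1-Lipschitz and \<open>f\<close> is a geodesic,
      \<open>d y (pt f u) \<le> d x y\<close> for every \<open>y\<close> in
      \<open>f\<close>.\<close>
    define u where "u = max (lo f) (min (hi f) (height x))"
    have u: "u \<in> {lo f..hi f}" using segment_bounds[OF f(1)] by (auto simp: u_def)
    have xM: "x \<in> M" using e segment_subset ES2(3) by blast
    have "x \<noteq> pt f u" using x pt_in[OF f(1) u] by blast
    then have pos: "d x (pt f u) > 0" using xM pt_mem[OF f(1) u] by simp
    show "\<exists>r>0. Metric_space.mball (\<Union>E) d x r \<subseteq> \<Union>E - f"
    proof (intro exI[of _ "d x (pt f u) / 2"] conjI subsetI)
      fix y assume "y \<in> Metric_space.mball (\<Union>E) d x (d x (pt f u) / 2)"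
      then have y: "y \<in> \<Union>E" "d x y < d x (pt f u) / 2" by (auto simp: Metric_space.in_mball[OF subspace_E])
      have "y \<notin> f"
      proof
        assume yf: "y \<in> f"
        note h = segment_mem[OF f(1) yf]
        have "\<bar>height y - u\<bar> \<le> \<bar>height x - height y\<bar>" using h(1) by (auto simp: u_def)
        also have "\<dots> \<le> d x y" by (rule height_dist[OF ES2(3)[OF e(1)] f(1) e(2) yf])
        finally have "d y (pt f u) \<le> d x y" using pt_dist[OF f(1) h(1) u] h(2) by simp
        moreover have "d x (pt f u) \<le> d x y + d y (pt f u)"
          using triangle xM pt_mem[OF f(1) u] segment_subset[OF f(1)] yf by blast
        ultimately show False using y(2) by simp
      qed
      then show "y \<in> \<Union>E - f" using y(1) by blast
    qed (use pos in simp)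
  qed auto
  then have "\<Union>E - (\<Union>E - f) \<in> sigma_sets (\<Union>E) (opens E)" by (intro sigma_sets.Compl sigma_sets.Basic)
  moreover have "\<Union>E - (\<Union>E - f) = f" using f(2) by blast
  ultimately show ?thesis by (simp add: sets_edge_measure)
qed

lemma measure_segment:
  assumes e: "e \<in> E" and f: "segment f" "f \<subseteq> e"
  shows "measure (edge_measure E c) f = c e * (hi f - lo f)"
proof -
  have "f \<in> sets (edge_measure E c)" using segment_measurable[OF f(1)] f(2) e by blast
  then show ?thesis using measure_sub_edge[OF _ e f(2)] len_sub_edge[OF E e f] by simp
qed

lemma prob_space_edge_measure:
  assumes "(\<Sum>e\<in>E. c e * (hi e - lo e)) = 1"
  shows "prob_space (edge_measure E c)"
proof
  have top: "\<Union>E \<in> sets (edge_measure E c)"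
    using sets.top[of "edge_measure E c"] space_edge_measure by simp
  have "height ` (\<Union>E \<inter> e) = {lo e..hi e}" if "e \<in> E" for e
    using height_image[OF ES2(3)[OF that]] that by (metis Union_upper inf.absorb2)
  then have "emeasure (edge_measure E c) (\<Union>E) = (\<Sum>e\<in>E. ennreal (c e * (hi e - lo e)))"
    unfolding emeasure_edge_measure[OF top]
    using segment_bounds ES2(3) c by (intro sum.cong) (simp_all add: ennreal_mult less_imp_le)
  also have "\<dots> = ennreal (\<Sum>e\<in>E. c e * (hi e - lo e))"
    using segment_bounds ES2(3) c by (intro sum_ennreal mult_nonneg_nonneg) (auto simp: less_imp_le)
  finally show "emeasure (edge_measure E c) (space (edge_measure E c)) = 1"
    using assms space_edge_measure by simp
qed

end

section \<open>The thick inverse system\<close>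

lemma single_edge:
  assumes g: "\<gamma> \<in> F"
  shows "edge_system {\<gamma> ` {0..1}}" "lo (\<gamma> ` {0..1}) = 0" "hi (\<gamma> ` {0..1}) = 1"
    "source (\<gamma> ` {0..1}) = v0" "sink (\<gamma> ` {0..1}) = v1"
proof -
  note s = segmentI[OF g, of 0 1, simplified]
  show "edge_system {\<gamma> ` {0..1}}" using s(1) by (intro edge_systemI) auto
  show "lo (\<gamma> ` {0..1}) = 0" "hi (\<gamma> ` {0..1}) = 1" by (rule s(2), rule s(3))
  then show "source (\<gamma> ` {0..1}) = v0" "sink (\<gamma> ` {0..1}) = v1" using s(4) start[OF g] finish[OF g] by auto
qed

text \<open>The dependent choice runs over the edge sets alone, with the first one pinned by the
  clause for \<open>i = 0\<close>; subdivision and detours are extracted afterwards, stage by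
  stage.\<close>

lemma refinement_sequence:
  assumes \<delta>: "\<And>i. 0 < \<delta> i" and g: "\<gamma> \<in> F"
  obtains E E' op where "E 0 = {\<gamma> ` {0..1}}" "\<And>i :: nat. edge_system (E i)"
    "\<And>i. refinement (E i) (\<delta> i) (E' i) (op i)" "\<And>i. E (Suc i) = E' i \<union> op i ` E' i"
proof -
  have "\<exists>E. \<forall>i. (edge_system (E i) \<and> (i = 0 \<longrightarrow> E i = {\<gamma> ` {0..1}})) \<and>
      (\<exists>E' op. refinement (E i) (\<delta> i) E' op \<and> E (Suc i) = E' \<union> op ` E')"
  proof (rule dependent_nat_choice)
    show "\<exists>E. edge_system E \<and> ((0::nat) = 0 \<longrightarrow> E = {\<gamma> ` {0..1}})" using single_edge(1)[OF g] by blast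
    fix E and i :: nat assume "edge_system E \<and> (i = 0 \<longrightarrow> E = {\<gamma> ` {0..1}})"
    then have E: "edge_system E" by blast
    obtain E' op where R: "refinement E (\<delta> i) E' op" using refinement_exists[OF E \<delta>] by blast
    then show "\<exists>y. (edge_system y \<and> (Suc i = 0 \<longrightarrow> y = {\<gamma> ` {0..1}})) \<and>
        (\<exists>E' op. refinement E (\<delta> i) E' op \<and> y = E' \<union> op ` E')"
      using edge_system_next[OF E R] by blast
  qed
  then obtain E where *: "\<forall>i. (edge_system (E i) \<and> (i = 0 \<longrightarrow> E i = {\<gamma> ` {0..1}})) \<and>
      (\<exists>E' op. refinement (E i) (\<delta> i) E' op \<and> E (Suc i) = E' \<union> op ` E')" by (rule exE)
  have E: "edge_system (E i)" "E 0 = {\<gamma> ` {0..1}}"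
    "\<exists>E' op. refinement (E i) (\<delta> i) E' op \<and> E (Suc i) = E' \<union> op ` E'" for i
    using spec[OF *, of i] spec[OF *, of 0] by simp_all
  from E(3) obtain E' op where "\<And>i. refinement (E i) (\<delta> i) (E' i) (op i) \<and> E (Suc i) = E' i \<union> op i ` E' i"
    by metis
  then show thesis using E(1,2) by (intro that[of E E' op]) blast+
qed

lemma contains_system:
  assumes \<delta>: "\<And>i. 0 < \<delta> i"
  shows "contains_thick_inverse_system M d \<delta>"
proof -
  obtain \<gamma> where g: "\<gamma> \<in> F" using family by (auto simp: curve_family_def)
  define e\<^sub>0 where "e\<^sub>0 = \<gamma> ` {0..1}"
  note e0 = single_edge[OF g, folded e\<^sub>0_def]
  obtain E E' op where E0: "E 0 = {e\<^sub>0}" and E: "\<And>i :: nat. edge_system (E i)"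
    and R: "\<And>i. refinement (E i) (\<delta> i) (E' i) (op i)" and Suc: "\<And>i. E (Suc i) = E' i \<union> op i ` E' i"
    by (rule refinement_sequence[of \<delta>, OF \<delta> g, folded e\<^sub>0_def]) (rule that)
  \<comment> \<open>The densities: length itself on the single edge, then divided at each
    circle.\<close>
  define c where "c = rec_nat (\<lambda>_. 1) (\<lambda>i. next_weight (E i) (E' i) (op i))"
  have c_simps: "c 0 = (\<lambda>_. 1)" "\<And>i. c (Suc i) = next_weight (E i) (E' i) (op i) (c i)"
    by (simp_all add: c_def)
  have c_nonneg: "e \<in> E i \<Longrightarrow> 0 \<le> c i e" for i e
  proof (induction i arbitrary: e)
    case (Suc i)
    then show ?case using next_weight_nonneg[OF E R] \<open>\<And>i. E (Suc i) = _\<close> by (simp add: c_simps)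
  qed (simp add: c_simps)
  have c_total: "(\<Sum>e\<in>E i. c i e * (hi e - lo e)) = 1" for i
  proof (induction i)
    case 0
    then show ?case using e0(2,3) by (simp add: E0 c_simps)
  next
    case (Suc i)
    then show ?case using next_weight_total[OF E R] \<open>\<And>i. E (Suc i) = _\<close> by (simp add: c_simps)
  qed
  let ?X = "\<lambda>i. graph_of (E i)" and ?X' = "\<lambda>i. graph_of (E' i)"
    and ?proj = "\<lambda>i. retract (E i) (E' i) (op i)" and ?\<mu> = "\<lambda>i. edge_measure (E i) (c i)"
  note RD = refinementD[OF R]
  note op = op_edge[OF E R]
  have seg': "segment e'" if "e' \<in> E' i" for e' i using edge_systemD(3)[OF RD(1) that] .
  have Union_mono: "\<Union>(E i) \<subseteq> \<Union>(E (Suc i))" for i using RD(2)[of i] Suc[of i] by auto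
  have "thick_inverse_system d v0 v1 ?X ?X' ?proj op ?\<mu>"
  proof (rule thick_inverse_system.intro)
    fix i
    show "directed_metric_graph d (?X i)" by (rule graph_of_directed[OF E])
    show "pts (?X i) \<subseteq> pts (?X (Suc i))" using Union_mono by simp
    show "?proj i \<in> pts (?X (Suc i)) \<rightarrow> pts (?X i)"
    proof
      fix x assume "x \<in> pts (?X (Suc i))"
      then obtain e' where e': "e' \<in> E' i" "x \<in> e' \<or> x \<in> op i e'" using Suc[of i] by auto
      then have "?proj i x \<in> e'" using retract_preimage[OF E R e'(1)] Suc[of i] by blast
      then show "?proj i x \<in> pts (?X i)" using e'(1) RD(2)[of i] by auto
    qed
    show "directed_subdivision d (?X i) (?X' i)" by (rule subdivision_graph_of[OF E R])
    show "\<exists>\<beta>>0. \<forall>i es. directed_edge_path_from_to (?X' i) v0 v1 es \<longrightarrow>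
      (\<Sum>e' | e' \<in> edges (?X' i) \<and> e' \<subseteq> \<Union>(set es) \<and> op i e' \<noteq> e'. len d (?X i) e') \<ge> \<beta>"
    proof (intro exI[of _ "\<alpha> / 4"] conjI allI impI)
      fix i es assume es: "directed_edge_path_from_to (?X' i) v0 v1 es"
      \<comment> \<open>A directed path of the subdivision from \<open>v0\<close> to
        \<open>v1\<close> is the image of a full curve of \<open>F\<close>, so the circle bound of
        the stage applies to it.\<close>
      obtain \<gamma> where \<gamma>: "\<gamma> \<in> F" "\<Union>(set es) = \<gamma> ` {0..1}" using full_path_curve[OF RD(1) es] by blast
      have "set es \<subseteq> E' i" using es by (simp add: directed_edge_path_from_to_def directed_edge_path_def)
      then have "\<gamma> ` {0..1} \<subseteq> \<Union>(E i)" using \<gamma>(2) RD(2)[of i] by blast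
      from RD(8)[OF \<gamma>(1) this]
      show "\<alpha> / 4 \<le> (\<Sum>e' | e' \<in> edges (?X' i) \<and> e' \<subseteq> \<Union>(set es) \<and> op i e' \<noteq> e'. len d (?X i) e')"
        using len_E'[OF E R] \<gamma>(2) by simp
    qed (use \<alpha>_pos in simp)
    show "\<exists>\<alpha>>0. \<forall>i. \<forall>e'\<in>edges (?X' i). op i e' \<noteq> e' \<longrightarrow>
      (\<exists>p\<in>e'. d p (opp_point (?proj i) (op i e') p) \<ge> \<alpha> * len d (?X i) e')"
    proof (intro exI[of _ \<alpha>] conjI allI ballI impI \<alpha>_pos)
      fix i e' assume "e' \<in> edges (?X' i)" and ne: "op i e' \<noteq> e'"
      then have e': "e' \<in> E' i" by simp
      obtain u where u: "u \<in> {lo e'<..<hi e'}" "\<alpha> * (hi e' - lo e') \<le> d (pt e' u) (pt (op i e') u)"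
        using RD(5)[OF e' ne] by (auto simp: bubble_def)
      then have u': "u \<in> {lo e'..hi e'}" by auto
      show "\<exists>p\<in>e'. d p (opp_point (?proj i) (op i e') p) \<ge> \<alpha> * len d (?X i) e'"
        using u(2) opp_point_retract[OF E R e' pt_in[OF seg'[OF e'] u']] height_pt[OF seg'[OF e'] u'] len_E'[OF E R e']
        by (intro bexI[OF _ pt_in[OF seg'[OF e'] u']]) simp
    qed
    show "prob_space (?\<mu> i)" by (rule prob_space_edge_measure[OF E c_nonneg c_total])
    show "space (?\<mu> i) = pts (?X i)" using space_edge_measure[OF E c_nonneg] by simp
    show "sets (?\<mu> i) = sigma_sets (pts (?X i)) {U. openin (Metric_space.mtopology (pts (?X i)) d) U}"
      using sets_edge_measure[OF E c_nonneg] by (simp add: opens_def)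
  next
    show "v0 \<noteq> v1" using source_neq_sink[of e\<^sub>0] edge_systemD(3)[OF e0(1)] e0(4,5) by simp
    show "verts (?X 0) = {v0, v1}" "edges (?X 0) = {pts (?X 0)}" "src (?X 0) (pts (?X 0)) = v0"
      "snk (?X 0) (pts (?X 0)) = v1" using e0 by (auto simp: E0)
    show "len d (?X 0) (pts (?X 0)) = 1"
      using len_E[OF E R, of e\<^sub>0 0] e0(2,3) by (simp add: E0)
    fix A assume A: "A \<in> sets (?\<mu> 0)"
    have "A \<subseteq> e\<^sub>0" using sets.sets_into_space[OF A] space_edge_measure[OF E c_nonneg, of 0] by (simp add: E0)
    then show "measure (?\<mu> 0) A = len d (?X 0) A"
      using measure_sub_edge[OF E c_nonneg A, of e\<^sub>0] by (simp add: E0 c_simps)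
  next
    fix i e' assume "e' \<in> edges (?X' i)"
    then have e': "e' \<in> E' i" by simp
    show "{x \<in> pts (?X (Suc i)). ?proj i x \<in> e'} = e' \<union> op i e'"
      using retract_preimage[OF E R e'] Suc[of i] by simp
    show "e' \<in> edges (?X (Suc i)) \<and> op i e' \<in> edges (?X (Suc i)) \<and>
      src (?X (Suc i)) e' = src (?X' i) e' \<and> snk (?X (Suc i)) e' = snk (?X' i) e'"
      using e' Suc[of i] by simp
    show "?proj i x = x" if "x \<in> e'" for x
      using retract_id[OF E R] that e' RD(2)[of i] by blast
    show "?proj i ` op i e' = e' \<and> (\<forall>x\<in>op i e'. \<forall>y\<in>op i e'. d (?proj i x) (?proj i y) = d x y)"
      using retract_isometric[OF E R e'] by blast
    obtain e where e: "e \<in> E i" "e' \<subseteq> e" using RD(3)[OF e'] by blast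
    note s = seg'[OF e']
    have old: "measure (?\<mu> i) e' = c i e * (hi e' - lo e')"
      by (rule measure_segment[OF E c_nonneg e(1) s e(2)])
    have new: "measure (?\<mu> (Suc i)) f = c (Suc i) f * (hi f - lo f)" if "f = e' \<or> f = op i e'" for f
    proof (rule measure_segment[OF E c_nonneg _ _ order_refl])
      show "f \<in> E (Suc i)" using that e' Suc[of i] by blast
      then show "segment f" by (rule edge_systemD(3)[OF E])
    qed
    note w = next_weight[OF E R e' e, of "c i"]
    show "measure (?\<mu> (Suc i)) e' = measure (?\<mu> i) e'" if "op i e' = e'"
      using old new[of e'] w(1) that by (simp add: c_simps)
    show "measure (?\<mu> (Suc i)) e' = measure (?\<mu> i) e' / 2 \<and> measure (?\<mu> (Suc i)) (op i e') = measure (?\<mu> i) e' / 2"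
      if "op i e' \<noteq> e'"
      using old new[of e'] new[of "op i e'"] w op(2,3)[OF e'] that by (simp add: c_simps)
    show "src (?X (Suc i)) (op i e') = src (?X (Suc i)) e' \<and> snk (?X (Suc i)) (op i e') = snk (?X (Suc i)) e' \<and>
      (\<forall>f\<in>edges (?X (Suc i)). f \<noteq> op i e' \<longrightarrow>
         (op i e' - {src (?X (Suc i)) (op i e'), snk (?X (Suc i)) (op i e')}) \<inter> f = {})"
      if ne: "op i e' \<noteq> e'"
    proof (intro conjI ballI impI)
      fix f assume f: "f \<in> edges (?X (Suc i))" "f \<noteq> op i e'"
      have "z = source (op i e') \<or> z = sink (op i e')" if z: "z \<in> op i e'" "z \<in> f" for z
        using segment_end[OF op(1)[OF e'] z(1)] op_meets[OF E R e' _ ne f(2) z] f(1) Suc[of i] op(2,3)[OF e'] by auto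
      then show "(op i e' - {src (?X (Suc i)) (op i e'), snk (?X (Suc i)) (op i e')}) \<inter> f = {}" by auto
    qed (use op(2-5)[OF e'] in simp_all)
  next
    fix i e e' assume t: "terminal_subedge (?X i) (?X' i) e e'"
    then have "e \<in> E i" "e' \<in> E' i" "e' \<subseteq> e" by (auto simp: terminal_subedge_def)
    then show "op i e' = e'" using terminal_iff[OF E R] t RD(7) by blast
  next
    fix i es assume "directed_edge_path (?X i) es"
    then show "isometric_to_compact_interval d (\<Union>(set es))" by (rule path_isometric[OF E])
  next
    fix i e assume "e \<in> edges (?X (Suc i))"
    then have e: "e \<in> E (Suc i)" by simp
    show "\<exists>k. \<forall>A\<in>sets (?\<mu> (Suc i)). A \<subseteq> e \<longrightarrow> measure (?\<mu> (Suc i)) A = k * len d (?X (Suc i)) A"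
      by (intro exI[of _ "c (Suc i) e"] ballI impI) (rule measure_sub_edge[OF E c_nonneg _ e])
  qed
  moreover have "pts (?X i) \<subseteq> M" for i using segment_subset edge_systemD(3)[OF E] by auto
  moreover have "delta_E d (?X i) (?X' i) \<le> \<delta> i \<and> delta_d d (?X i) (?X' i) \<le> ennreal (\<delta> i)" for i
    using delta_E_le[OF E R \<delta>] delta_d_le[OF E R \<delta>] by blast
  ultimately show ?thesis unfolding contains_thick_inverse_system_def by blast
qed

end

(* The edge of X_0 has length 1, so a system for the metric d itself requires two points of M at
   distance 1; a thick family of length d p q < 1 does not provide them (M may have diameter < 1).
   The metric d / r makes r the unit of length.  If d p q >= 1 then r = 1 is allowed and gives a
   system for d; r = d p q is always allowed. *)
theorem theorem3p11:
  fixes M :: "'a set"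
    and d :: "'a \<Rightarrow> 'a \<Rightarrow> real"
    and p q :: 'a
    and a b r :: real
    and \<Gamma> :: "(real \<Rightarrow> 'a) set"
    and \<delta>' :: "nat \<Rightarrow> real"
  assumes "Metric_space M d"
    and "thick_family M d p q a b \<Gamma>"
    and "\<And>i. 0 < \<delta>' i"
    and "0 < r" and "r \<le> d p q"
  shows "contains_thick_inverse_system M (\<lambda>x y. d x y / r) \<delta>'"
proof -
  have M: "Metric_space M (\<lambda>x y. d x y / r)"
  proof -
    interpret Metric_space M d by fact
    show ?thesis
    proof
      fix x y z assume "x \<in> M" "y \<in> M" "z \<in> M"
      then show "d x z / r \<le> d x y / r + d y z / r"
        using triangle assms(4) by (simp add: divide_right_mono flip: add_divide_distrib)
    qed (use assms(4) commute in auto)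
  qed
  obtain F \<alpha> where F: "curve_family M (\<lambda>x y. d x y / r) 0 1 F" "\<alpha> > 0"
    "uniformly_thick (\<lambda>x y. d x y / r) 0 1 F \<alpha>" "\<forall>\<gamma>\<in>F. \<forall>\<eta>\<in>F. \<gamma> 0 = \<eta> 0 \<and> \<gamma> 1 = \<eta> 1"
    using thick_family_normalize[OF assms(1,2,4,5)] by metis
  obtain \<gamma> where g: "\<gamma> \<in> F" using F(1) by (auto simp: curve_family_def)
  \<comment> \<open>All curves of \<open>F\<close> share their ends, so any one of them supplies the
    two vertices of the first graph.\<close>
  have "thick_curves M (\<lambda>x y. d x y / r) F (\<gamma> 0) (\<gamma> 1) \<alpha>"
    by (intro thick_curves.intro M thick_curves_axioms.intro F(1-3)) (use F(4) g in auto)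
  then show ?thesis by (rule thick_curves.contains_system) (rule assms(3))
qed

end
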